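(* Let $\mathbb{K}$ be a field. Let $S$ be an Arf semigroup such that its blowup $S'$ has the same multiplicity $n_1$ as $S$. Then $$\beta_{i,s}(S')=\beta_{i,\,s+(i+1)n_1}(S),$$ where $\beta_{i,s}$ denotes the graded Betti numbers over $\mathbb{K}$ of the respective semigroup ring.
   Context: A numerical semigroup is a subset $S\subseteq\mathbb{N}=\{0,1,2,\dots\}$ that contains $0$, is closed under addition, and has finite complement in $\mathbb{N}$. A subset of $S$ generates $S$ if every element of $S$ is a linear combination of elements of that subset with non-negative integer coefficients. Every numerical semigroup $S$ has a unique minimal generating set $G(S)$, which is finite and consists exactly of the nonzero elements of $S$ that are not the sum of two nonzero elements of $S$. Write $G(S)=\{n_1,\dots,n_k\}$ with $n_1<\dots<n_k$. The multiplicity of $S$ is $n_1$. An Arf semigroup is a numerical semigroup $S$ such that for each $n\in S$ the set $S(n)=\{s-n : s\in S,\ s\geq n\}$ is also a semigroup; equivalently, $s,t,u\in S$ with $s,t\geq u$ implies $s+t-u\in S$. The blowup of $S$ with $G(S)=\{n_1<\dots<n_k\}$ is the semigroup $S'$ generated by $n_1, n_2-n_1,\dots,n_k-n_1$ (all non-negative integer combinations of these, including $0$). Betti numbers: for a numerical semigroup $S$ with $G(S)=\{n_1<\dots<n_k\}$ and a field $\mathbb{K}$, let $R=\mathbb{K}[t^{n_1},\dots,t^{n_k}]\subseteq \mathbb{K}[t]$ be the semigroup ring, and let $T=\mathbb{K}[X_1,\dots,X_k]$ be the polynomial ring graded by $\deg X_j=n_j$. Then $R\cong T/I$ as graded rings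 via $X_j\mapsto t^{n_j}$, where $I$ is the ideal generated by the binomials $X^\alpha-X^\beta$ with $\sum_j n_j\alpha_j=\sum_j n_j\beta_j$. With $\mathbb{K}=T/(X_1,\dots,X_k)$, the space $\mathrm{Tor}_i^T(R,\mathbb{K})$ inherits a grading from $T$, and $\beta_{i,s}(S)=\dim_{\mathbb{K}}\mathrm{Tor}_i^T(R,\mathbb{K})_s$, the dimension of its part of degree $s$. The Betti numbers of $S'$ are defined in the same way using its own minimal generating set $G(S')$.
   Formalization: The formula is stated for i ≥ 1 only; for i = 0 it is false, since β_{0,0}(S') = 1 while β_{0,n_1}(S) = 0 (the semigroup ring is generated over T by 1 in degree 0). *)

theory Defs
  imports "HOL-Library.Poly_Mapping" "HOL-Computational_Algebra.Polynomial"
begin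

section \<open>Numerical semigroups\<close>

definition numerical_semigroup :: "nat set \<Rightarrow> bool" where
  "numerical_semigroup S \<longleftrightarrow>
     0 \<in> S \<and> (\<forall>a\<in>S. \<forall>b\<in>S. a + b \<in> S) \<and> finite (UNIV - S)"

definition nat_span :: "nat set \<Rightarrow> nat set" where
  "nat_span A = {x. \<exists>F c. finite F \<and> F \<subseteq> A \<and> x = (\<Sum>a\<in>F. c a * a)}"

definition min_gens :: "nat set \<Rightarrow> nat set" where
  "min_gens S = {n \<in> S. n \<noteq> 0 \<and> \<not> (\<exists>a\<in>S. \<exists>b\<in>S. a \<noteq> 0 \<and> b \<noteq> 0 \<and> n = a + b)}"

definition semigroup_multiplicity :: "nat set \<Rightarrow> nat" where
  "semigroup_multiplicity S = Min (min_gens S)"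

definition arf_semigroup :: "nat set \<Rightarrow> bool" where
  "arf_semigroup S \<longleftrightarrow>
     numerical_semigroup S \<and>
     (\<forall>n\<in>S. numerical_semigroup {s - n |s. s \<in> S \<and> s \<ge> n})"

definition blowup :: "nat set \<Rightarrow> nat set" where
  "blowup S = nat_span (insert (semigroup_multiplicity S)
     ((\<lambda>n. n - semigroup_multiplicity S) ` (min_gens S - {semigroup_multiplicity S})))"

text \<open>The irreducible elements collected in \<^const>\<open>min_gens\<close> form the unique minimal
  generating set: they generate, and every generating subset contains them.\<close>

lemma nat_span_0: "0 \<in> nat_span A"
  unfolding nat_span_def by (auto intro!: exI[of _ "{}"])

lemma nat_span_base: "a \<in> A \<Longrightarrow> a \<in> nat_span A"
  unfolding nat_span_def by (auto intro!: exI[of _ "{a}"] exI[of _ "\<lambda>_. 1"])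

lemma nat_span_add:
  assumes "x \<in> nat_span A" "y \<in> nat_span A"
  shows "x + y \<in> nat_span A"
proof -
  obtain F c where F: "finite F" "F \<subseteq> A" "x = (\<Sum>a\<in>F. c a * a)"
    using assms(1) unfolding nat_span_def by blast
  obtain H d where H: "finite H" "H \<subseteq> A" "y = (\<Sum>a\<in>H. d a * a)"
    using assms(2) unfolding nat_span_def by blast
  let ?e = "\<lambda>a. (if a \<in> F then c a else 0) + (if a \<in> H then d a else 0)"
  have x: "x = (\<Sum>a\<in>F \<union> H. (if a \<in> F then c a else 0) * a)"
    unfolding F(3) by (rule sum.mono_neutral_cong_left) (use F(1) H(1) in auto)
  have y: "y = (\<Sum>a\<in>F \<union> H. (if a \<in> H then d a else 0) * a)"
    unfolding H(3) by (rule sum.mono_neutral_cong_left) (use F(1) H(1) in auto)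
  have "x + y = (\<Sum>a\<in>F \<union> H. ?e a * a)"
    unfolding x y sum.distrib[symmetric] by (simp add: distrib_right)
  then show ?thesis
    unfolding nat_span_def using F(1,2) H(1,2) by (intro CollectI exI[of _ "F \<union> H"] exI[of _ ?e]) auto
qed

lemma nat_span_min_gens:
  assumes "numerical_semigroup S"
  shows "nat_span (min_gens S) = S"
proof (rule set_eqI, rule iffI)
  fix x assume "x \<in> nat_span (min_gens S)"
  then obtain F c where F: "finite F" "F \<subseteq> min_gens S" "x = (\<Sum>a\<in>F. c a * a)"
    unfolding nat_span_def by blast
  have S0: "0 \<in> S" and Sadd: "\<And>a b. a \<in> S \<Longrightarrow> b \<in> S \<Longrightarrow> a + b \<in> S"
    using assms unfolding numerical_semigroup_def by auto
  have mult: "k * a \<in> S" if "a \<in> S" for k a :: nat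
    by (induction k) (use that S0 Sadd in auto)
  have "(\<Sum>a\<in>F. c a * a) \<in> S"
    using F(1,2)
  proof (induction F rule: finite_induct)
    case (insert a F)
    have "a \<in> S" using insert.prems unfolding min_gens_def by auto
    then show ?case using insert Sadd mult by auto
  qed (use S0 in auto)
  then show "x \<in> S" using F(3) by simp
next
  fix x assume "x \<in> S"
  then show "x \<in> nat_span (min_gens S)"
  proof (induction x rule: less_induct)
    case (less x)
    show ?case
    proof (cases "x = 0 \<or> x \<in> min_gens S")
      case True
      then show ?thesis using nat_span_0 nat_span_base by auto
    next
      case False
      then obtain a b where ab: "a \<in> S" "b \<in> S" "a \<noteq> 0" "b \<noteq> 0" "x = a + b"
        using less.prems unfolding min_gens_def by auto
      then have "a \<in> nat_span (min_gens S)" "b \<in> nat_span (min_gens S)"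
        using less.IH by auto
      then show ?thesis using nat_span_add ab(5) by simp
    qed
  qed
qed

lemma min_gens_least:
  assumes "numerical_semigroup S" "A \<subseteq> S" "nat_span A = S"
  shows "min_gens S \<subseteq> A"
proof
  fix n assume n: "n \<in> min_gens S"
  then have "n \<in> nat_span A" using assms(3) unfolding min_gens_def by auto
  then obtain F c where F: "finite F" "F \<subseteq> A" "n = (\<Sum>a\<in>F. c a * a)"
    unfolding nat_span_def by blast
  have n0: "n \<noteq> 0" using n unfolding min_gens_def by simp
  then obtain a where a: "a \<in> F" "c a * a \<noteq> 0"
    unfolding F(3) by (meson sum.neutral)
  let ?d = "c(a := c a - 1)"
  have rest: "(\<Sum>b\<in>F - {a}. c b * b) = (\<Sum>b\<in>F - {a}. ?d b * b)"
    by (rule sum.cong) auto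
  have "n = c a * a + (\<Sum>b\<in>F - {a}. ?d b * b)"
    unfolding F(3) rest[symmetric] by (rule sum.remove[OF F(1) a(1)])
  also have "c a * a = a + ?d a * a"
    using a(2) by (cases "c a") simp_all
  also have "a + ?d a * a + (\<Sum>b\<in>F - {a}. ?d b * b) = a + (\<Sum>b\<in>F. ?d b * b)"
    unfolding sum.remove[OF F(1) a(1), of "\<lambda>b. ?d b * b"] by (rule add.assoc)
  finally have eq: "n = a + (\<Sum>b\<in>F. ?d b * b)" .
  have "(\<Sum>b\<in>F. ?d b * b) \<in> nat_span A"
    unfolding nat_span_def using F(1,2) by blast
  then have "(\<Sum>b\<in>F. ?d b * b) \<in> S" using assms(3) by simp
  moreover have "a \<in> S" "a \<noteq> 0" using a F(2) assms(2) by auto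
  ultimately have "(\<Sum>b\<in>F. ?d b * b) = 0"
    using n eq unfolding min_gens_def by blast
  then show "n \<in> A" using eq a(1) F(2) by auto
qed


section \<open>The semigroup ring as a graded module over the polynomial ring\<close>

text \<open>The variables of the polynomial ring are indexed by the minimal generators themselves, so the
  variable indexed by \<open>n\<close> has degree \<open>n\<close>.  A monomial is its exponent vector.\<close>

type_synonym monom = "nat \<Rightarrow>\<^sub>0 nat"
type_synonym 'k mpoly = "monom \<Rightarrow>\<^sub>0 'k"

definition mdeg :: "monom \<Rightarrow> nat" where
  "mdeg \<alpha> = (\<Sum>n\<in>Poly_Mapping.keys \<alpha>. Poly_Mapping.lookup \<alpha> n * n)"

definition poly_ring :: "nat set \<Rightarrow> ('k::field) mpoly set" where
  "poly_ring S = {p. \<forall>\<alpha>\<in>Poly_Mapping.keys p. Poly_Mapping.keys \<alpha> \<subseteq> min_gens S}"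

text \<open>The substitution of \<open>t ^ n\<close> for the variable indexed by \<open>n\<close>; its image on
  \<^const>\<open>poly_ring\<close> is the algebra generated by the powers \<open>t ^ n\<close>, and \<^const>\<open>poly_ring\<close> acts
  on that algebra through it.\<close>

definition subst_t :: "('k::field) mpoly \<Rightarrow> 'k poly" where
  "subst_t p = (\<Sum>\<alpha>\<in>Poly_Mapping.keys p. Polynomial.monom (Poly_Mapping.lookup p \<alpha>) (mdeg \<alpha>))"

definition semigroup_ring :: "nat set \<Rightarrow> ('k::field) poly set" where
  "semigroup_ring S = subst_t ` poly_ring S"


section \<open>Graded free resolutions\<close>

text \<open>Data for a complex of graded free modules augmented to the semigroup ring.  The module in
  homological degree \<open>i\<close> has a basis indexed by \<open>basis F i\<close>, the element with index \<open>b\<close> having degree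
  \<open>bdeg F i b\<close>.  The differential from homological degree \<open>i + 1\<close> to \<open>i\<close> sends the basis element with
  index \<open>b\<close> to \<open>bdiff F i b\<close>, and the augmentation sends the basis element with index \<open>b\<close> in
  homological degree \<open>0\<close> to \<open>baug F b\<close>.\<close>

record (overloaded) 'k free_complex =
  basis :: "nat \<Rightarrow> nat set"
  bdeg :: "nat \<Rightarrow> nat \<Rightarrow> nat"
  bdiff :: "nat \<Rightarrow> nat \<Rightarrow> (nat \<Rightarrow>\<^sub>0 'k mpoly)"
  baug :: "nat \<Rightarrow> 'k poly"

definition free_mod ::
    "nat set \<Rightarrow> ('k::field) free_complex \<Rightarrow> nat \<Rightarrow> (nat \<Rightarrow>\<^sub>0 'k mpoly) set" where
  "free_mod S F i =
     {v. Poly_Mapping.keys v \<subseteq> basis F i \<and> (\<forall>b. Poly_Mapping.lookup v b \<in> poly_ring S)}"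

definition homogeneous ::
    "('k::field) free_complex \<Rightarrow> nat \<Rightarrow> nat \<Rightarrow> (nat \<Rightarrow>\<^sub>0 'k mpoly) \<Rightarrow> bool" where
  "homogeneous F i d v \<longleftrightarrow>
     (\<forall>b. \<forall>\<alpha>\<in>Poly_Mapping.keys (Poly_Mapping.lookup v b). mdeg \<alpha> + bdeg F i b = d)"

definition differential ::
    "('k::field) free_complex \<Rightarrow> nat \<Rightarrow> (nat \<Rightarrow>\<^sub>0 'k mpoly) \<Rightarrow> (nat \<Rightarrow>\<^sub>0 'k mpoly)" where
  "differential F i v =
     (\<Sum>b\<in>Poly_Mapping.keys v. Poly_Mapping.map ((*) (Poly_Mapping.lookup v b)) (bdiff F i b))"

definition aug :: "('k::field) free_complex \<Rightarrow> (nat \<Rightarrow>\<^sub>0 'k mpoly) \<Rightarrow> 'k poly" where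
  "aug F v = (\<Sum>b\<in>Poly_Mapping.keys v. subst_t (Poly_Mapping.lookup v b) * baug F b)"

text \<open>The first condition asks for finitely many basis elements in each degree, so that all graded
  pieces are finite-dimensional over the field.\<close>

definition graded_free_resolution :: "nat set \<Rightarrow> ('k::field) free_complex \<Rightarrow> bool" where
  "graded_free_resolution S F \<longleftrightarrow>
     (\<forall>i d. finite {b \<in> basis F i. bdeg F i b = d}) \<and>
     (\<forall>b\<in>basis F 0. baug F b \<in> semigroup_ring S \<and>
        (\<forall>m. coeff (baug F b) m \<noteq> 0 \<longrightarrow> m = bdeg F 0 b)) \<and>
     (\<forall>i. \<forall>b\<in>basis F (Suc i). bdiff F i b \<in> free_mod S F i \<and>
        homogeneous F i (bdeg F (Suc i) b) (bdiff F i b)) \<and>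
     aug F ` free_mod S F 0 = semigroup_ring S \<and>
     {v \<in> free_mod S F 0. aug F v = 0} = differential F 0 ` free_mod S F 1 \<and>
     (\<forall>i. {v \<in> free_mod S F (Suc i). differential F i v = 0} =
        differential F (Suc i) ` free_mod S F (Suc (Suc i)))"


section \<open>Tor and graded Betti numbers\<close>

text \<open>Tensoring a free module with the residue field (the polynomial ring modulo its variables) gives
  the vector space with the same graded basis.  The induced differential keeps only the constant
  coefficients of the entries of the original one.  The degrees are taken in the integers, so the
  pieces of negative degree are zero.\<close>

definition tensor_piece :: "('k::field) free_complex \<Rightarrow> nat \<Rightarrow> int \<Rightarrow> (nat \<Rightarrow>\<^sub>0 'k) set" where
  "tensor_piece F i s = {w. Poly_Mapping.keys w \<subseteq> {b \<in> basis F i. int (bdeg F i b) = s}}"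

definition tensor_diff :: "('k::field) free_complex \<Rightarrow> nat \<Rightarrow> (nat \<Rightarrow>\<^sub>0 'k) \<Rightarrow> (nat \<Rightarrow>\<^sub>0 'k)" where
  "tensor_diff F i w =
     (\<Sum>b\<in>Poly_Mapping.keys w.
        Poly_Mapping.map (\<lambda>p. Poly_Mapping.lookup w b * Poly_Mapping.lookup p 0) (bdiff F i b))"

definition tor_cycles :: "('k::field) free_complex \<Rightarrow> nat \<Rightarrow> int \<Rightarrow> (nat \<Rightarrow>\<^sub>0 'k) set" where
  "tor_cycles F i s =
     (case i of 0 \<Rightarrow> tensor_piece F 0 s
      | Suc j \<Rightarrow> {w \<in> tensor_piece F (Suc j) s. tensor_diff F j w = 0})"

definition tor_boundaries :: "('k::field) free_complex \<Rightarrow> nat \<Rightarrow> int \<Rightarrow> (nat \<Rightarrow>\<^sub>0 'k) set" where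
  "tor_boundaries F i s = tensor_diff F i ` tensor_piece F (Suc i) s"

lemma lookup_map_mult:
  "Poly_Mapping.lookup (Poly_Mapping.map ((*) c) v) k = c * Poly_Mapping.lookup v k"
  for c :: "'b::semiring_0"
  by (simp add: Poly_Mapping.map.rep_eq when_def)

interpretation kvec: vector_space "\<lambda>c::'k::field. Poly_Mapping.map ((*) c) :: (nat \<Rightarrow>\<^sub>0 'k) \<Rightarrow> _"
  by unfold_locales
    (rule poly_mapping_eqI, simp add: lookup_map_mult lookup_add distrib_left distrib_right mult.assoc)+

text \<open>The dimension of the quotient of cycles by boundaries in degree \<open>s\<close>; both are
  finite-dimensional and the boundaries are cycles, so it is the difference of the dimensions.  A
  graded free resolution of the required kind exists (generate each kernel by bases of its graded
  pieces, which are finite-dimensional), and Tor does not depend on the choice.\<close>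

definition betti :: "'k::field itself \<Rightarrow> nat set \<Rightarrow> nat \<Rightarrow> int \<Rightarrow> nat" where
  "betti K S i s =
     (let F = (SOME F :: 'k free_complex. graded_free_resolution S F)
      in kvec.dim (tor_cycles F i s) - kvec.dim (tor_boundaries F i s))"

end

theory Submission
  imports Defs "HOL-Library.Function_Algebras" "HOL-Library.Nat_Bijection"
begin

text \<open>
  Tensoring a graded free resolution \<open>F\<close> of the semigroup ring \<open>R\<close> with the Koszul complex of the
  variables gives a double complex whose rows and columns are exact away from the edge. Shifting
  dimensions along its diagonal identifies the homology of \<open>F \<otimes> K\<close> in degree \<open>s\<close> with the Koszul homology of \<open>R\<close>, which in
  degree \<open>s\<close> is the chain complex of a simplicial complex: \<open>J \<subseteq> G(S)\<close> carries a copy of \<open>K\<close> iff \<open>s - \<Sum>J \<in> S\<close>.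
  An Arf semigroup has maximal embedding dimension: with \<open>m\<close> the multiplicity and
  \<open>N = G(S) - {m}\<close>, the element \<open>t\<^sup>m\<close> is regular on \<open>R\<close>, and \<open>R/(t\<^sup>m)\<close> is spanned by \<open>1\<close> and the \<open>t\<^sup>n\<close>
  with \<open>n \<in> N\<close>, all products of the latter being \<open>0\<close>. This yields, for \<open>i \<ge> 1\<close>,
  \<open>\<beta>(i,s) = #{(J,n). |J| = i, n + \<Sum>J = s} - #{J. |J| = i + 1, \<Sum>J = s}\<close>, where \<open>J \<subseteq> N\<close> and \<open>n \<in> N\<close>.
  Both terms count sums of \<open>i + 1\<close> elements of \<open>N\<close>, and blowing up shifts \<open>N\<close> by \<open>-m\<close>.
\<close>

section \<open>Dimensions of quotients\<close>

text \<open>\<open>betti\<close> reads its numbers off one resolution picked by \<open>SOME\<close>,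
  of which minimality is not known. So the argument must work for every resolution, and existence
  must be proved before the choice means anything. Koszul homology of R does not mention the
  resolution, which is why Tor is computed from both sides. The Betti formula comes from A = R/(t^m)
  and the Koszul complex on the variables in N. Let V be the span of the t^n in A. In 0
  \<rightarrow> V \<rightarrow> A \<rightarrow> K \<rightarrow> 0 every variable acts as zero on V
  and on K, so the outer homologies are V \<otimes> \<Lambda>^i and \<Lambda>^i. The connecting map
  \<Lambda>^(i+1) \<rightarrow> V \<otimes> \<Lambda>^i sends e_J to the signed sum of the t^j
  \<otimes> e_(J - j). It is injective, and so is the one below it as long as i \<ge> 1; hence the
  homology of A in degree i is its cokernel. The two cardinalities are the dimensions of the two
  spaces in degree s.\<close>

lemma (in vector_space) finite_basis_of_subset:
  assumes "finite A" "V \<subseteq> span A"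
  obtains B where "finite B" "B \<subseteq> V" "independent B" "V \<subseteq> span B"
proof -
  obtain B where B: "B \<subseteq> V" "independent B" "V \<subseteq> span B"
    using maximal_independent_subset by blast
  moreover have "finite B"
    using independent_span_bound[OF assms(1) B(2)] B(1) assms(2) by blast
  ultimately show thesis using that by blast
qed

text \<open>Rank-nullity for a finite-dimensional \<open>V\<close> inside a possibly
  infinite-dimensional space, as is the case for the chain spaces below. A basis of the kernel is
  extended to one of \<open>V\<close>, and \<open>f\<close> is injective on the span of the added
  vectors.\<close>

lemma (in vector_space_pair) dim_image_plus_kernel:
  assumes f: "Vector_Spaces.linear s1 s2 f" and V: "vs1.subspace V" and A: "finite A" "V \<subseteq> vs1.span A"
  shows "vs1.dim V = vs2.dim (f ` V) + vs1.dim {v \<in> V. f v = 0}"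
proof -
  interpret f: Vector_Spaces.linear s1 s2 f by (rule f)
  let ?K = "{v \<in> V. f v = 0}"
  obtain BK where BK: "BK \<subseteq> ?K" "vs1.independent BK" "?K \<subseteq> vs1.span BK"
    using vs1.maximal_independent_subset by blast
  obtain B where B: "BK \<subseteq> B" "B \<subseteq> V" "vs1.independent B" "V \<subseteq> vs1.span B"
    using vs1.maximal_independent_subset_extend[of BK V] BK by auto
  have finB: "finite B"
    using vs1.independent_span_bound[OF A(1) B(3)] B(2) A(2) by blast
  let ?C = "B - BK"
  \<comment> \<open>Such an \<open>x\<close> lies in the spans of both \<open>BK\<close> and
    \<open>B - BK\<close>; the difference of the two expansions is a linear relation on the
    independent set \<open>B\<close>.\<close>
  have zero: "x = 0" if x: "x \<in> vs1.span ?C" "f x = 0" for x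
  proof -
    have "x \<in> V" using x(1) B(2) V vs1.span_minimal by blast
    then have xK: "x \<in> vs1.span BK" using x(2) BK(3) by auto
    obtain u where u: "x = (\<Sum>c\<in>?C. s1 (u c) c)"
      using x(1) finB by (auto simp: vs1.span_finite)
    obtain w where w: "x = (\<Sum>c\<in>BK. s1 (w c) c)"
      using xK vs1.span_finite[OF finite_subset[OF B(1) finB]] by auto
    let ?g = "\<lambda>c. if c \<in> BK then - w c else u c"
    have "(\<Sum>c\<in>B. s1 (?g c) c) = (\<Sum>c\<in>?C. s1 (?g c) c) + (\<Sum>c\<in>BK. s1 (?g c) c)"
      using finB B(1) by (rule sum.subset_diff[rotated])
    also have "(\<Sum>c\<in>?C. s1 (?g c) c) = x" unfolding u by (rule sum.cong) auto
    also have "(\<Sum>c\<in>BK. s1 (?g c) c) = - x"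
      unfolding w sum_negf[symmetric] by (rule sum.cong) auto
    finally have "(\<Sum>c\<in>B. s1 (?g c) c) = 0" by simp
    then have "?g c = 0" if "c \<in> B" for c
      using that by (rule vs1.independentD[OF B(3) finB subset_refl, where u = ?g])
    then have "u c = 0" if "c \<in> ?C" for c using that by fastforce
    then show "x = 0" unfolding u by simp
  qed
  have inj: "inj_on f (vs1.span ?C)"
    using zero f.inj_on_iff_eq_0[of "vs1.span ?C"] by (auto simp: vs1.subspace_span)
  have indC: "vs1.independent ?C" using B(3) vs1.independent_mono by blast
  have indfC: "vs2.independent (f ` ?C)"
    by (rule f.independent_injective_image[OF indC inj])
  have "f ` V \<subseteq> vs2.span (f ` ?C)"
  proof -
    have "f ` V \<subseteq> vs2.span (f ` B)" using f.spans_image B(4) by blast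
    also have "f ` B \<subseteq> insert 0 (f ` ?C)" using BK(1) by auto
    then have "vs2.span (f ` B) \<subseteq> vs2.span (f ` ?C)"
      using vs2.span_mono[of "f ` B" "insert 0 (f ` ?C)"] by simp
    finally show ?thesis .
  qed
  moreover have "f ` ?C \<subseteq> f ` V" using B(2) by auto
  ultimately have "vs2.dim (f ` V) = card (f ` ?C)"
    using vs2.basis_card_eq_dim[OF _ _ indfC] by simp
  also have "\<dots> = card ?C"
    using inj card_image inj_on_subset vs1.span_superset by metis
  finally have 1: "vs2.dim (f ` V) = card B - card BK"
    using card_Diff_subset[of BK B] finB B(1) finite_subset by metis
  have "vs1.dim ?K = card BK" using vs1.basis_card_eq_dim[OF BK(1,3,2)] by simp
  moreover have "vs1.dim V = card B" using vs1.basis_card_eq_dim[OF B(2,4,3)] by simp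
  moreover have "card BK \<le> card B" using card_mono finB B(1) by blast
  ultimately show ?thesis using 1 by simp
qed

lemma (in vector_space_pair) dim_quotient_image:
  assumes f: "Vector_Spaces.linear s1 s2 f" and V: "vs1.subspace V" and A: "finite A" "V \<subseteq> vs1.span A"
    and W: "vs2.subspace W" "W \<subseteq> f ` V"
  shows "vs1.dim V - vs1.dim {v \<in> V. f v \<in> W} = vs2.dim (f ` V) - vs2.dim W"
proof -
  interpret f: Vector_Spaces.linear s1 s2 f by (rule f)
  let ?U = "{v \<in> V. f v \<in> W}"
  have U: "vs1.subspace ?U"
    using vs1.subspace_inter[OF V f.subspace_linear_preimage[OF W(1)]]
    by (simp add: Int_def)
  have "f ` ?U = W" using W(2) by auto
  moreover have "{v \<in> ?U. f v = 0} = {v \<in> V. f v = 0}"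
    using vs2.subspace_0[OF W(1)] by auto
  ultimately have "vs1.dim ?U = vs2.dim W + vs1.dim {v \<in> V. f v = 0}"
    using dim_image_plus_kernel[OF f U A(1)] A(2) by auto
  then show ?thesis using dim_image_plus_kernel[OF f V A] by simp
qed

text \<open>Both quotients are \<open>V\<close> modulo one and the same subspace, the common
  preimage of \<open>W\<close> and \<open>X\<close>. This replaces every isomorphism between
  homology spaces: no quotient space and no choice of lifts is needed.\<close>

lemma dim_quotient_eqI:
  assumes f: "Vector_Spaces.linear s1 s2 f" and g: "Vector_Spaces.linear s1 s3 g"
    and V: "module.subspace s1 V" and A: "finite A" "V \<subseteq> module.span s1 A"
    and W: "module.subspace s2 W" "W \<subseteq> f ` V"
    and X: "module.subspace s3 X" "X \<subseteq> g ` V"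
    and eq: "\<And>v. v \<in> V \<Longrightarrow> f v \<in> W \<longleftrightarrow> g v \<in> X"
  shows "vector_space.dim s2 (f ` V) - vector_space.dim s2 W =
    vector_space.dim s3 (g ` V) - vector_space.dim s3 X"
proof -
  interpret f: Vector_Spaces.linear s1 s2 f by (rule f)
  interpret g: Vector_Spaces.linear s1 s3 g by (rule g)
  interpret f: vector_space_pair s1 s2 by unfold_locales
  interpret g: vector_space_pair s1 s3 by unfold_locales
  have "{v \<in> V. f v \<in> W} = {v \<in> V. g v \<in> X}" using eq by auto
  then show ?thesis
    using f.dim_quotient_image[OF f V A W] g.dim_quotient_image[OF g V A X] by simp
qed

text \<open>The connecting isomorphism of the long exact sequence of \<open>0 \<rightarrow> N \<rightarrow> E \<rightarrow> M \<rightarrow> 0\<close> with \<open>E\<close> exact in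
  the middle degree. No vanishing is assumed one degree lower, so there the homology of \<open>N\<close> is cut
  down to the boundaries of \<open>E\<close>.\<close>

lemma dim_homology_shift:
  fixes dE :: "'a::ab_group_add \<Rightarrow> 'a" and f :: "'a \<Rightarrow> 'b::ab_group_add"
  assumes dE: "Vector_Spaces.linear s1 s1 dE" and f: "Vector_Spaces.linear s1 s2 f"
    and dM: "Vector_Spaces.linear s2 s2 dM"
    and sub: "module.subspace s1 E0" "module.subspace s1 E1" "module.subspace s1 E2"
    and fin: "finite A" "E1 \<subseteq> module.span s1 A"
    and maps: "dE ` E1 \<subseteq> E0"
    and surj: "f ` E1 = M1" "f ` E2 = M2"
    and chain: "\<And>e. e \<in> E1 \<union> E2 \<Longrightarrow> f (dE e) = dM (f e)"
    and exact: "{e \<in> E1. dE e = 0} = dE ` E2"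
  shows "vector_space.dim s2 {z \<in> M1. dM z = 0} - vector_space.dim s2 (dM ` M2) =
    vector_space.dim s1 ({e \<in> E0. f e = 0} \<inter> dE ` E1) -
    vector_space.dim s1 (dE ` {e \<in> E1. f e = 0})"
proof -
  interpret f: Vector_Spaces.linear s1 s2 f by (rule f)
  interpret dE: Vector_Spaces.linear s1 s1 dE by (rule dE)
  interpret dM: Vector_Spaces.linear s2 s2 dM by (rule dM)
  \<comment> \<open>Each \<open>e\<close> in \<open>?V\<close> links the cycle \<open>f e\<close> of
    \<open>M\<close> to the element \<open>dE e\<close> killed by \<open>f\<close>. This relation is
    the connecting homomorphism, with \<open>f\<close> and \<open>dE\<close> as its two
    projections.\<close>
  let ?V = "{e \<in> E1. dM (f e) = 0}"
  have V: "f.vs1.subspace ?V"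
    using f.vs1.subspace_inter[OF sub(2) f.subspace_linear_preimage[OF dM.subspace_kernel]]
    by (simp add: Int_def)
  have N1: "f.vs1.subspace {e \<in> E1. f e = 0}"
    using f.vs1.subspace_inter[OF sub(2) f.subspace_kernel] by (simp add: Int_def)
  have im1: "f ` ?V = {z \<in> M1. dM z = 0}" using surj by auto
  have im2: "dE ` ?V = {e \<in> E0. f e = 0} \<inter> dE ` E1" using chain maps by auto
  have "dM (f (dE e)) = 0" if "e \<in> E2" for e
  proof -
    have "dE e \<in> E1" "dE (dE e) = 0" using exact that by auto
    then show ?thesis using chain[of "dE e"] by simp
  qed
  then have B1: "dM ` M2 \<subseteq> f ` ?V"
    using exact chain surj(2) by (force simp: image_iff)
  have M2: "f.vs2.subspace (dM ` M2)"
    using surj(2) sub(3) f.subspace_image dM.subspace_image by metis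
  have B2: "dE ` {e \<in> E1. f e = 0} \<subseteq> dE ` ?V" by auto
  have iff: "f v \<in> dM ` M2 \<longleftrightarrow> dE v \<in> dE ` {e \<in> E1. f e = 0}" if v: "v \<in> ?V" for v
  proof
    assume "f v \<in> dM ` M2"
    then obtain e where e: "e \<in> E2" "f v = dM (f e)" using surj(2) by auto
    have de: "dE e \<in> E1" "dE (dE e) = 0" using exact e(1) by auto
    have "f (v - dE e) = 0" using chain[of e] e by (simp add: f.diff)
    moreover have "v - dE e \<in> E1" using v de sub(2) f.vs1.subspace_diff by auto
    moreover have "dE v = dE (v - dE e)" using de by (simp add: dE.diff)
    ultimately show "dE v \<in> dE ` {e \<in> E1. f e = 0}" by blast
  next
    assume "dE v \<in> dE ` {e \<in> E1. f e = 0}"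
    then obtain n where n: "n \<in> E1" "f n = 0" "dE v = dE n" by auto
    have "v - n \<in> {e \<in> E1. dE e = 0}"
      using v n sub(2) f.vs1.subspace_diff by (auto simp: dE.diff)
    then obtain e where e: "e \<in> E2" "v - n = dE e" using exact by auto
    have "f v = f (v - n)" using n by (simp add: f.diff)
    also have "\<dots> = dM (f e)" using e chain by simp
    finally show "f v \<in> dM ` M2" using e(1) surj(2) by auto
  qed
  have "?V \<subseteq> f.vs1.span A" using fin(2) by auto
  from dim_quotient_eqI[OF f dE V fin(1) this M2 B1 dE.subspace_image[OF N1] B2 iff]
  show ?thesis unfolding im1 im2 by simp
qed

section \<open>The Koszul differential\<close>

text \<open>The sign of moving \<open>j\<close> past the smaller elements of \<open>J\<close> in an
  exterior product. It is applied as a negation, so that it serves vectors, polynomials and scalars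
  alike.\<close>

definition ksign :: "nat \<Rightarrow> nat set \<Rightarrow> 'm \<Rightarrow> 'm::ab_group_add" where
  "ksign j J x = (if even (card {k \<in> J. k < j}) then x else - x)"

text \<open>\<open>c J\<close> is the coefficient of the exterior basis element indexed by
  \<open>J\<close>; the sum collects what reaches \<open>J\<close> from the sets with one more
  element. The operators \<open>X j\<close> are left open: they are the variables on free modules,
  and the identity once a degree of R is fixed.\<close>

definition koszul ::
    "nat set \<Rightarrow> (nat \<Rightarrow> 'm \<Rightarrow> 'm) \<Rightarrow> (nat set \<Rightarrow> 'm::ab_group_add) \<Rightarrow> nat set \<Rightarrow> 'm" where
  "koszul G X c J = (\<Sum>j\<in>G - J. ksign j J (X j (c (insert j J))))"

lemma ksign_add: "ksign j J (x + y) = ksign j J x + ksign j J y"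
  and ksign_minus: "ksign j J (- x) = - ksign j J x"
  and ksign_zero [simp]: "ksign j J 0 = 0"
  and ksign_eq_0_iff [simp]: "ksign j J x = 0 \<longleftrightarrow> x = 0"
  by (simp_all add: ksign_def)

lemma ksign_sum: "ksign j J (sum f A) = (\<Sum>a\<in>A. ksign j J (f a))"
  by (simp add: ksign_def sum_negf)

lemma ksign_commute: "ksign j J (ksign k L x) = ksign k L (ksign j J x)"
  by (simp add: ksign_def)

lemma ksign_insert:
  assumes "i \<notin> J"
  shows "ksign j (insert i J) x = (if i < j then - ksign j J x else ksign j J x)"
proof (cases "i < j")
  case True
  have "{k \<in> insert i J. k < j} = insert i {k \<in> J. k < j}" using True by auto
  moreover have "finite {k \<in> J. k < j}" by (rule finite_subset[of _ "{..<j}"]) auto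
  ultimately have "card {k \<in> insert i J. k < j} = Suc (card {k \<in> J. k < j})"
    using assms by simp
  then show ?thesis using True by (simp add: ksign_def)
next
  case False
  then have "{k \<in> insert i J. k < j} = {k \<in> J. k < j}" by auto
  then show ?thesis using False by (simp add: ksign_def)
qed

lemma ksign_least: "(\<And>k. k \<in> J \<Longrightarrow> j \<le> k) \<Longrightarrow> ksign j J x = x"
proof -
  assume "\<And>k. k \<in> J \<Longrightarrow> j \<le> k"
  then have "{k \<in> J. k < j} = {}" by fastforce
  then show ?thesis by (simp add: ksign_def del: Collect_empty_eq)
qed

text \<open>Removing \<open>j\<close> and then \<open>k\<close> uses the same operators as removing
  \<open>k\<close> and then \<open>j\<close>, with opposite sign; the pairs with
  \<open>j < k\<close> cancel those with \<open>k < j\<close>.\<close>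

lemma koszul_koszul:
  fixes X :: "nat \<Rightarrow> 'm \<Rightarrow> 'm::ab_group_add"
  assumes G: "finite G" and add: "\<And>j x y. X j (x + y) = X j x + X j y"
    and comm: "\<And>j k x. X j (X k x) = X k (X j x)"
  shows "koszul G X (koszul G X c) J = 0"
proof -
  have X0: "X j 0 = 0" for j using add[of j 0 0] by simp
  have Xneg: "X j (- x) = - X j x" for j x
    using add[of j x "- x"] X0 by (simp add: eq_neg_iff_add_eq_0 add.commute)
  have Xsum: "X j (sum f A) = (\<Sum>a\<in>A. X j (f a))" for j f and A :: "nat set"
    by (induction A rule: infinite_finite_induct) (simp_all add: X0 add)
  have Xsgn: "X j (ksign k L x) = ksign k L (X j x)" for j k L x
    by (simp add: ksign_def Xneg)
  define T where "T = (\<lambda>(j, k). ksign j J (ksign k (insert j J) (X j (X k (c (insert k (insert j J)))))))"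
  let ?D = "SIGMA j:G - J. G - insert j J"
  let ?A = "{(j, k). j \<in> G - J \<and> k \<in> G - J \<and> j < k}"
  let ?B = "{(j, k). j \<in> G - J \<and> k \<in> G - J \<and> k < j}"
  have fin: "finite ?A" "finite ?B"
    by (rule finite_subset[of _ "G \<times> G"]; use G in auto)+
  have "koszul G X (koszul G X c) J = (\<Sum>j\<in>G - J. \<Sum>k\<in>G - insert j J. T (j, k))"
    by (simp add: koszul_def Xsum Xsgn ksign_sum T_def)
  also have "\<dots> = sum T ?D" using G by (subst sum.Sigma) auto
  also have "?D = ?A \<union> ?B" by auto
  also have "sum T (?A \<union> ?B) = sum T ?A + sum T ?B"
    by (rule sum.union_disjoint[OF fin]) auto
  also have "sum T ?B = (\<Sum>p\<in>?A. T (prod.swap p))"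
    by (rule sum.reindex_bij_witness[of _ prod.swap prod.swap]) auto
  also have "\<dots> = (\<Sum>p\<in>?A. - T p)"
  proof (rule sum.cong[OF refl])
    fix p assume "p \<in> ?A"
    then obtain j k where p: "p = (j, k)" "j \<notin> J" "k \<notin> J" "j < k" by auto
    then show "T (prod.swap p) = - T p"
      by (simp add: T_def ksign_insert ksign_minus comm[of k j] insert_commute[of j k]
          ksign_commute[of k J j])
  qed
  finally show ?thesis by (simp add: sum_negf)
qed

section \<open>Chains as vector spaces of functions on sets of generators\<close>

lemma vector_space_pointwise:
  assumes "vector_space s"
  shows "vector_space (\<lambda>k c x. s k (c x))"
proof -
  interpret vector_space s by (rule assms)
  show ?thesis
    by unfold_locales (auto simp: fun_eq_iff scale_right_distrib scale_left_distrib)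
qed

lemma linear_pointwise:
  assumes "Vector_Spaces.linear s1 s2 f"
  shows "Vector_Spaces.linear (\<lambda>k c x. s1 k (c x)) (\<lambda>k c x. s2 k (c x)) (\<lambda>c x. f (c x))"
proof -
  interpret Vector_Spaces.linear s1 s2 f by (rule assms)
  show ?thesis
    unfolding Vector_Spaces.linear_iff
    using vector_space_pointwise[OF vs1.vector_space_axioms]
      vector_space_pointwise[OF vs2.vector_space_axioms]
    by (auto simp: fun_eq_iff add scale)
qed

lemma linear_koszul:
  assumes "vector_space s" "\<And>j. Vector_Spaces.linear s s (X j)"
  shows "Vector_Spaces.linear (\<lambda>k c x. s k (c x)) (\<lambda>k c x. s k (c x)) (koszul G X)"
proof -
  interpret vector_space s by (rule assms(1))
  have X: "X j (x + y) = X j x + X j y" "X j (s k x) = s k (X j x)" for j k x y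
    using assms(2)[of j] by (auto simp: Vector_Spaces.linear_iff)
  have sgn: "ksign j J (s k x) = s k (ksign j J x)" for j J k x
    by (simp add: ksign_def)
  have "koszul G X (\<lambda>x. c x + d x) J = koszul G X c J + koszul G X d J" for c d J
    unfolding koszul_def X ksign_add by (rule sum.distrib)
  moreover have "koszul G X (\<lambda>x. s k (c x)) J = s k (koszul G X c J)" for k c J
    unfolding koszul_def X sgn by (rule scale_sum_right[symmetric])
  ultimately show ?thesis
    unfolding Vector_Spaces.linear_iff plus_fun_def
    using vector_space_pointwise[OF assms(1)] by (intro conjI allI ext) auto
qed

text \<open>The indicator functions of the points of \<open>P\<close> are a basis. This is how
  counting sets of generators becomes a dimension.\<close>

lemma finite_support_subspace:
  assumes "finite P"
  shows "\<exists>A. finite A \<and> {c :: 'a \<Rightarrow> 'k::field. \<forall>x. c x \<noteq> 0 \<longrightarrow> x \<in> P} \<subseteq>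
      module.span (\<lambda>k c x. k * c x) A"
    and "vector_space.dim (\<lambda>k c x. k * c x) {c :: 'a \<Rightarrow> 'k. \<forall>x. c x \<noteq> 0 \<longrightarrow> x \<in> P} = card P"
proof -
  interpret s: vector_space "(*) :: 'k \<Rightarrow> 'k \<Rightarrow> 'k" by unfold_locales (auto simp: algebra_simps)
  interpret v: vector_space "\<lambda>k c x. k * c x :: 'k" by (rule vector_space_pointwise) unfold_locales
  let ?W = "{c :: 'a \<Rightarrow> 'k. \<forall>x. c x \<noteq> 0 \<longrightarrow> x \<in> P}"
  define e where "e p = (\<lambda>x. if x = p then 1 else 0 :: 'k)" for p :: 'a
  have inj: "inj e" by (rule injI) (metis e_def zero_neq_one)
  have sum_e: "(\<Sum>p\<in>P. (\<lambda>x. u p * e p x)) = (\<lambda>x. if x \<in> P then u x else 0)" for u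
  proof
    fix x
    have "(\<Sum>p\<in>P. (\<lambda>x. u p * e p x)) x = (\<Sum>p\<in>P. u p * e p x)"
      using assms by (induction P rule: finite_induct) auto
    also have "\<dots> = (if x \<in> P then u x else 0)"
      using assms by (simp add: e_def if_distrib cong: if_cong)
    finally show "(\<Sum>p\<in>P. (\<lambda>x. u p * e p x)) x = (if x \<in> P then u x else 0)" .
  qed
  have span: "?W \<subseteq> v.span (e ` P)"
  proof
    fix c assume "c \<in> ?W"
    then have "c = (\<Sum>p\<in>P. (\<lambda>x. c p * e p x))" unfolding sum_e by (intro ext) auto
    also have "\<dots> \<in> v.span (e ` P)"
      by (intro v.span_sum v.span_scale v.span_base) auto
    finally show "c \<in> v.span (e ` P)" .
  qed
  then show "\<exists>A. finite A \<and> ?W \<subseteq> v.span A" using assms by (intro exI[of _ "e ` P"]) auto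
  have "v.independent (e ` P)"
  proof (rule v.independent_if_scalars_zero)
    fix u x assume *: "(\<Sum>x\<in>e ` P. (\<lambda>y. u x * x y)) = 0" and x: "x \<in> e ` P"
    have "(\<lambda>x. if x \<in> P then u (e x) else 0) = 0"
      using * unfolding sum_e[symmetric] sum.reindex[OF inj_on_subset[OF inj subset_UNIV]]
      by (simp add: o_def)
    from fun_cong[OF this] have *: "(if p \<in> P then u (e p) else 0) = 0" for p by simp
    have "p \<in> P \<Longrightarrow> u (e p) = 0" for p
      using *[of p] by simp
    then show "u x = 0" using x by fastforce
  qed (use assms in simp)
  moreover have "e ` P \<subseteq> ?W" by (auto simp: e_def split: if_splits)
  ultimately have "v.dim ?W = card (e ` P)" using v.basis_card_eq_dim[OF _ span] by simp
  then show "v.dim ?W = card P" by (simp add: card_image inj_on_subset[OF inj])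
qed

section \<open>Koszul homology of semigroups of maximal embedding dimension\<close>

lemma subspace_support:
  "module.subspace (\<lambda>k c x. k * c x) {c :: 'a \<Rightarrow> 'k::field. \<forall>x. c x \<noteq> 0 \<longrightarrow> R x}"
proof -
  interpret v: vector_space "\<lambda>k c x. k * c x :: 'k"
    by (rule vector_space_pointwise) (unfold_locales, auto simp: algebra_simps)
  have "c x + d x \<noteq> 0 \<Longrightarrow> c x \<noteq> 0 \<or> d x \<noteq> 0" for c d :: "'a \<Rightarrow> 'k" and x by auto
  then show ?thesis by (intro v.subspaceI) (fastforce, fastforce, fastforce)
qed

lemma koszul_cong:
  "(\<And>j. j \<in> G - J \<Longrightarrow> c (insert j J) = d (insert j J)) \<Longrightarrow> koszul G X c J = koszul G X d J"
  by (simp add: koszul_def)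

text \<open>Each graded piece of R is zero or spanned by a single power of t, and multiplication by
  t^j carries one such power to another. In a fixed degree the variables therefore act as the
  identity on coefficients, and all information sits in the support.\<close>

abbreviation simplicial_koszul :: "nat set \<Rightarrow> (nat set \<Rightarrow> 'm::ab_group_add) \<Rightarrow> nat set \<Rightarrow> 'm" where
  "simplicial_koszul G \<equiv> koszul G (\<lambda>_ x. x)"

lemma simplicial_koszul_minus:
  "simplicial_koszul G (\<lambda>J. - c J) J = - simplicial_koszul G c J"
  by (simp add: koszul_def ksign_minus sum_negf)

lemma simplicial_koszul_nonzeroD:
  assumes "simplicial_koszul G c J \<noteq> 0"
  obtains j where "j \<in> G" "j \<notin> J" "c (insert j J) \<noteq> 0"
proof -
  have "\<exists>j\<in>G - J. ksign j J (c (insert j J)) \<noteq> 0"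
    using assms unfolding koszul_def by (meson sum.neutral)
  then show thesis using that by auto
qed

lemma simplicial_koszul_single:
  assumes "finite G" "j \<in> G" "j \<notin> J"
    and "\<And>k. k \<in> G \<Longrightarrow> k \<notin> J \<Longrightarrow> k \<noteq> j \<Longrightarrow> c (insert k J) = 0"
  shows "simplicial_koszul G c J = ksign j J (c (insert j J))"
proof -
  have "simplicial_koszul G c J = (\<Sum>k\<in>{j}. ksign k J (c (insert k J)))"
    unfolding koszul_def by (rule sum.mono_neutral_right) (use assms in auto)
  then show ?thesis by simp
qed

text \<open>As \<open>m\<close> is least, it carries the sign + itself and flips the sign of every
  other generator. Splitting a chain into the components without and with \<open>m\<close> thus
  exhibits the differential as a mapping cone, whose connecting map is multiplication by
  t^m.\<close>

lemma simplicial_koszul_cone: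
  assumes "finite G" "m \<in> G" "J \<subseteq> G" "m \<notin> J" "\<And>k. k \<in> G \<Longrightarrow> m \<le> k"
  shows "simplicial_koszul G c J = c (insert m J) + simplicial_koszul (G - {m}) c J"
    and "simplicial_koszul G c (insert m J) =
      - simplicial_koszul (G - {m}) (\<lambda>J. c (insert m J)) J"
proof -
  have "G - J = insert m (G - {m} - J)" using assms(2,4) by auto
  moreover have "ksign m J x = x" for x :: 'a using ksign_least assms(3,5) by blast
  ultimately show "simplicial_koszul G c J = c (insert m J) + simplicial_koszul (G - {m}) c J"
    using assms(1) by (simp add: koszul_def)
  have eq: "G - insert m J = G - {m} - J" by auto
  have "m < k" if "k \<in> G - {m} - J" for k using assms(5)[of k] that by force
  then show "simplicial_koszul G c (insert m J) =
      - simplicial_koszul (G - {m}) (\<lambda>J. c (insert m J)) J"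
    unfolding koszul_def eq sum_negf[symmetric]
    by (intro sum.cong refl) (simp add: ksign_insert[OF assms(4)] insert_commute)
qed

text \<open>The degree \<open>s\<close> part of the Koszul complex of R in exterior degree
  \<open>q\<close>. The condition is written additively over the integers, so that no truncated
  \<open>s - \<Sum>J\<close> occurs.\<close>

definition degree_chains :: "nat set \<Rightarrow> nat \<Rightarrow> int \<Rightarrow> (nat set \<Rightarrow> 'k::field) set" where
  "degree_chains S q s =
     {a. \<forall>J. a J \<noteq> 0 \<longrightarrow> J \<subseteq> min_gens S \<and> card J = q \<and> (\<exists>u\<in>S. int (u + \<Sum>J) = s)}"

lemma linear_simplicial_koszul:
  "Vector_Spaces.linear (\<lambda>k c x. k * c x) (\<lambda>k c x. k * c x :: 'k::field) (simplicial_koszul G)"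
proof -
  interpret s: vector_space "(*) :: 'k \<Rightarrow> 'k \<Rightarrow> 'k" by unfold_locales (auto simp: algebra_simps)
  show ?thesis by (rule linear_koszul[OF s.vector_space_axioms s.linear_ident])
qed

lemma simplicial_koszul_degree_chains:
  assumes G: "finite (min_gens S)" and add: "\<And>a b. a \<in> S \<Longrightarrow> b \<in> S \<Longrightarrow> a + b \<in> S"
    and c: "c \<in> degree_chains S (Suc q) s"
  shows "simplicial_koszul (min_gens S) c \<in> degree_chains S q s"
proof -
  have "J \<subseteq> min_gens S \<and> card J = q \<and> (\<exists>u\<in>S. int (u + \<Sum>J) = s)"
    if J: "simplicial_koszul (min_gens S) c J \<noteq> 0" for J
  proof -
    obtain j where j: "j \<in> min_gens S" "j \<notin> J" "c (insert j J) \<noteq> 0"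
      using simplicial_koszul_nonzeroD[OF J] .
    then obtain u where u: "insert j J \<subseteq> min_gens S" "card (insert j J) = Suc q" "u \<in> S"
      "int (u + \<Sum>(insert j J)) = s"
      using c unfolding degree_chains_def by blast
    have fin: "finite J" using finite_subset[OF u(1) G] by simp
    have "u + j \<in> S" using add[OF u(3), of j] j(1) unfolding min_gens_def by blast
    moreover have "int (u + j + \<Sum>J) = s" using u(4) fin j(2) by simp
    ultimately have "\<exists>u\<in>S. int (u + \<Sum>J) = s" by (rule bexI[rotated])
    then show ?thesis using u(1,2) fin j(2) by simp
  qed
  then show ?thesis unfolding degree_chains_def by blast
qed

text \<open>Below, \<open>phi\<close> keeps the components of a chain in degrees \<open>n \<in> N\<close>, that is, its image modulo \<open>t\<^sup>m\<close>
  and modulo the constants. A cycle is determined by these components up to a boundary; the boundaries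
  that survive come from chains with constant coefficients, supported on \<open>Q\<close>.\<close>

lemma koszul_homology_max_embedding_dim:
  assumes G: "finite (min_gens S)" and add: "\<And>a b. a \<in> S \<Longrightarrow> b \<in> S \<Longrightarrow> a + b \<in> S" and "0 \<in> S"
    and m: "m \<in> min_gens S" "\<And>k. k \<in> min_gens S \<Longrightarrow> m \<le> k"
    and N: "N = min_gens S - {m}"
    and med: "\<And>j u. j \<in> min_gens S \<Longrightarrow> u \<in> S \<Longrightarrow> u \<noteq> 0 \<Longrightarrow> \<exists>v\<in>S. j + u = m + v"
    and apery: "\<And>u. u \<in> S \<Longrightarrow> u = 0 \<or> u \<in> N \<or> (\<exists>v\<in>S. u = m + v)"
    and i: "i \<ge> 1"
  shows "vector_space.dim (\<lambda>k c x. k * c x)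
        {a :: nat set \<Rightarrow> 'k::field. a \<in> degree_chains S i s \<and> simplicial_koszul (min_gens S) a = 0} -
      vector_space.dim (\<lambda>k c x. k * c x)
        (simplicial_koszul (min_gens S) ` (degree_chains S (Suc i) s :: (nat set \<Rightarrow> 'k) set)) =
    card {J. J \<subseteq> N \<and> card J = i \<and> (\<exists>n\<in>N. int (n + \<Sum>J) = s)} -
    card {J. J \<subseteq> N \<and> card J = Suc i \<and> int (\<Sum>J) = s}"
proof -
  let ?G = "min_gens S"
  let ?d = "simplicial_koszul ?G :: (nat set \<Rightarrow> 'k) \<Rightarrow> nat set \<Rightarrow> 'k"
  let ?M = "\<lambda>q. degree_chains S q s :: (nat set \<Rightarrow> 'k) set"
  \<comment> \<open>\<open>J\<close> and \<open>s\<close> determine \<open>n\<close>, so counting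
    the sets \<open>J\<close> counts the pairs \<open>(J, n)\<close>.\<close>
  define P where "P = {J. J \<subseteq> N \<and> card J = i \<and> (\<exists>n\<in>N. int (n + \<Sum>J) = s)}"
  define Q where "Q = {J. J \<subseteq> N \<and> card J = Suc i \<and> int (\<Sum>J) = s}"
  define phi where "phi c = (\<lambda>J. if J \<in> P then c J else 0)" for c :: "nat set \<Rightarrow> 'k"
  define V where "V = {a \<in> ?M i. ?d a = 0}"
  define U where "U = {c :: nat set \<Rightarrow> 'k. \<forall>J. c J \<noteq> 0 \<longrightarrow> J \<in> Q}"
  interpret k: vector_space "(*) :: 'k \<Rightarrow> 'k \<Rightarrow> 'k" by unfold_locales (auto simp: algebra_simps)
  interpret v: vector_space "\<lambda>k c x. k * c x :: 'k" by (rule vector_space_pointwise) unfold_locales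
  interpret v: vector_space_pair "\<lambda>k c x. k * c x :: 'k" "\<lambda>k c x. k * c x :: 'k" by unfold_locales
  interpret d: Vector_Spaces.linear "\<lambda>k c x. k * c x" "\<lambda>k c x. k * c x :: 'k" ?d
    by (rule linear_simplicial_koszul)
  have phi: "Vector_Spaces.linear (\<lambda>k c x. k * c x) (\<lambda>k c x. k * c x) phi"
    unfolding Vector_Spaces.linear_iff using v.vector_space_axioms
    by (auto simp: phi_def fun_eq_iff)
  interpret phi: Vector_Spaces.linear "\<lambda>k c x. k * c x" "\<lambda>k c x. k * c x :: 'k" phi by (rule phi)
  have GS: "j \<in> ?G \<Longrightarrow> j \<in> S \<and> j \<noteq> 0" for j by (simp add: min_gens_def)
  have irred: "u = 0" if "n \<in> ?G" "j \<in> ?G" "u \<in> S" "n = j + u" for n j u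
    using that unfolding min_gens_def by blast
  have not_m: "n \<noteq> m + v" if "n \<in> N" "v \<in> S" for n v
    using irred[of n m v] that m(1) N by auto
  have fin: "finite J" if "J \<subseteq> ?G" for J using finite_subset[OF that G] .
  have finP: "finite P" "finite Q"
    by (rule finite_subset[of _ "Pow ?G"]; use G in \<open>auto simp: P_def Q_def N\<close>)+
  have sum_ins: "\<Sum>(insert j J) = j + \<Sum>J" if "J \<subseteq> ?G" "j \<notin> J" for j J
    using fin[OF that(1)] that(2) by simp
  have MD: "J \<subseteq> ?G \<and> card J = q \<and> (\<exists>u\<in>S. int (u + \<Sum>J) = s)" if "a \<in> ?M q" "a J \<noteq> 0" for a q J
    using that unfolding degree_chains_def by blast
  have MG: "a J = 0" if "a \<in> ?M q" "\<not> J \<subseteq> ?G" for a q J using MD that by blast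
  have dM: "?d a \<in> ?M q" if "a \<in> ?M (Suc q)" for a q
    using simplicial_koszul_degree_chains[OF G add that] .
  have dd: "?d (?d c) = 0" for c
  proof
    show "?d (?d c) J = 0 J" for J using koszul_koszul[OF G, of "\<lambda>_ x. x" c J] by simp
  qed
  have UM: "U \<subseteq> ?M (Suc i)" unfolding U_def Q_def degree_chains_def N using \<open>0 \<in> S\<close> by force
  have subM: "v.subspace (?M q)" for q
    unfolding degree_chains_def by (rule subspace_support)
  have dU: "?d ` U \<subseteq> V" using UM dM dd unfolding V_def by auto
  have subV: "v.subspace V"
    using v.subspace_inter[OF subM d.subspace_kernel] by (simp add: V_def Int_def)
  have subU: "v.subspace U"
    unfolding U_def by (rule subspace_support)
  have subW: "v.subspace (phi ` ?d ` U)"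
    using phi.subspace_image[OF d.subspace_image[OF subU]] .
  have phi_V: "phi ` V = {c. \<forall>J. c J \<noteq> 0 \<longrightarrow> J \<in> P}"
  proof (intro set_eqI iffI)
    fix w assume "w \<in> phi ` V"
    then show "w \<in> {c. \<forall>J. c J \<noteq> 0 \<longrightarrow> J \<in> P}" by (auto simp: phi_def split: if_splits)
  next
    fix w :: "nat set \<Rightarrow> 'k" assume w: "w \<in> {c. \<forall>J. c J \<noteq> 0 \<longrightarrow> J \<in> P}"
    \<comment> \<open>For a set without \<open>m\<close>, the first cone formula forces this value
      at \<open>insert m J\<close>. The condition at sets with \<open>m\<close> then holds because
      the differential over \<open>N\<close> squares to zero.\<close>
    define a where "a J = (if m \<in> J then - simplicial_koszul N w (J - {m}) else w J)" for J
    have aM: "a \<in> ?M i"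
      unfolding degree_chains_def
    proof (intro CollectI allI impI)
      fix J assume nz: "a J \<noteq> 0"
      show "J \<subseteq> ?G \<and> card J = i \<and> (\<exists>u\<in>S. int (u + \<Sum>J) = s)"
      proof (cases "m \<in> J")
        case True
        then have "simplicial_koszul N w (J - {m}) \<noteq> 0" using nz by (simp add: a_def)
        then obtain j where j: "j \<in> N" "j \<notin> J - {m}" "w (insert j (J - {m})) \<noteq> 0"
          using simplicial_koszul_nonzeroD by blast
        then have "insert j (J - {m}) \<in> P" using w by blast
        then obtain n where n: "insert j (J - {m}) \<subseteq> N" "card (insert j (J - {m})) = i" "n \<in> N"
          "int (n + \<Sum>(insert j (J - {m}))) = s" unfolding P_def by blast
        have J: "J - {m} \<subseteq> ?G" using n(1) N by auto
        then have finJ: "finite (J - {m})" by (rule fin)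
        have "j \<in> ?G" "n \<in> S" "n \<noteq> 0" using j(1) n(3) N GS by auto
        \<comment> \<open>The coefficient of \<open>a J\<close> has degree
          \<open>s - \<Sum>J = j + n - m\<close>. It lies in \<open>S\<close> because the product of
          two elements of positive degree is divisible by t^m.\<close>
        then obtain v where v: "v \<in> S" "j + n = m + v" using med by blast
        have "\<Sum>J = m + \<Sum>(J - {m})"
          using finJ True by (subst sum.remove[of J m]) auto
        then have "int (v + \<Sum>J) = s" using n(4) v(2) sum_ins[OF J j(2)] by simp
        moreover have "J = insert m (J - {m})" using True by auto
        then have "card J = Suc (card (J - {m}))" using card_insert_disjoint[OF finJ, of m] by simp
        ultimately show ?thesis using v(1) J m(1) n(2) finJ j(2) by auto
      next
        case False
        then have "J \<in> P" using nz w by (simp add: a_def)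
        then obtain n where n: "J \<subseteq> N" "card J = i" "n \<in> N" "int (n + \<Sum>J) = s"
          unfolding P_def by blast
        have "n \<in> S" using n(3) N GS by blast
        then show ?thesis using n N by auto
      qed
    qed
    moreover have "?d a = 0"
    proof
      fix J
      show "?d a J = 0 J"
      proof (cases "J \<subseteq> ?G")
        case J: True
        show ?thesis
        proof (cases "m \<in> J")
          case False
          have "simplicial_koszul N a J = simplicial_koszul N w J"
            by (rule koszul_cong) (use False N in \<open>auto simp: a_def\<close>)
          then show ?thesis
            using simplicial_koszul_cone(1)[OF G m(1) J False m(2), of a] False
            unfolding N[symmetric] by (simp add: a_def)
        next
          case True
          have ins: "J = insert m (J - {m})" using True by auto
          have "?d a J = - simplicial_koszul N (\<lambda>J. a (insert m J)) (J - {m})"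
            using simplicial_koszul_cone(2)[OF G m(1) _ _ m(2), of "J - {m}" a] J
            unfolding N[symmetric] ins[symmetric] by auto
          also have "simplicial_koszul N (\<lambda>J. a (insert m J)) (J - {m}) =
              simplicial_koszul N (\<lambda>J. - simplicial_koszul N w J) (J - {m})"
          proof (rule koszul_cong)
            fix j assume "j \<in> N - (J - {m})"
            then have "insert m (insert j (J - {m})) - {m} = insert j (J - {m})" using N by auto
            then show "a (insert m (insert j (J - {m}))) = - simplicial_koszul N w (insert j (J - {m}))"
              by (simp add: a_def)
          qed
          also have "\<dots> = 0"
            unfolding simplicial_koszul_minus using G N by (simp add: koszul_koszul)
          finally show ?thesis by simp
        qed
      next
        case False
        then have "a (insert j J) = 0" for j using MG[OF aM] by blast
        then show ?thesis by (simp add: koszul_def)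
      qed
    qed
    moreover have "phi a = w"
    proof
      fix J
      have "m \<notin> J" if "J \<in> P" using that by (auto simp: P_def N)
      then show "phi a J = w J" using w by (auto simp: phi_def a_def)
    qed
    ultimately show "w \<in> phi ` V" unfolding V_def by blast
  qed
  \<comment> \<open>Let \<open>c J\<close> be nonzero and \<open>j\<close> in \<open>J\<close>. At
    \<open>J - {j}\<close>, which lies in \<open>P\<close> with \<open>n = j\<close>, only the term
    from \<open>j\<close> survives: another set \<open>insert k (J - {j})\<close> in
    \<open>Q\<close> would have the same sum as \<open>J\<close>, forcing
    \<open>k = j\<close>.\<close>
  have inj: "c = 0" if c: "c \<in> U" and 0: "phi (?d c) = 0" for c
  proof (rule ccontr)
    assume "c \<noteq> 0"
    then obtain J where J: "c J \<noteq> 0" by fastforce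
    then have JQ: "J \<in> Q" using c unfolding U_def by blast
    then obtain j where j: "j \<in> J" unfolding Q_def by fastforce
    let ?J = "J - {j}"
    have ins: "insert j ?J = J" "j \<notin> ?J" using j by auto
    have JG: "J \<subseteq> ?G" "?J \<subseteq> ?G" using JQ N unfolding Q_def by auto
    have sJ: "\<Sum>J = j + \<Sum>?J" using sum_ins[OF JG(2) ins(2)] ins by simp
    have jN: "j \<in> N" using j JQ unfolding Q_def by auto
    have "card ?J = i" using JQ j unfolding Q_def by simp
    moreover have "int (j + \<Sum>?J) = s" using JQ unfolding sJ[symmetric] Q_def by blast
    ultimately have "?J \<in> P" using JQ jN unfolding P_def Q_def by blast
    then have "?d c ?J = 0" using fun_cong[OF 0, of ?J] by (simp add: phi_def)
    moreover have "?d c ?J = ksign j ?J (c (insert j ?J))"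
    proof (rule simplicial_koszul_single[OF G])
      fix k assume k: "k \<in> ?G" "k \<notin> ?J" "k \<noteq> j"
      show "c (insert k ?J) = 0"
      proof (rule ccontr)
        assume "c (insert k ?J) \<noteq> 0"
        then have "int (\<Sum>(insert k ?J)) = s" using c unfolding U_def Q_def by blast
        moreover have "int (\<Sum>J) = s" using JQ unfolding Q_def by blast
        ultimately show False using sum_ins[OF JG(2) k(2)] sJ k(3) by simp
      qed
    qed (use jN N ins in auto)
    ultimately show False using J ins(1) by simp
  qed
  have dimW: "v.dim (phi ` ?d ` U) = card Q"
  proof -
    have "Vector_Spaces.linear (\<lambda>k c x. k * c x) (\<lambda>k c x. k * c x) (phi \<circ> ?d)"
      by (rule Vector_Spaces.linear_compose[OF d.linear_axioms phi])
    moreover have "{c \<in> U. (phi \<circ> ?d) c = 0} = {0}"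
      using inj v.subspace_0[OF subU] by (auto simp: phi.zero)
    moreover obtain A where "finite A" "U \<subseteq> v.span A"
      using finite_support_subspace(1)[OF finP(2)] unfolding U_def by blast
    moreover have "v.dim U = card Q"
      using finite_support_subspace(2)[OF finP(2)] unfolding U_def .
    moreover have "v.dim {0 :: nat set \<Rightarrow> 'k} = 0"
      using v.dim_le_card[of "{0 :: nat set \<Rightarrow> 'k}" "{}"] by simp
    ultimately show ?thesis
      using v.dim_image_plus_kernel[OF _ subU, of "phi \<circ> ?d"] by (simp add: image_comp)
  qed
  have bound: "{a \<in> V. phi a \<in> phi ` ?d ` U} = ?d ` ?M (Suc i)"
  proof (intro set_eqI iffI)
    fix a assume "a \<in> {a \<in> V. phi a \<in> phi ` ?d ` U}"
    then obtain c where a: "a \<in> V" and c: "c \<in> U" "phi a = phi (?d c)" by auto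
    define b where "b = a - ?d c"
    have bV: "b \<in> V" unfolding b_def using v.subspace_diff[OF subV a] dU c(1) by auto
    then have bM: "b \<in> ?M i" and db: "?d b = 0" unfolding V_def by auto
    have "phi b = 0" unfolding b_def using c(2) by (simp add: phi.diff)
    then have bP: "b J = 0" if "J \<in> P" for J
    proof -
      have "phi b J = 0" using \<open>phi b = 0\<close> by simp
      then show ?thesis using that by (simp add: phi_def)
    qed
    \<comment> \<open>A constant coefficient of the cycle \<open>b\<close> at \<open>J\<close> is
      alone in its component at \<open>J - {j}\<close>: a competing \<open>k\<close> would give
      \<open>j = k + u\<close>, against irreducibility of \<open>j\<close>. That \<open>J\<close>
      has an element \<open>j\<close> at all uses \<open>i \<ge> 1\<close>.\<close>
    have b0: "b J = 0" if J: "J \<subseteq> N" "int (\<Sum>J) = s" for J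
    proof (rule ccontr)
      assume nz: "b J \<noteq> 0"
      then have cJ: "card J = i" using MD[OF bM] by blast
      then obtain j where j: "j \<in> J" using i by fastforce
      let ?J = "J - {j}"
      have ins: "insert j ?J = J" "j \<notin> ?J" using j by auto
      have JG: "J \<subseteq> ?G" "?J \<subseteq> ?G" using J N by auto
      have sJ: "\<Sum>J = j + \<Sum>?J" using sum_ins[OF JG(2) ins(2)] ins by simp
      have jG: "j \<in> ?G" using j JG by auto
      have "?d b ?J = ksign j ?J (b (insert j ?J))"
      proof (rule simplicial_koszul_single[OF G])
        fix k assume k: "k \<in> ?G" "k \<notin> ?J" "k \<noteq> j"
        show "b (insert k ?J) = 0"
        proof (rule ccontr)
          assume "b (insert k ?J) \<noteq> 0"
          then obtain u where u: "u \<in> S" "int (u + \<Sum>(insert k ?J)) = s"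
            using MD[OF bM] by blast
          then have "j = k + u" using sum_ins[OF JG(2) k(2)] sJ J(2) by simp
          then show False using irred[OF jG k(1) u(1)] k(3) by simp
        qed
      qed (use jG ins in auto)
      then show False using nz db ins(1) by simp
    qed
    \<comment> \<open>The contraction of the cone: divide by t^m and adjoin \<open>m\<close> to the
      set. It stays inside R because the coefficients of \<open>b\<close> at subsets of
      \<open>N\<close> no longer occur in degree \<open>0\<close> (by \<open>b0\<close>) or in
      degrees from \<open>N\<close> (by \<open>bP\<close>), and \<open>apery\<close> makes all
      others divisible.\<close>
    define y where "y J = (if m \<in> J then b (J - {m}) else 0)" for J
    have yM: "y \<in> ?M (Suc i)"
      unfolding degree_chains_def
    proof (intro CollectI allI impI)
      fix J assume nz: "y J \<noteq> 0"
      then have mJ: "m \<in> J" and nz: "b (J - {m}) \<noteq> 0" by (auto simp: y_def split: if_splits)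
      let ?J = "J - {m}"
      have ins: "insert m ?J = J" "m \<notin> ?J" using mJ by auto
      obtain u where u: "?J \<subseteq> ?G" "card ?J = i" "u \<in> S" "int (u + \<Sum>?J) = s"
        using MD[OF bM nz] by blast
      have JN: "?J \<subseteq> N" using u(1) N by auto
      have "u \<noteq> 0" using b0[OF JN] nz u(4) by (metis add_0)
      moreover have "u \<notin> N" using bP[of ?J] nz u JN unfolding P_def by blast
      ultimately obtain v where v: "v \<in> S" "u = m + v" using apery[OF u(3)] by blast
      have "int (v + \<Sum>J) = s" using v u(4) sum_ins[OF u(1) ins(2)] ins by simp
      moreover have "card J = Suc i" using card_insert_disjoint[OF fin[OF u(1)] ins(2)] ins u(2) by simp
      ultimately show "J \<subseteq> ?G \<and> card J = Suc i \<and> (\<exists>u\<in>S. int (u + \<Sum>J) = s)"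
        using v(1) u(1) m(1) by auto
    qed
    have "?d y J = b J" for J
    proof (cases "J \<subseteq> ?G")
      case J: True
      have yb: "simplicial_koszul N (\<lambda>J. y (insert m J)) L = simplicial_koszul N b L" if "m \<notin> L" for L
      proof (rule koszul_cong)
        fix j assume "j \<in> N - L"
        then have "insert m (insert j L) - {m} = insert j L" using N that by auto
        then show "y (insert m (insert j L)) = b (insert j L)" by (simp add: y_def)
      qed
      show ?thesis
      proof (cases "m \<in> J")
        case False
        have "simplicial_koszul N y J = 0"
          using False N by (auto simp: koszul_def y_def intro!: sum.neutral)
        then show ?thesis
          using simplicial_koszul_cone(1)[OF G m(1) J False m(2), of y] False
          unfolding N[symmetric] by (simp add: y_def)
      next
        case True
        let ?J = "J - {m}"
        have ins: "insert m ?J = J" "m \<notin> ?J" "?J \<subseteq> ?G" using True J by auto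
        have "?d y J = - simplicial_koszul N b ?J"
          using simplicial_koszul_cone(2)[OF G m(1) ins(3,2) m(2), of y] yb[OF ins(2)]
          unfolding N[symmetric] ins(1) by simp
        also have "\<dots> = b J"
          using simplicial_koszul_cone(1)[OF G m(1) ins(3,2) m(2), of b] db
          unfolding N[symmetric] ins(1) by (simp add: eq_neg_iff_add_eq_0[symmetric])
        finally show ?thesis .
      qed
    next
      case False
      then have "y (insert j J) = 0" for j using MG[OF yM] by blast
      then show ?thesis using MG[OF bM False] by (simp add: koszul_def)
    qed
    then have "?d y = b" by (rule ext)
    then have "a = ?d (y + c)" unfolding d.add b_def by simp
    moreover have "y + c \<in> ?M (Suc i)" using v.subspace_add[OF subM yM] UM c(1) by auto
    ultimately show "a \<in> ?d ` ?M (Suc i)" by blast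
  next
    fix a assume "a \<in> ?d ` ?M (Suc i)"
    then obtain y where y: "y \<in> ?M (Suc i)" "a = ?d y" by blast
    \<comment> \<open>A term of \<open>y\<close> at \<open>insert j J\<close> reaches a set
      \<open>J\<close> in \<open>P\<close> only with coefficient degree \<open>u\<close> such that
      \<open>n = j + u\<close>. Irreducibility of \<open>n\<close> leaves \<open>u = 0\<close> and
      \<open>j = n\<close>, so \<open>insert j J\<close> is in \<open>Q\<close>.\<close>
    define c where "c J = (if J \<in> Q then y J else 0)" for J
    have "phi a J = phi (?d c) J" for J
    proof (cases "J \<in> P")
      case True
      then obtain n where n: "J \<subseteq> N" "card J = i" "n \<in> N" "int (n + \<Sum>J) = s"
        unfolding P_def by blast
      have JG: "J \<subseteq> ?G" using n(1) N by auto
      have "y (insert j J) = c (insert j J)" if j: "j \<in> ?G - J" for j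
      proof (rule ccontr)
        assume ne: "y (insert j J) \<noteq> c (insert j J)"
        then have "y (insert j J) \<noteq> 0" "insert j J \<notin> Q" by (auto simp: c_def split: if_splits)
        then obtain u where u: "u \<in> S" "int (u + \<Sum>(insert j J)) = s" "card (insert j J) = Suc i"
          using MD[OF y(1)] by blast
        have "u + \<Sum>(insert j J) = n + \<Sum>J" using u(2) n(4) by (metis of_nat_eq_iff)
        then have nj: "n = j + u" using sum_ins[OF JG, of j] j by simp
        have u0: "u = 0" using irred[OF _ _ u(1) nj] n(3) j N by auto
        then have "int (\<Sum>(insert j J)) = s" using u(2) by (metis add_0)
        then have "insert j J \<in> Q" using u(3) n(1,3) nj u0 unfolding Q_def by simp
        then show False using \<open>insert j J \<notin> Q\<close> by contradiction
      qed
      then have "?d y J = ?d c J" by (rule koszul_cong)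
      then show ?thesis using True y(2) by (simp add: phi_def)
    qed (simp add: phi_def)
    then have "phi a = phi (?d c)" by (rule ext)
    moreover have "c \<in> U" by (auto simp: c_def U_def split: if_splits)
    moreover have "a \<in> V" using y dM dd unfolding V_def by auto
    ultimately show "a \<in> {a \<in> V. phi a \<in> phi ` ?d ` U}" by auto
  qed
  have "V \<subseteq> {c. \<forall>J. c J \<noteq> 0 \<longrightarrow> J \<in> Pow ?G}" using MD unfolding V_def by blast
  moreover obtain A where A: "finite A" "{c. \<forall>J. c J \<noteq> 0 \<longrightarrow> J \<in> Pow ?G} \<subseteq> v.span A"
    using finite_support_subspace(1)[of "Pow ?G"] G by blast
  ultimately have VA: "V \<subseteq> v.span A" by (blast intro: order_trans)
  have "phi ` ?d ` U \<subseteq> phi ` V" using dU by blast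
  from v.dim_quotient_image[OF phi subV A(1) VA subW this]
  show ?thesis
    unfolding bound dimW unfolding phi_V finite_support_subspace(2)[OF finP(1)]
    by (simp add: V_def P_def Q_def)
qed

section \<open>Graded pieces of free modules\<close>

type_synonym 'k mvec = "nat \<Rightarrow>\<^sub>0 'k mpoly"

abbreviation pscale :: "('k::field) mpoly \<Rightarrow> 'k mvec \<Rightarrow> 'k mvec" where
  "pscale p v \<equiv> Poly_Mapping.map ((*) p) v"

abbreviation kscale :: "'k::field \<Rightarrow> 'k mvec \<Rightarrow> 'k mvec" where
  "kscale k \<equiv> pscale (Poly_Mapping.single 0 k)"

abbreviation coefficient :: "('k::field) mvec \<Rightarrow> nat \<Rightarrow> monom \<Rightarrow> 'k" where
  "coefficient v b \<alpha> \<equiv> Poly_Mapping.lookup (Poly_Mapping.lookup v b) \<alpha>"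

lemma coefficient_eqI: "(\<And>b \<alpha>. coefficient v b \<alpha> = coefficient w b \<alpha>) \<Longrightarrow> v = w"
  by (intro poly_mapping_eqI) auto

interpretation pmod: module "pscale :: ('k::field) mpoly \<Rightarrow> _"
  by unfold_locales
    (rule poly_mapping_eqI, simp add: lookup_map_mult lookup_add distrib_left distrib_right mult.assoc)+

lemma lookup_single_mult:
  fixes p :: "('k::field) mpoly"
  shows "Poly_Mapping.lookup (Poly_Mapping.single \<beta> c * p) (\<beta> + \<gamma>) = c * Poly_Mapping.lookup p \<gamma>"
  by (simp add: lookup_mult lookup_single when_mult)

lemma lookup_single_mult_eq_0:
  fixes p :: "('k::field) mpoly"
  assumes "\<And>\<gamma>. \<alpha> \<noteq> \<beta> + \<gamma>"
  shows "Poly_Mapping.lookup (Poly_Mapping.single \<beta> c * p) \<alpha> = 0"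
proof (rule ccontr)
  assume "\<not> ?thesis"
  then have "\<alpha> \<in> Poly_Mapping.keys (Poly_Mapping.single \<beta> c * p)" by (simp add: in_keys_iff)
  then show False using keys_mult[of "Poly_Mapping.single \<beta> c" p] assms by (auto split: if_splits)
qed

lemma lookup_const_mult:
  fixes p :: "('k::field) mpoly"
  shows "Poly_Mapping.lookup (Poly_Mapping.single 0 c * p) \<alpha> = c * Poly_Mapping.lookup p \<alpha>"
  using lookup_single_mult[of 0 c p \<alpha>] by simp

lemma monom_eq_single_plus:
  fixes \<alpha> :: "nat \<Rightarrow>\<^sub>0 nat"
  assumes "j \<in> Poly_Mapping.keys \<alpha>"
  shows "\<alpha> = Poly_Mapping.single j (Suc 0) + (\<alpha> - Poly_Mapping.single j (Suc 0))"
  by (rule poly_mapping_eqI)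
    (use assms in \<open>auto simp: lookup_add lookup_minus lookup_single in_keys_iff when_def\<close>)

lemma lookup_variable_mult:
  fixes p :: "('k::field) mpoly"
  shows "Poly_Mapping.lookup (Poly_Mapping.single (Poly_Mapping.single j (Suc 0)) 1 * p) \<alpha> =
    (if j \<in> Poly_Mapping.keys \<alpha> then Poly_Mapping.lookup p (\<alpha> - Poly_Mapping.single j (Suc 0)) else 0)"
proof (cases "j \<in> Poly_Mapping.keys \<alpha>")
  case True
  then show ?thesis
    using lookup_single_mult[of "Poly_Mapping.single j (Suc 0)" 1 p "\<alpha> - Poly_Mapping.single j (Suc 0)"]
      monom_eq_single_plus[OF True] by simp
next
  case False
  then have *: "\<alpha> \<noteq> Poly_Mapping.single j (Suc 0) + \<gamma>" for \<gamma>
    by (auto simp: in_keys_iff lookup_add)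
  show ?thesis using False lookup_single_mult_eq_0[OF *, where c = 1 and p = p] by simp
qed

lemma coefficient_kscale [simp]: "coefficient (kscale k v) b \<alpha> = k * coefficient v b \<alpha>"
  by (simp add: lookup_map_mult lookup_const_mult)

interpretation kmod: vector_space "kscale :: 'k::field \<Rightarrow> _"
  by unfold_locales (rule coefficient_eqI, simp only: coefficient_kscale, simp add: lookup_add algebra_simps)+

lemma mdeg_add: "mdeg (\<alpha> + \<beta>) = mdeg \<alpha> + mdeg \<beta>"
  unfolding mdeg_def
  by (rule setsum_keys_plus_distrib[where f = "\<lambda>n c. c * n"]) (simp_all add: distrib_right)

lemma mdeg_0 [simp]: "mdeg 0 = 0"
  and mdeg_single [simp]: "mdeg (Poly_Mapping.single n c) = c * n"
  by (simp_all add: mdeg_def)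

lemma keys_monom_add: "Poly_Mapping.keys (\<alpha> + \<beta>) = Poly_Mapping.keys \<alpha> \<union> Poly_Mapping.keys \<beta>"
  for \<alpha> \<beta> :: "nat \<Rightarrow>\<^sub>0 nat"
  by (auto simp: in_keys_iff lookup_add)

lemma lookup_le_mdeg:
  assumes "n > 0"
  shows "Poly_Mapping.lookup \<alpha> n \<le> mdeg \<alpha>"
proof (cases "n \<in> Poly_Mapping.keys \<alpha>")
  case True
  have "Poly_Mapping.lookup \<alpha> n \<le> Poly_Mapping.lookup \<alpha> n * n" using assms by simp
  also have "\<dots> \<le> mdeg \<alpha>"
    unfolding mdeg_def by (rule member_le_sum[OF True]) auto
  finally show ?thesis .
qed (simp add: in_keys_iff)

lemma finite_monoms_mdeg_le:
  assumes "finite G" "0 \<notin> G"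
  shows "finite {\<alpha>. Poly_Mapping.keys \<alpha> \<subseteq> G \<and> mdeg \<alpha> \<le> d}"
proof -
  let ?A = "{\<alpha>. Poly_Mapping.keys \<alpha> \<subseteq> G \<and> mdeg \<alpha> \<le> d}"
  have "finite (Poly_Mapping.lookup ` ?A)"
  proof (rule finite_subset)
    show "finite {f. \<forall>x. (x \<in> G \<longrightarrow> f x \<in> {..d}) \<and> (x \<notin> G \<longrightarrow> f x = (0::nat))}"
      by (rule finite_set_of_finite_funs) (use assms in auto)
    show "Poly_Mapping.lookup ` ?A \<subseteq> {f. \<forall>x. (x \<in> G \<longrightarrow> f x \<in> {..d}) \<and> (x \<notin> G \<longrightarrow> f x = 0)}"
    proof clarify
      fix \<alpha> x assume \<alpha>: "Poly_Mapping.keys \<alpha> \<subseteq> G" "mdeg \<alpha> \<le> d"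
      have "Poly_Mapping.lookup \<alpha> x \<le> d" if "x \<in> G"
        using lookup_le_mdeg[of x \<alpha>] that assms(2) \<alpha>(2) by (cases "x = 0") auto
      moreover have "Poly_Mapping.lookup \<alpha> x = 0" if "x \<notin> G"
        using that \<alpha>(1) by (auto simp: in_keys_iff)
      ultimately show "(x \<in> G \<longrightarrow> Poly_Mapping.lookup \<alpha> x \<in> {..d}) \<and>
          (x \<notin> G \<longrightarrow> Poly_Mapping.lookup \<alpha> x = 0)" by auto
    qed
  qed
  then show ?thesis by (rule finite_imageD) (auto intro!: inj_onI poly_mapping_eqI)
qed

text \<open>The map of free modules with columns \<open>f\<close>, detached from any complex: during
  the construction of a resolution there is no complex yet.\<close>

definition dmap :: "(nat \<Rightarrow> ('k::field) mvec) \<Rightarrow> 'k mvec \<Rightarrow> 'k mvec" where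
  "dmap f v = (\<Sum>b\<in>Poly_Mapping.keys v. pscale (Poly_Mapping.lookup v b) (f b))"

lemma differential_eq_dmap: "differential F i = dmap (bdiff F i)"
  by (simp add: fun_eq_iff differential_def dmap_def)

lemma sum_keys_superset:
  assumes "finite X" "Poly_Mapping.keys v \<subseteq> X" "\<And>b. g b 0 = 0"
  shows "(\<Sum>b\<in>Poly_Mapping.keys v. g b (Poly_Mapping.lookup v b)) = (\<Sum>b\<in>X. g b (Poly_Mapping.lookup v b))"
  by (rule sum.mono_neutral_left) (use assms in \<open>auto simp: in_keys_iff\<close>)

lemma module_hom_dmap: "module_hom pscale pscale (dmap f)"
proof -
  have "dmap f (v + w) = dmap f v + dmap f w" for v w
    unfolding dmap_def
    by (rule setsum_keys_plus_distrib[where f = "\<lambda>b p. pscale p (f b)"])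
      (simp_all add: pmod.scale_left_distrib)
  moreover have "dmap f (pscale p v) = pscale p (dmap f v)" for p v
  proof -
    have "Poly_Mapping.keys (pscale p v) \<subseteq> Poly_Mapping.keys v"
      by (auto simp: in_keys_iff lookup_map_mult)
    then have "dmap f (pscale p v) =
        (\<Sum>b\<in>Poly_Mapping.keys v. pscale (Poly_Mapping.lookup (pscale p v) b) (f b))"
      unfolding dmap_def by (intro sum_keys_superset[where g = "\<lambda>b p. pscale p (f b)"]) auto
    then show ?thesis
      by (simp add: dmap_def pmod.scale_sum_right lookup_map_mult pmod.scale_scale)
  qed
  ultimately show ?thesis
    unfolding module_hom_iff using pmod.module_axioms by blast
qed

interpretation dmap: module_hom pscale pscale "dmap f" for f :: "nat \<Rightarrow> ('k::field) mvec"
  by (rule module_hom_dmap)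

lemma linear_dmap: "Vector_Spaces.linear kscale kscale (dmap f)"
  unfolding Vector_Spaces.linear_iff
  using kmod.vector_space_axioms by (auto simp: dmap.add dmap.scale)

text \<open>A set \<open>D\<close> of degrees instead of one degree lets \<open>UNIV\<close> give
  the whole free module, \<open>- D\<close> the complementary part, and
  \<open>{n. int (n + \<Sum>J) = s}\<close> a piece of integer degree that may be empty.\<close>

definition graded_piece ::
    "nat set \<Rightarrow> nat set \<Rightarrow> (nat \<Rightarrow> nat) \<Rightarrow> nat set \<Rightarrow> ('k::field) mvec set" where
  "graded_piece G B g D =
     {v. \<forall>b \<alpha>. coefficient v b \<alpha> \<noteq> 0 \<longrightarrow> b \<in> B \<and> Poly_Mapping.keys \<alpha> \<subseteq> G \<and> g b + mdeg \<alpha> \<in> D}"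

lemma free_mod_eq: "free_mod S F i = graded_piece (min_gens S) (basis F i) (bdeg F i) UNIV"
  unfolding free_mod_def graded_piece_def poly_ring_def
proof (intro Collect_cong iffI allI impI conjI)
  fix v :: "'a mvec" and b \<alpha>
  assume v: "Poly_Mapping.keys v \<subseteq> basis F i \<and> (\<forall>b. Poly_Mapping.lookup v b \<in>
    {p. \<forall>\<alpha>\<in>Poly_Mapping.keys p. Poly_Mapping.keys \<alpha> \<subseteq> min_gens S})"
    and nz: "coefficient v b \<alpha> \<noteq> 0"
  then have "b \<in> Poly_Mapping.keys v" "\<alpha> \<in> Poly_Mapping.keys (Poly_Mapping.lookup v b)"
    by (auto simp: in_keys_iff)
  then show "b \<in> basis F i" "Poly_Mapping.keys \<alpha> \<subseteq> min_gens S" using v by auto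
next
  fix v :: "'a mvec"
  assume v: "\<forall>b \<alpha>. coefficient v b \<alpha> \<noteq> 0 \<longrightarrow> b \<in> basis F i \<and> Poly_Mapping.keys \<alpha> \<subseteq> min_gens S \<and>
    bdeg F i b + mdeg \<alpha> \<in> UNIV"
  show "Poly_Mapping.keys v \<subseteq> basis F i"
  proof
    fix b assume "b \<in> Poly_Mapping.keys v"
    then have "Poly_Mapping.lookup v b \<noteq> 0" by (simp add: in_keys_iff)
    then obtain \<alpha> where "coefficient v b \<alpha> \<noteq> 0" by (metis lookup_zero poly_mapping_eqI)
    then show "b \<in> basis F i" using v by blast
  qed
  show "\<And>b. Poly_Mapping.lookup v b \<in> {p. \<forall>\<alpha>\<in>Poly_Mapping.keys p. Poly_Mapping.keys \<alpha> \<subseteq> min_gens S}"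
    using v by (auto simp: in_keys_iff)
qed simp

lemma homogeneous_free_mod_eq:
  "v \<in> free_mod S F i \<and> homogeneous F i d v \<longleftrightarrow>
    v \<in> graded_piece (min_gens S) (basis F i) (bdeg F i) {d}"
  unfolding free_mod_eq graded_piece_def homogeneous_def Ball_def in_keys_iff add.commute[of "mdeg _"]
  by blast

lemma subspace_graded_piece: "kmod.subspace (graded_piece G B g D)"
proof (rule kmod.subspaceI)
  fix v w :: "'k::field mvec"
  have "coefficient v b \<alpha> \<noteq> 0 \<or> coefficient w b \<alpha> \<noteq> 0" if "coefficient (v + w) b \<alpha> \<noteq> 0" for b \<alpha>
    using that by (auto simp: lookup_add)
  then show "v \<in> graded_piece G B g D \<Longrightarrow> w \<in> graded_piece G B g D \<Longrightarrow> v + w \<in> graded_piece G B g D"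
    unfolding graded_piece_def by blast
qed (simp add: graded_piece_def, simp add: graded_piece_def, blast)

lemma graded_piece_mono: "D \<subseteq> D' \<Longrightarrow> graded_piece G B g D \<subseteq> graded_piece G B g D'"
  unfolding graded_piece_def by blast

lemma pscale_graded_piece:
  assumes v: "v \<in> graded_piece G B g D"
    and p: "\<And>\<alpha>. Poly_Mapping.lookup p \<alpha> \<noteq> 0 \<Longrightarrow> Poly_Mapping.keys \<alpha> \<subseteq> G \<and> (\<forall>d\<in>D. d + mdeg \<alpha> \<in> D')"
  shows "pscale p v \<in> graded_piece G B g D'"
  unfolding graded_piece_def
proof (intro CollectI allI impI)
  fix b \<alpha> assume "coefficient (pscale p v) b \<alpha> \<noteq> 0"
  then have "\<alpha> \<in> Poly_Mapping.keys (p * Poly_Mapping.lookup v b)"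
    by (simp add: in_keys_iff lookup_map_mult)
  then obtain \<beta> \<gamma> where \<alpha>: "\<alpha> = \<beta> + \<gamma>" "Poly_Mapping.lookup p \<beta> \<noteq> 0" "coefficient v b \<gamma> \<noteq> 0"
    using keys_mult[of p "Poly_Mapping.lookup v b"] by (auto simp: in_keys_iff)
  then have "b \<in> B" "Poly_Mapping.keys \<gamma> \<subseteq> G" "g b + mdeg \<gamma> \<in> D"
    using v unfolding graded_piece_def by blast+
  then show "b \<in> B \<and> Poly_Mapping.keys \<alpha> \<subseteq> G \<and> g b + mdeg \<alpha> \<in> D'"
    using p[OF \<alpha>(2)] \<alpha>(1) by (auto simp: keys_monom_add mdeg_add add.assoc add.commute[of "mdeg \<beta>"])
qed

lemma dmap_graded_piece:
  assumes f: "\<And>b. b \<in> B' \<Longrightarrow> f b \<in> graded_piece G B g {g' b}"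
    and v: "v \<in> graded_piece G B' g' D"
  shows "dmap f v \<in> graded_piece G B g D"
  unfolding dmap_def
proof (rule kmod.subspace_sum[OF subspace_graded_piece])
  fix b assume "b \<in> Poly_Mapping.keys v"
  then have "Poly_Mapping.lookup v b \<noteq> 0" by (simp add: in_keys_iff)
  then obtain \<beta> where "coefficient v b \<beta> \<noteq> 0" by (metis lookup_zero poly_mapping_eqI)
  then have "b \<in> B'" using v unfolding graded_piece_def by blast
  then show "pscale (Poly_Mapping.lookup v b) (f b) \<in> graded_piece G B g D"
    by (rule pscale_graded_piece[OF f]) (use v in \<open>auto simp: graded_piece_def\<close>)
qed

lemma graded_piece_split:
  assumes "v \<in> graded_piece G B g D"
  obtains v1 v2 where "v1 \<in> graded_piece G B g (D \<inter> C)" "v2 \<in> graded_piece G B g (D - C)" "v = v1 + v2"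
proof -
  define part where "part P =
    Poly_Mapping.mapp (\<lambda>b p. Poly_Mapping.mapp (\<lambda>\<alpha> k. if g b + mdeg \<alpha> \<in> P then k else 0) p) v" for P
  have part: "coefficient (part P) b \<alpha> = (if g b + mdeg \<alpha> \<in> P then coefficient v b \<alpha> else 0)" for P b \<alpha>
    by (auto simp: part_def lookup_mapp when_def in_keys_iff)
  have "part C \<in> graded_piece G B g (D \<inter> C)" "part (- C) \<in> graded_piece G B g (D - C)"
    using assms by (auto simp: graded_piece_def part)
  moreover have "v = part C + part (- C)"
    by (rule coefficient_eqI) (simp add: lookup_add part)
  ultimately show thesis using that by blast
qed

lemma graded_piece_disjoint:
  assumes "v \<in> graded_piece G B g D" "v \<in> graded_piece G B g D'" "D \<inter> D' = {}"
  shows "v = 0"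
proof (rule coefficient_eqI)
  fix b \<alpha>
  have "coefficient v b \<alpha> = 0" using assms unfolding graded_piece_def by blast
  then show "coefficient v b \<alpha> = coefficient 0 b \<alpha>" by simp
qed

lemma dmap_exact_graded_piece:
  assumes f: "\<And>b. b \<in> B' \<Longrightarrow> f b \<in> graded_piece G B g {g' b}"
    and v: "v \<in> graded_piece G B g D" "v \<in> dmap f ` graded_piece G B' g' UNIV"
  shows "v \<in> dmap f ` graded_piece G B' g' D"
proof -
  obtain w where w: "w \<in> graded_piece G B' g' UNIV" "v = dmap f w" using v(2) by blast
  obtain w1 w2 where s: "w1 \<in> graded_piece G B' g' (UNIV \<inter> D)"
    "w2 \<in> graded_piece G B' g' (UNIV - D)" "w = w1 + w2"
    using graded_piece_split[OF w(1)] .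
  have "dmap f w2 \<in> graded_piece G B g (UNIV - D)" "dmap f w1 \<in> graded_piece G B g D"
    using dmap_graded_piece[OF f s(2)] dmap_graded_piece[OF f s(1)] by auto
  moreover have "dmap f w2 = v - dmap f w1" using w(2) s(3) by (simp add: dmap.add)
  ultimately have "dmap f w2 = 0"
    using graded_piece_disjoint[of "dmap f w2" G B g D "UNIV - D"]
      kmod.subspace_diff[OF subspace_graded_piece v(1)] by auto
  then show ?thesis using w(2) s(1,3) by (auto simp: dmap.add)
qed

lemma graded_piece_finite_dim:
  assumes G: "finite G" "0 \<notin> G" and B: "\<And>d. finite {b \<in> B. g b = d}" and D: "finite D"
  obtains A where "finite A" "(graded_piece G B g D :: ('k::field) mvec set) \<subseteq> kmod.span A"
proof -
  let ?X = "(\<Union>d\<le>Max D. {b \<in> B. g b = d}) \<times> {\<alpha>. Poly_Mapping.keys \<alpha> \<subseteq> G \<and> mdeg \<alpha> \<le> Max D}"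
  define e where "e = (\<lambda>(b :: nat, \<alpha> :: monom). Poly_Mapping.single b (Poly_Mapping.single \<alpha> (1::'k)))"
  have fin: "finite ?X" using B finite_monoms_mdeg_le[OF G] by blast
  have "v \<in> kmod.span (e ` ?X)" if v: "v \<in> graded_piece G B g D" for v
  proof -
    have "v = (\<Sum>x\<in>?X. kscale (coefficient v (fst x) (snd x)) (e x))"
    proof (rule coefficient_eqI)
      fix b \<alpha>
      have "coefficient (\<Sum>x\<in>?X. kscale (coefficient v (fst x) (snd x)) (e x)) b \<alpha> =
          (\<Sum>x\<in>?X. if x = (b, \<alpha>) then coefficient v b \<alpha> else 0)"
        unfolding lookup_sum coefficient_kscale
        by (rule sum.cong) (auto simp: e_def lookup_single when_def split: if_splits)
      also have "\<dots> = coefficient v b \<alpha>"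
      proof (cases "coefficient v b \<alpha> = 0")
        case False
        then have *: "b \<in> B" "Poly_Mapping.keys \<alpha> \<subseteq> G" "g b + mdeg \<alpha> \<in> D"
          using v unfolding graded_piece_def by blast+
        then have "g b + mdeg \<alpha> \<le> Max D" using D by simp
        then have "(b, \<alpha>) \<in> ?X" using * by auto
        then show ?thesis using fin by simp
      next
        case True
        then show ?thesis by (simp add: sum.neutral)
      qed
      finally show "coefficient v b \<alpha> =
        coefficient (\<Sum>x\<in>?X. kscale (coefficient v (fst x) (snd x)) (e x)) b \<alpha>" by simp
    qed
    also have "\<dots> \<in> kmod.span (e ` ?X)"
      by (intro kmod.span_sum kmod.span_scale kmod.span_base) auto
    finally show ?thesis .
  qed
  then show thesis using that fin by blast
qed

section \<open>Exactness of the Koszul complex of a free module\<close>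

abbreviation xvar :: "nat \<Rightarrow> ('k::field) mvec \<Rightarrow> 'k mvec" where
  "xvar j \<equiv> pscale (Poly_Mapping.single (Poly_Mapping.single j (Suc 0)) 1)"

lemma coefficient_xvar:
  "coefficient (xvar j v) b \<alpha> =
    (if j \<in> Poly_Mapping.keys \<alpha> then coefficient v b (\<alpha> - Poly_Mapping.single j (Suc 0)) else 0)"
  unfolding lookup_map_mult by (rule lookup_variable_mult)

lemma coefficient_ksign: "coefficient (ksign j J v) b \<alpha> = ksign j J (coefficient v b \<alpha>)"
  by (simp add: ksign_def)

lemma xvar_commute: "xvar j (xvar k v) = xvar k (xvar j v)"
  by (simp only: pmod.scale_scale mult.commute)

lemma linear_xvar: "Vector_Spaces.linear kscale kscale (xvar j)"
  unfolding Vector_Spaces.linear_iff using kmod.vector_space_axioms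
  by (simp only: pmod.scale_right_distrib pmod.scale_scale mult.commute simp_thms)

interpretation kfun: vector_space "\<lambda>k (c :: nat set \<Rightarrow> ('k::field) mvec) J. kscale k (c J)"
  by (rule vector_space_pointwise) (rule kmod.vector_space_axioms)

text \<open>Degree \<open>s\<close> and exterior degree \<open>q\<close> of the Koszul complex of a
  free module. Components at all other sets are required to vanish, so that equality of chains is
  equality of functions.\<close>

definition koszul_piece ::
    "nat set \<Rightarrow> nat set \<Rightarrow> (nat \<Rightarrow> nat) \<Rightarrow> nat \<Rightarrow> int \<Rightarrow> (nat set \<Rightarrow> ('k::field) mvec) set" where
  "koszul_piece G B g q s = {c. \<forall>J b \<alpha>. coefficient (c J) b \<alpha> \<noteq> 0 \<longrightarrow>
     J \<subseteq> G \<and> card J = q \<and> b \<in> B \<and> Poly_Mapping.keys \<alpha> \<subseteq> G \<and> int (g b + mdeg \<alpha> + \<Sum>J) = s}"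

lemma koszul_piece_iff:
  "c \<in> koszul_piece G B g q s \<longleftrightarrow> (\<forall>J. c J \<noteq> 0 \<longrightarrow> J \<subseteq> G \<and> card J = q) \<and>
     (\<forall>J. c J \<in> graded_piece G B g {n. int (n + \<Sum>J) = s})"
proof -
  have nz: "v \<noteq> 0 \<longleftrightarrow> (\<exists>b \<alpha>. coefficient v b \<alpha> \<noteq> 0)" for v :: "'a mvec"
    using coefficient_eqI[of v 0] by auto
  show ?thesis unfolding nz koszul_piece_def graded_piece_def mem_Collect_eq by blast
qed

lemma koszul_pieceD:
  "c \<in> koszul_piece G B g q s \<Longrightarrow> c J \<noteq> 0 \<Longrightarrow> J \<subseteq> G \<and> card J = q"
  "c \<in> koszul_piece G B g q s \<Longrightarrow> c J \<in> graded_piece G B g {n. int (n + \<Sum>J) = s}"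
  unfolding koszul_piece_iff by blast+

lemma subspace_koszul_piece: "kfun.subspace (koszul_piece G B g q s)"
proof (rule kfun.subspaceI, unfold koszul_piece_iff)
  fix c d :: "nat set \<Rightarrow> ('k::field) mvec" and k :: 'k
  assume c: "(\<forall>J. c J \<noteq> 0 \<longrightarrow> J \<subseteq> G \<and> card J = q) \<and>
    (\<forall>J. c J \<in> graded_piece G B g {n. int (n + \<Sum>J) = s})"
  show "(\<forall>J. kscale k (c J) \<noteq> 0 \<longrightarrow> J \<subseteq> G \<and> card J = q) \<and>
    (\<forall>J. kscale k (c J) \<in> graded_piece G B g {n. int (n + \<Sum>J) = s})"
    using c kmod.subspace_scale[OF subspace_graded_piece] by (metis kmod.scale_zero_right)
  assume d: "(\<forall>J. d J \<noteq> 0 \<longrightarrow> J \<subseteq> G \<and> card J = q) \<and>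
    (\<forall>J. d J \<in> graded_piece G B g {n. int (n + \<Sum>J) = s})"
  show "(\<forall>J. (c + d) J \<noteq> 0 \<longrightarrow> J \<subseteq> G \<and> card J = q) \<and>
    (\<forall>J. (c + d) J \<in> graded_piece G B g {n. int (n + \<Sum>J) = s})"
  proof (intro conjI allI)
    fix J
    have "(c + d) J \<noteq> 0 \<Longrightarrow> c J \<noteq> 0 \<or> d J \<noteq> 0" by auto
    then show "(c + d) J \<noteq> 0 \<longrightarrow> J \<subseteq> G \<and> card J = q" using c d by blast
    show "(c + d) J \<in> graded_piece G B g {n. int (n + \<Sum>J) = s}"
      unfolding plus_fun_apply
      by (rule kmod.subspace_add[OF subspace_graded_piece conjunct2[OF c, rule_format]
            conjunct2[OF d, rule_format]])
  qed
qed (simp add: kmod.subspace_0[OF subspace_graded_piece])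

lemma koszul_piece_finite_dim:
  assumes G: "finite G" "0 \<notin> G" and B: "\<And>d. finite {b \<in> B. g b = d}"
  obtains A where "finite A" "(koszul_piece G B g q s :: (nat set \<Rightarrow> ('k::field) mvec) set) \<subseteq> kfun.span A"
proof -
  define put where "put J v = (\<lambda>L. if L = J then v else 0)" for J :: "nat set" and v :: "'k mvec"
  have lin: "Vector_Spaces.linear kscale (\<lambda>k c J. kscale k (c J)) (put J)" for J
    unfolding Vector_Spaces.linear_iff using kmod.vector_space_axioms kfun.vector_space_axioms
    by (auto simp: put_def fun_eq_iff)
  have "\<exists>A. finite A \<and>
      (graded_piece G B g {n. int (n + \<Sum>J) = s} :: 'k mvec set) \<subseteq> kmod.span A" for J
  proof -
    have "finite {n. int (n + \<Sum>J) = s}"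
      by (rule finite_subset[of _ "{nat (s - int (\<Sum>J))}"]) auto
    from graded_piece_finite_dim[OF G B this] show ?thesis by metis
  qed
  then obtain A where A: "\<And>J. finite (A J)"
    "\<And>J. (graded_piece G B g {n. int (n + \<Sum>J) = s} :: 'k mvec set) \<subseteq> kmod.span (A J)"
    by metis
  let ?A = "\<Union>J\<in>Pow G. put J ` A J"
  have "c \<in> kfun.span ?A" if c: "c \<in> koszul_piece G B g q s" for c :: "nat set \<Rightarrow> 'k mvec"
  proof -
    have *: "(\<Sum>J\<in>X. put J (c J)) L = (if L \<in> X then c L else 0)" if "finite X" for X L
      using that by (induction X rule: finite_induct) (auto simp: put_def)
    have "c = (\<Sum>J\<in>Pow G. put J (c J))"
    proof
      show "c L = (\<Sum>J\<in>Pow G. put J (c J)) L" for L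
        using *[of "Pow G" L] koszul_pieceD(1)[OF c, of L] G(1) by (cases "L \<subseteq> G") auto
    qed
    also have "\<dots> \<in> kfun.span ?A"
    proof (rule kfun.span_sum)
      fix J assume J: "J \<in> Pow G"
      interpret put: Vector_Spaces.linear kscale "\<lambda>k c J. kscale k (c J)" "put J" by (rule lin)
      have "put J (c J) \<in> put J ` kmod.span (A J)" using koszul_pieceD(2)[OF c] A(2) by blast
      also have "\<dots> = kfun.span (put J ` A J)" by (rule put.span_image[symmetric])
      also have "\<dots> \<subseteq> kfun.span ?A" using J by (intro kfun.span_mono) blast
      finally show "put J (c J) \<in> kfun.span ?A" .
    qed
    finally show ?thesis .
  qed
  moreover have "finite ?A" using G A(1) by simp
  ultimately show thesis using that by blast
qed

abbreviation kdiff :: "nat set \<Rightarrow> (nat set \<Rightarrow> ('k::field) mvec) \<Rightarrow> nat set \<Rightarrow> 'k mvec" where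
  "kdiff G \<equiv> koszul G xvar"

lemma linear_kdiff:
  "Vector_Spaces.linear (\<lambda>k c J. kscale k (c J)) (\<lambda>k c J. kscale k (c J)) (kdiff G)"
  by (rule linear_koszul) (rule kmod.vector_space_axioms linear_xvar)+

interpretation kdiff: Vector_Spaces.linear "\<lambda>k (c :: nat set \<Rightarrow> ('k::field) mvec) J. kscale k (c J)"
  "\<lambda>k c J. kscale k (c J)" "kdiff G" for G
  by (rule linear_kdiff)

lemma kdiff_kdiff: "finite G \<Longrightarrow> kdiff G (kdiff G c) = 0"
  by (intro ext) (simp only: zero_fun_apply, rule koszul_koszul[OF _ pmod.scale_right_distrib xvar_commute])

lemma coefficient_kdiff:
  "coefficient (kdiff G c J) b \<alpha> = (\<Sum>j\<in>G - J. ksign j J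
    (if j \<in> Poly_Mapping.keys \<alpha> then coefficient (c (insert j J)) b (\<alpha> - Poly_Mapping.single j (Suc 0)) else 0))"
  unfolding koszul_def lookup_sum coefficient_ksign coefficient_xvar ..

lemma kdiff_koszul_piece:
  assumes G: "finite G" and c: "c \<in> koszul_piece G B g (Suc q) s"
  shows "kdiff G c \<in> koszul_piece G B g q s"
  unfolding koszul_piece_def
proof (intro CollectI allI impI)
  fix J b \<alpha> assume "coefficient (kdiff G c J) b \<alpha> \<noteq> 0"
  then obtain j where j: "j \<in> G" "j \<notin> J" "j \<in> Poly_Mapping.keys \<alpha>"
    "coefficient (c (insert j J)) b (\<alpha> - Poly_Mapping.single j (Suc 0)) \<noteq> 0"
    unfolding coefficient_kdiff
    by (rule sum.not_neutral_contains_not_neutral) (auto split: if_splits)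
  let ?\<beta> = "\<alpha> - Poly_Mapping.single j (Suc 0)"
  have *: "insert j J \<subseteq> G" "card (insert j J) = Suc q" "b \<in> B" "Poly_Mapping.keys ?\<beta> \<subseteq> G"
    "int (g b + mdeg ?\<beta> + \<Sum>(insert j J)) = s"
    using c j(4) unfolding koszul_piece_def by blast+
  have \<alpha>: "\<alpha> = Poly_Mapping.single j (Suc 0) + ?\<beta>" by (rule monom_eq_single_plus[OF j(3)])
  have "finite J" using finite_subset[OF *(1) G] by simp
  moreover have "mdeg \<alpha> = j + mdeg ?\<beta>" using mdeg_add[of "Poly_Mapping.single j (Suc 0)" ?\<beta>] \<alpha> by simp
  moreover have "Poly_Mapping.keys \<alpha> \<subseteq> G"
    using keys_monom_add[of "Poly_Mapping.single j (Suc 0)" ?\<beta>] \<alpha> *(4) j(1) by auto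
  ultimately show "J \<subseteq> G \<and> card J = q \<and> b \<in> B \<and> Poly_Mapping.keys \<alpha> \<subseteq> G \<and>
      int (g b + mdeg \<alpha> + \<Sum>J) = s"
    using * j(2) by simp
qed

text \<open>Division by the variable \<open>j\<close>, restricted to results in which no smaller
  variable occurs: a monomial survives only if \<open>j\<close> was its least variable.\<close>

definition lower :: "nat \<Rightarrow> ('k::field) mvec \<Rightarrow> 'k mvec" where
  "lower j v = Poly_Mapping.map (\<lambda>p. Poly_Mapping.mapp
     (\<lambda>\<alpha> k. if \<forall>i\<in>Poly_Mapping.keys \<alpha>. j \<le> i then k else 0)
     (Poly_Mapping.map_key (\<lambda>\<alpha>. \<alpha> + Poly_Mapping.single j (Suc 0)) p)) v"

lemma coefficient_lower:
  "coefficient (lower j v) b \<alpha> = (if \<forall>i\<in>Poly_Mapping.keys \<alpha>. j \<le> i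
     then coefficient v b (\<alpha> + Poly_Mapping.single j (Suc 0)) else 0)"
proof -
  have inj: "inj (\<lambda>\<alpha>::monom. \<alpha> + Poly_Mapping.single j (Suc 0))" by (rule injI) simp
  have "Poly_Mapping.lookup (Poly_Mapping.map_key (\<lambda>\<alpha>. \<alpha> + Poly_Mapping.single j (Suc 0)) p) \<alpha> =
      Poly_Mapping.lookup p (\<alpha> + Poly_Mapping.single j (Suc 0))" for p :: "'a mpoly"
    by (simp only: map_key.rep_eq[OF inj] o_apply)
  then show ?thesis
    by (auto simp: lower_def Poly_Mapping.map.rep_eq when_def lookup_mapp in_keys_iff)
qed

text \<open>The contraction of the Koszul complex: in each multidegree, the least variable occurring is
  moved from the monomial into the exterior part.\<close>

definition khomotopy :: "(nat set \<Rightarrow> ('k::field) mvec) \<Rightarrow> nat set \<Rightarrow> 'k mvec" where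
  "khomotopy c J = (if J = {} then 0 else lower (Min J) (c (J - {Min J})))"

lemma khomotopy_koszul_piece:
  assumes G: "finite G" and c: "c \<in> koszul_piece G B g q s"
  shows "khomotopy c \<in> koszul_piece G B g (Suc q) s"
  unfolding koszul_piece_def
proof (intro CollectI allI impI)
  fix J b \<alpha> assume nz: "coefficient (khomotopy c J) b \<alpha> \<noteq> 0"
  let ?j = "Min J"
  let ?\<beta> = "\<alpha> + Poly_Mapping.single ?j (Suc 0)"
  have J: "J \<noteq> {}" and nz: "coefficient (c (J - {?j})) b ?\<beta> \<noteq> 0"
    using nz by (auto simp: khomotopy_def coefficient_lower split: if_splits)
  have *: "J - {?j} \<subseteq> G" "card (J - {?j}) = q" "b \<in> B" "Poly_Mapping.keys ?\<beta> \<subseteq> G"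
    "int (g b + mdeg ?\<beta> + \<Sum>(J - {?j})) = s"
    using c nz unfolding koszul_piece_def by blast+
  have "finite J" using finite_subset[OF *(1) G] by simp
  moreover then have "?j \<in> J" using J by simp
  moreover have "?j \<in> G" "Poly_Mapping.keys \<alpha> \<subseteq> G" using *(4) by (auto simp: keys_monom_add)
  moreover have "mdeg ?\<beta> = mdeg \<alpha> + ?j" by (simp add: mdeg_add)
  moreover have "card J = Suc (card (J - {?j}))"
    using calculation(1,2) by (rule card.remove)
  moreover have "\<Sum>J = ?j + \<Sum>(J - {?j})" using calculation(1,2) by (rule sum.remove)
  ultimately show "J \<subseteq> G \<and> card J = Suc q \<and> b \<in> B \<and> Poly_Mapping.keys \<alpha> \<subseteq> G \<and>
      int (g b + mdeg \<alpha> + \<Sum>J) = s"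
    using * by auto
qed

text \<open>The identity is checked at each pair of \<open>J\<close> and \<alpha>, according to
  where the least index \<open>j0\<close> occurring in either of them sits. Where none occurs there
  is nothing to move, and \<open>const\<close> covers exactly that case.\<close>

lemma kdiff_khomotopy:
  assumes G: "finite G" and c: "c \<in> koszul_piece G B g q s" and cycle: "kdiff G c = 0"
    and const: "\<And>b. coefficient (c {}) b 0 = 0"
  shows "kdiff G (khomotopy c) = c"
proof (rule ext, rule coefficient_eqI)
  fix J b \<alpha>
  let ?e = "\<lambda>j. Poly_Mapping.single j (Suc 0) :: monom"
  let ?T = "\<lambda>j. if j \<in> Poly_Mapping.keys \<alpha>
    then coefficient (khomotopy c (insert j J)) b (\<alpha> - ?e j) else 0"
  have hc: "kdiff G (khomotopy c) \<in> koszul_piece G B g q s"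
    by (rule kdiff_koszul_piece[OF G khomotopy_koszul_piece[OF G c]])
  show "coefficient (kdiff G (khomotopy c) J) b \<alpha> = coefficient (c J) b \<alpha>"
  proof (cases "J \<subseteq> G \<and> Poly_Mapping.keys \<alpha> \<subseteq> G")
    case False
    then have "coefficient (kdiff G (khomotopy c) J) b \<alpha> = 0" "coefficient (c J) b \<alpha> = 0"
      using hc c unfolding koszul_piece_def by blast+
    then show ?thesis by simp
  next
    case True
    then have fin: "finite J" using finite_subset[OF _ G] by blast
    show ?thesis
    proof (cases "Poly_Mapping.keys \<alpha> \<union> J = {}")
      case True
      then show ?thesis using const[of b] by (simp add: coefficient_kdiff)
    next
      case ne: False
      define j0 where "j0 = Min (Poly_Mapping.keys \<alpha> \<union> J)"
      have j0: "j0 \<in> Poly_Mapping.keys \<alpha> \<union> J" "\<And>k. k \<in> Poly_Mapping.keys \<alpha> \<union> J \<Longrightarrow> j0 \<le> k"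
        unfolding j0_def using fin by (intro Min_in[OF _ ne] Min_le, simp)+
      have sub: "Poly_Mapping.keys (\<alpha> - ?e j) \<subseteq> Poly_Mapping.keys \<alpha>" for j
        by (auto simp: in_keys_iff lookup_minus)
      show ?thesis
      proof (cases "j0 \<in> J")
        case True
        let ?J = "J - {j0}"
        let ?U = "\<lambda>j. coefficient (c (insert j ?J)) b (\<alpha> + ?e j0 - ?e j)"
        have GJ: "G - ?J = insert j0 (G - J)" "j0 \<notin> G - J" and J: "insert j0 ?J = J"
          using True \<open>J \<subseteq> G \<and> _\<close> by auto
        \<comment> \<open>The cycle equation is read with \<open>j0\<close> moved from
          \<open>J\<close> into the monomial. Its \<open>j0\<close> term is the wanted coefficient,
          and its other terms are those of \<open>kdiff G (khomotopy c)\<close> with opposite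
          sign.\<close>
        have "0 = coefficient (kdiff G c ?J) b (\<alpha> + ?e j0)" using cycle by simp
        also have "\<dots> = ksign j0 ?J (coefficient (c J) b \<alpha>) +
            (\<Sum>j\<in>G - J. ksign j ?J (if j \<in> Poly_Mapping.keys \<alpha> then ?U j else 0))"
          unfolding coefficient_kdiff GJ(1) sum.insert[OF finite_Diff[OF G] GJ(2)]
          by (intro arg_cong2[where f = plus] sum.cong refl)
            (use True in \<open>auto simp: insert_absorb keys_monom_add\<close>)
        also have "(\<Sum>j\<in>G - J. ksign j ?J (if j \<in> Poly_Mapping.keys \<alpha> then ?U j else 0)) =
            (\<Sum>j\<in>G - J. - ksign j J (?T j))"
        proof (rule sum.cong[OF refl])
          fix j assume j: "j \<in> G - J"
          show "ksign j ?J (if j \<in> Poly_Mapping.keys \<alpha> then ?U j else 0) = - ksign j J (?T j)"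
          proof (cases "j \<in> Poly_Mapping.keys \<alpha>")
            case jk: True
            then have lt: "j0 < j" using j0(2)[of j] j True by (cases "j = j0") auto
            have "Min (insert j J) = j0"
              using fin True j0(2) jk by (intro Min_eqI) auto
            moreover have "insert j J - {j0} = insert j ?J" using lt by auto
            moreover have "\<alpha> - ?e j + ?e j0 = \<alpha> + ?e j0 - ?e j"
              using jk lt by (intro poly_mapping_eqI)
                (auto simp: lookup_add lookup_minus lookup_single when_def in_keys_iff)
            moreover have "\<forall>i\<in>Poly_Mapping.keys (\<alpha> - ?e j). j0 \<le> i" using sub j0(2) by blast
            ultimately have "?T j = ?U j"
              using jk by (simp add: khomotopy_def coefficient_lower)
            moreover have "ksign j J x = - ksign j ?J x" for x :: 'a
              using ksign_insert[of j0 ?J j x] lt J by simp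
            ultimately show ?thesis using jk by simp
          qed simp
        qed
        also have "\<dots> = - coefficient (kdiff G (khomotopy c) J) b \<alpha>"
          unfolding coefficient_kdiff sum_negf ..
        also have "ksign j0 ?J (coefficient (c J) b \<alpha>) = coefficient (c J) b \<alpha>"
          by (rule ksign_least) (use j0(2) in auto)
        finally show ?thesis by simp
      next
        case False
        then have j0k: "j0 \<in> Poly_Mapping.keys \<alpha>" using j0(1) by blast
        have j0J: "j0 \<in> G - J" using j0k False \<open>J \<subseteq> G \<and> _\<close> by blast
        \<comment> \<open>Dividing by \<open>j\<close> leaves \<open>j0\<close> in the monomial,
          below the least element of \<open>insert j J\<close>, so \<open>lower\<close> discards the
          term.\<close>
        have zero: "?T j = 0" if "j \<in> G - J" "j \<noteq> j0" for j
        proof (cases "j \<in> Poly_Mapping.keys \<alpha>")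
          case True
          have "j0 \<in> Poly_Mapping.keys (\<alpha> - ?e j)"
            using j0k that(2) by (auto simp: in_keys_iff lookup_minus lookup_single)
          moreover have "Min (insert j J) \<in> insert j J" using fin by (intro Min_in) auto
          then have "j0 < Min (insert j J)"
            using j0(2)[of "Min (insert j J)"] that(2) False True
            by (cases "Min (insert j J) = j0") auto
          ultimately show ?thesis by (auto simp: khomotopy_def coefficient_lower)
        qed simp
        have "coefficient (kdiff G (khomotopy c) J) b \<alpha> = (\<Sum>j\<in>{j0}. ksign j J (?T j))"
          unfolding coefficient_kdiff
          by (rule sum.mono_neutral_right) (use G j0J zero in auto)
        also have "\<dots> = ?T j0"
          using ksign_least[of J j0 "?T j0"] j0(2) by simp
        also have "\<dots> = coefficient (c J) b \<alpha>"
        proof -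
          have "Min (insert j0 J) = j0" using fin j0(2) by (intro Min_eqI) auto
          moreover have "insert j0 J - {j0} = J" using False by auto
          moreover have "\<alpha> - ?e j0 + ?e j0 = \<alpha>"
            using monom_eq_single_plus[OF j0k] by (simp add: add.commute)
          moreover have "\<forall>i\<in>Poly_Mapping.keys (\<alpha> - ?e j0). j0 \<le> i" using sub j0(2) by blast
          ultimately show ?thesis using j0k by (simp add: khomotopy_def coefficient_lower)
        qed
        finally show ?thesis .
      qed
    qed
  qed
qed

lemma kdiff_exact:
  assumes "finite G"
  shows "{c \<in> koszul_piece G B g (Suc q) s. kdiff G c = 0} =
    kdiff G ` (koszul_piece G B g (Suc (Suc q)) s :: (nat set \<Rightarrow> ('k::field) mvec) set)"
proof (intro set_eqI iffI)
  fix c :: "nat set \<Rightarrow> 'k mvec"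
  assume c: "c \<in> {c \<in> koszul_piece G B g (Suc q) s. kdiff G c = 0}"
  have "c {} = 0" using koszul_pieceD(1)[of c G B g "Suc q" s "{}"] c by auto
  then have "kdiff G (khomotopy c) = c"
    using kdiff_khomotopy[OF assms, of c B g "Suc q" s] c by simp
  then show "c \<in> kdiff G ` koszul_piece G B g (Suc (Suc q)) s"
    using khomotopy_koszul_piece[OF assms] c by force
next
  fix c :: "nat set \<Rightarrow> 'k mvec"
  assume "c \<in> kdiff G ` koszul_piece G B g (Suc (Suc q)) s"
  then show "c \<in> {c \<in> koszul_piece G B g (Suc q) s. kdiff G c = 0}"
    using kdiff_koszul_piece[OF assms] kdiff_kdiff[OF assms] by auto
qed

text \<open>At the end of the Koszul complex the cokernel is the free module reduced to its constant
  coefficients, that is, tensored with the residue field. This is where Tor meets the double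
  complex.\<close>

lemma kdiff_image_0:
  assumes "finite G"
  shows "kdiff G ` (koszul_piece G B g 1 s :: (nat set \<Rightarrow> ('k::field) mvec) set) =
    {c \<in> koszul_piece G B g 0 s. \<forall>b. coefficient (c {}) b 0 = 0}"
proof (intro set_eqI iffI)
  fix c :: "nat set \<Rightarrow> 'k mvec"
  assume "c \<in> kdiff G ` koszul_piece G B g 1 s"
  then show "c \<in> {c \<in> koszul_piece G B g 0 s. \<forall>b. coefficient (c {}) b 0 = 0}"
    using kdiff_koszul_piece[OF assms] by (auto simp: coefficient_kdiff)
next
  fix c :: "nat set \<Rightarrow> 'k mvec"
  assume "c \<in> {c \<in> koszul_piece G B g 0 s. \<forall>b. coefficient (c {}) b 0 = 0}"
  then have c: "c \<in> koszul_piece G B g 0 s" "\<And>b. coefficient (c {}) b 0 = 0" by auto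
  have "c (insert j J) = 0" for j J
    using koszul_pieceD(1)[OF c(1), of "insert j J"] assms finite_subset by fastforce
  then have "kdiff G c = 0" by (intro ext) (simp add: koszul_def)
  then have "kdiff G (khomotopy c) = c" using kdiff_khomotopy[OF assms c(1)] c(2) by blast
  then show "c \<in> kdiff G ` koszul_piece G B g 1 s"
    using khomotopy_koszul_piece[OF assms c(1)] by force
qed

section \<open>Maps of free modules applied to Koszul chains\<close>

lemma dmap_kdiff: "dmap f (kdiff G c J) = kdiff G (\<lambda>J. dmap f (c J)) J"
proof -
  have "dmap f (ksign j J v) = ksign j J (dmap f v)" for j v
    by (simp add: ksign_def dmap.neg)
  then show ?thesis by (simp add: koszul_def dmap.sum dmap.scale)
qed

lemma dmap_koszul_piece:
  assumes "\<And>b. b \<in> B' \<Longrightarrow> f b \<in> graded_piece G B g {g' b}" and "c \<in> koszul_piece G B' g' q s"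
  shows "(\<lambda>J. dmap f (c J)) \<in> koszul_piece G B g q s"
  unfolding koszul_piece_iff
proof (intro conjI allI)
  fix J
  show "dmap f (c J) \<noteq> 0 \<longrightarrow> J \<subseteq> G \<and> card J = q"
    using koszul_pieceD(1)[OF assms(2), of J] by (cases "c J = 0") (simp_all add: dmap.zero)
  show "dmap f (c J) \<in> graded_piece G B g {n. int (n + \<Sum>J) = s}"
    by (rule dmap_graded_piece[OF assms(1) koszul_pieceD(2)[OF assms(2)]])
qed

lemma dmap_exact_koszul_piece:
  assumes f: "\<And>b. b \<in> B' \<Longrightarrow> f b \<in> graded_piece G B g {g' b}"
    and c: "c \<in> koszul_piece G B g q s" "\<And>J. c J \<in> dmap f ` graded_piece G B' g' UNIV"
  obtains c' where "c' \<in> koszul_piece G B' g' q s" "c = (\<lambda>J. dmap f (c' J))"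
proof -
  \<comment> \<open>Preimages are chosen separately for each \<open>J\<close>. Taking
    \<open>0\<close> over \<open>0\<close> keeps the support condition on the sets
    \<open>J\<close>.\<close>
  have "\<exists>w \<in> graded_piece G B' g' {n. int (n + \<Sum>J) = s}. dmap f w = c J \<and> (c J = 0 \<longrightarrow> w = 0)" for J
  proof (cases "c J = 0")
    case False
    then show ?thesis
      using dmap_exact_graded_piece[OF f koszul_pieceD(2)[OF c(1)] c(2)] by force
  qed (use kmod.subspace_0[OF subspace_graded_piece] dmap.zero in auto)
  then obtain c' where c': "\<And>J. c' J \<in> graded_piece G B' g' {n. int (n + \<Sum>J) = s}"
    "\<And>J. dmap f (c' J) = c J" "\<And>J. c J = 0 \<Longrightarrow> c' J = 0" by metis
  have "c' \<in> koszul_piece G B' g' q s"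
    unfolding koszul_piece_iff using c'(1,3) koszul_pieceD(1)[OF c(1)] by blast
  moreover have "c = (\<lambda>J. dmap f (c' J))" using c'(2) by simp
  ultimately show thesis by (rule that)
qed

section \<open>The augmentation and the residue field\<close>

lemma finite_min_gens:
  assumes "numerical_semigroup S"
  shows "finite (min_gens S)"
proof -
  have "finite (UNIV - S)" using assms unfolding numerical_semigroup_def by blast
  then obtain c where "\<forall>n\<in>UNIV - S. n < c" using finite_nat_bounded[of "UNIV - S"] by auto
  then have c: "n \<in> S" if "n \<ge> c" for n using that by (metis DiffI UNIV_I not_less)
  \<comment> \<open>Beyond this bound \<open>n\<close> splits as \<open>c + 1\<close> plus a number
    at least \<open>c + 1\<close>; the added 1 keeps both summands nonzero even for
    \<open>c = 0\<close>.\<close>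
  have "n < 2 * c + 2" if "n \<in> min_gens S" for n
  proof (rule ccontr)
    assume n: "\<not> n < 2 * c + 2"
    then have "c + 1 \<in> S" "n - (c + 1) \<in> S" "n = (c + 1) + (n - (c + 1))" "n - (c + 1) \<noteq> 0"
      using c by auto
    then show False using that unfolding min_gens_def by (metis (mono_tags, lifting) add_is_0 mem_Collect_eq one_neq_zero)
  qed
  then show ?thesis by (meson finite_nat_iff_bounded lessThan_iff subsetI)
qed

lemma zero_notin_min_gens [simp]: "0 \<notin> min_gens S"
  by (simp add: min_gens_def)

section \<open>The substitution as a ring homomorphism, and the degrees it produces\<close>

lemma mpoly_sum_single:
  fixes p :: "('k::field) mpoly"
  shows "p = (\<Sum>\<alpha>\<in>Poly_Mapping.keys p. Poly_Mapping.single \<alpha> (Poly_Mapping.lookup p \<alpha>))"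
proof (rule poly_mapping_eqI)
  fix \<beta>
  have "Poly_Mapping.lookup (\<Sum>\<alpha>\<in>Poly_Mapping.keys p. Poly_Mapping.single \<alpha> (Poly_Mapping.lookup p \<alpha>)) \<beta>
      = (\<Sum>\<alpha>\<in>Poly_Mapping.keys p. if \<alpha> = \<beta> then Poly_Mapping.lookup p \<beta> else 0)"
    unfolding lookup_sum by (rule sum.cong) (auto simp: lookup_single when_def)
  then show "Poly_Mapping.lookup p \<beta> =
      Poly_Mapping.lookup (\<Sum>\<alpha>\<in>Poly_Mapping.keys p. Poly_Mapping.single \<alpha> (Poly_Mapping.lookup p \<alpha>)) \<beta>"
    by (simp add: in_keys_iff)
qed

lemma subst_t_single [simp]: "subst_t (Poly_Mapping.single \<alpha> c) = Polynomial.monom c (mdeg \<alpha>)"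
  by (simp add: subst_t_def)

lemma subst_t_add: "subst_t (p + q) = subst_t p + subst_t q"
  unfolding subst_t_def
  by (rule setsum_keys_plus_distrib[where f = "\<lambda>\<alpha> c. Polynomial.monom c (mdeg \<alpha>)"])
    (simp_all add: add_monom)

lemma subst_t_0 [simp]: "subst_t 0 = 0"
  by (simp add: subst_t_def)

lemma subst_t_sum: "subst_t (sum f A) = (\<Sum>a\<in>A. subst_t (f a))"
  by (induction A rule: infinite_finite_induct) (simp_all add: subst_t_add)

lemma subst_t_mult: "subst_t (p * q) = subst_t p * subst_t q"
proof -
  let ?s = "\<lambda>p \<alpha>. Poly_Mapping.single \<alpha> (Poly_Mapping.lookup p \<alpha>)"
  have "subst_t (p * q) = subst_t ((\<Sum>\<alpha>\<in>Poly_Mapping.keys p. ?s p \<alpha>) * (\<Sum>\<beta>\<in>Poly_Mapping.keys q. ?s q \<beta>))"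
    using mpoly_sum_single[of p] mpoly_sum_single[of q] by simp
  also have "\<dots> = subst_t (\<Sum>\<alpha>\<in>Poly_Mapping.keys p. ?s p \<alpha>) * subst_t (\<Sum>\<beta>\<in>Poly_Mapping.keys q. ?s q \<beta>)"
    by (simp add: sum_product subst_t_sum mult_single mult_monom mdeg_add)
  also have "\<dots> = subst_t p * subst_t q"
    using mpoly_sum_single[of p] mpoly_sum_single[of q] by simp
  finally show ?thesis .
qed

lemma coeff_subst_t_nonzeroD:
  assumes "coeff (subst_t p) n \<noteq> 0"
  obtains \<alpha> where "Poly_Mapping.lookup p \<alpha> \<noteq> 0" "mdeg \<alpha> = n"
proof -
  have "(\<Sum>\<alpha>\<in>Poly_Mapping.keys p. coeff (Polynomial.monom (Poly_Mapping.lookup p \<alpha>) (mdeg \<alpha>)) n) \<noteq> 0"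
    using assms by (simp add: subst_t_def coeff_sum)
  then obtain \<alpha> where "coeff (Polynomial.monom (Poly_Mapping.lookup p \<alpha>) (mdeg \<alpha>)) n \<noteq> 0"
    by (rule sum.not_neutral_contains_not_neutral)
  then show thesis using that by (auto split: if_splits)
qed

lemma aug_add: "aug F (v + w) = aug F v + aug F w"
  unfolding aug_def
  by (rule setsum_keys_plus_distrib[where f = "\<lambda>b p. subst_t p * baug F b"])
    (simp_all add: subst_t_add distrib_right)

lemma aug_pscale: "aug F (pscale p v) = subst_t p * aug F v"
proof -
  have "Poly_Mapping.keys (pscale p v) \<subseteq> Poly_Mapping.keys v"
    by (auto simp: in_keys_iff lookup_map_mult)
  then have "aug F (pscale p v) =
      (\<Sum>b\<in>Poly_Mapping.keys v. subst_t (Poly_Mapping.lookup (pscale p v) b) * baug F b)"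
    unfolding aug_def by (intro sum_keys_superset[where g = "\<lambda>b p. subst_t p * baug F b"]) auto
  then show ?thesis by (simp add: aug_def sum_distrib_left lookup_map_mult subst_t_mult mult.assoc)
qed

lemma aug_0 [simp]: "aug F 0 = 0"
  by (simp add: aug_def)

lemma aug_minus: "aug F (- v) = - aug F v"
  using aug_add[of F v "- v"] by (simp add: eq_neg_iff_add_eq_0 add.commute)

lemma aug_sum: "aug F (sum f A) = (\<Sum>a\<in>A. aug F (f a))"
  by (induction A rule: infinite_finite_induct) (simp_all add: aug_add)

lemma aug_ksign: "aug F (ksign j J v) = ksign j J (aug F v)"
  by (simp add: ksign_def aug_minus)

lemma aug_graded_piece:
  assumes v: "v \<in> graded_piece G (basis F 0) (bdeg F 0) D"
    and deg: "\<And>b m. b \<in> basis F 0 \<Longrightarrow> coeff (baug F b) m \<noteq> 0 \<Longrightarrow> m = bdeg F 0 b"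
    and n: "coeff (aug F v) n \<noteq> 0"
  shows "n \<in> D"
proof -
  have "(\<Sum>b\<in>Poly_Mapping.keys v. coeff (subst_t (Poly_Mapping.lookup v b) * baug F b) n) \<noteq> 0"
    using n by (simp add: aug_def coeff_sum)
  then obtain b where b: "coeff (subst_t (Poly_Mapping.lookup v b) * baug F b) n \<noteq> 0"
    by (rule sum.not_neutral_contains_not_neutral)
  then obtain i where i: "i \<le> n" "coeff (subst_t (Poly_Mapping.lookup v b)) i \<noteq> 0"
    "coeff (baug F b) (n - i) \<noteq> 0"
    unfolding coeff_mult by (rule sum.not_neutral_contains_not_neutral) auto
  obtain \<alpha> where \<alpha>: "coefficient v b \<alpha> \<noteq> 0" "mdeg \<alpha> = i"
    using coeff_subst_t_nonzeroD[OF i(2)] .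
  then have bD: "b \<in> basis F 0" "bdeg F 0 b + i \<in> D" using v unfolding graded_piece_def by blast+
  have "n - i = bdeg F 0 b" by (rule deg[OF bD(1) i(3)])
  then have "n = bdeg F 0 b + i" using i(1) by simp
  then show ?thesis using bD(2) by simp
qed

lemma mdeg_min_gens:
  assumes "numerical_semigroup S" "Poly_Mapping.keys \<alpha> \<subseteq> min_gens S"
  shows "mdeg \<alpha> \<in> S"
proof -
  have "mdeg \<alpha> \<in> nat_span (min_gens S)"
    unfolding nat_span_def mdeg_def using assms(2) by (auto intro!: exI[of _ "Poly_Mapping.keys \<alpha>"])
  then show ?thesis using nat_span_min_gens[OF assms(1)] by simp
qed

lemma monom_of_semigroup:
  assumes "numerical_semigroup S" "u \<in> S"
  obtains \<alpha> where "Poly_Mapping.keys \<alpha> \<subseteq> min_gens S" "mdeg \<alpha> = u"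
proof -
  have "u \<in> nat_span (min_gens S)" using assms nat_span_min_gens by simp
  then obtain F c where F: "finite F" "F \<subseteq> min_gens S" "u = (\<Sum>a\<in>F. c a * a)"
    unfolding nat_span_def by blast
  let ?\<alpha> = "\<Sum>a\<in>F. Poly_Mapping.single a (c a)"
  have "Poly_Mapping.keys ?\<alpha> \<subseteq> (\<Union>a\<in>F. Poly_Mapping.keys (Poly_Mapping.single a (c a)))"
    by (rule keys_sum)
  also have "\<dots> \<subseteq> F" by auto
  finally have "Poly_Mapping.keys ?\<alpha> \<subseteq> min_gens S" using F(2) by blast
  moreover have "mdeg ?\<alpha> = u"
    unfolding F(3) using F(1) by (induction F rule: finite_induct) (simp_all add: mdeg_add)
  ultimately show thesis by (rule that)
qed

lemma coeff_semigroup_ring: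
  assumes "numerical_semigroup S" "p \<in> semigroup_ring S" "coeff p n \<noteq> 0"
  shows "n \<in> S"
proof -
  obtain q where q: "q \<in> poly_ring S" "p = subst_t q" using assms(2) unfolding semigroup_ring_def by blast
  then obtain \<alpha> where \<alpha>: "Poly_Mapping.lookup q \<alpha> \<noteq> 0" "mdeg \<alpha> = n"
    using coeff_subst_t_nonzeroD assms(3) by metis
  then have "Poly_Mapping.keys \<alpha> \<subseteq> min_gens S"
    using q(1) unfolding poly_ring_def by (auto simp: in_keys_iff)
  then show ?thesis using mdeg_min_gens[OF assms(1)] \<alpha>(2) by blast
qed

lemma monom_in_semigroup_ring:
  assumes "numerical_semigroup S" "u \<in> S"
  shows "Polynomial.monom k u \<in> semigroup_ring S"
proof -
  obtain \<alpha> where "Poly_Mapping.keys \<alpha> \<subseteq> min_gens S" "mdeg \<alpha> = u"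
    using monom_of_semigroup[OF assms] .
  then have "Poly_Mapping.single \<alpha> k \<in> poly_ring S" "subst_t (Poly_Mapping.single \<alpha> k) = Polynomial.monom k u"
    by (auto simp: poly_ring_def)
  then show ?thesis unfolding semigroup_ring_def by (metis image_eqI)
qed

text \<open>The passage to the residue field. It is applied to chains of exterior degree 0, for
  which the empty set carries the only component.\<close>

definition const_part :: "(nat set \<Rightarrow> ('k::field) mvec) \<Rightarrow> (nat \<Rightarrow>\<^sub>0 'k)" where
  "const_part c = Poly_Mapping.map (\<lambda>p. Poly_Mapping.lookup p 0) (c {})"

lemma lookup_const_part: "Poly_Mapping.lookup (const_part c) b = coefficient (c {}) b 0"
  by (simp add: const_part_def Poly_Mapping.map.rep_eq when_def)

lemma lookup_mult_0: "Poly_Mapping.lookup (p * q) 0 = Poly_Mapping.lookup p 0 * Poly_Mapping.lookup q 0"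
  for p q :: "('k::field) mpoly"
proof -
  have add0: "(0 = l + m) = (l = 0 \<and> m = 0)" for l m :: "nat \<Rightarrow>\<^sub>0 nat"
    by (auto simp: poly_mapping_eq_iff fun_eq_iff lookup_add)
  have inner: "(Sum_any (\<lambda>m. Poly_Mapping.lookup q m when 0 = l + m)) =
      (Poly_Mapping.lookup q 0 when l = 0)" for l
  proof (cases "l = 0")
    case True
    then show ?thesis by simp
  qed (simp add: add0)
  show ?thesis unfolding lookup_mult inner by (simp add: mult_when)
qed

lemma tensor_diff_const_part: "tensor_diff F i (const_part c) = const_part (\<lambda>J. dmap (bdiff F i) (c J))"
proof (rule poly_mapping_eqI)
  fix b'
  have "Poly_Mapping.lookup (tensor_diff F i (const_part c)) b' =
      (\<Sum>b\<in>Poly_Mapping.keys (const_part c). coefficient (c {}) b 0 * coefficient (bdiff F i b) b' 0)"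
    by (simp add: tensor_diff_def lookup_sum Poly_Mapping.map.rep_eq lookup_const_part when_def)
      (rule sum.cong, auto)
  also have "\<dots> = (\<Sum>b\<in>Poly_Mapping.keys (c {}). coefficient (c {}) b 0 * coefficient (bdiff F i b) b' 0)"
    by (rule sum.mono_neutral_left) (auto simp: in_keys_iff lookup_const_part)
  also have "\<dots> = Poly_Mapping.lookup (const_part (\<lambda>J. dmap (bdiff F i) (c J))) b'"
    by (simp add: lookup_const_part dmap_def lookup_sum lookup_map_mult lookup_mult_0)
  finally show "Poly_Mapping.lookup (tensor_diff F i (const_part c)) b' =
      Poly_Mapping.lookup (const_part (\<lambda>J. dmap (bdiff F i) (c J))) b'" .
qed

lemma linear_const_part:
  "Vector_Spaces.linear (\<lambda>k c J. kscale k (c J)) (\<lambda>k. Poly_Mapping.map ((*) k)) const_part"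
  unfolding Vector_Spaces.linear_iff
  using kfun.vector_space_axioms kvec.vector_space_axioms
  by (auto intro!: poly_mapping_eqI simp: lookup_const_part lookup_add lookup_map_mult lookup_const_mult)

lemma const_part_koszul_piece:
  fixes F :: "'k::field free_complex"
  shows "const_part ` koszul_piece G (basis F i) (bdeg F i) 0 s = tensor_piece F i s"
proof (intro set_eqI iffI)
  fix w :: "nat \<Rightarrow>\<^sub>0 'k" assume "w \<in> const_part ` koszul_piece G (basis F i) (bdeg F i) 0 s"
  then show "w \<in> tensor_piece F i s"
    by (force simp: tensor_piece_def in_keys_iff lookup_const_part koszul_piece_def)
next
  fix w :: "nat \<Rightarrow>\<^sub>0 'k" assume w: "w \<in> tensor_piece F i s"
  define c where "c = (\<lambda>J :: nat set. if J = {} then Poly_Mapping.map (Poly_Mapping.single (0::monom)) w else 0 :: 'k mvec)"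
  have coef: "coefficient (c J) b \<alpha> = (if J = {} \<and> \<alpha> = 0 then Poly_Mapping.lookup w b else 0)" for J b \<alpha>
    by (auto simp: c_def Poly_Mapping.map.rep_eq when_def lookup_single)
  have "c \<in> koszul_piece G (basis F i) (bdeg F i) 0 s"
    unfolding koszul_piece_def
  proof (intro CollectI allI impI)
    fix J b \<alpha> assume "coefficient (c J) b \<alpha> \<noteq> 0"
    then have "J = {}" "\<alpha> = 0" "Poly_Mapping.lookup w b \<noteq> 0" by (auto simp: coef split: if_splits)
    then show "J \<subseteq> G \<and> card J = 0 \<and> b \<in> basis F i \<and> Poly_Mapping.keys \<alpha> \<subseteq> G \<and>
        int (bdeg F i b + mdeg \<alpha> + \<Sum>J) = s"
      using w by (auto simp: tensor_piece_def in_keys_iff subset_iff)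
  qed
  moreover have "const_part c = w"
    by (rule poly_mapping_eqI) (simp add: lookup_const_part coef)
  ultimately show "w \<in> const_part ` koszul_piece G (basis F i) (bdeg F i) 0 s" by blast
qed

section \<open>Balancing Tor\<close>

locale semigroup_resolution =
  fixes S :: "nat set" and F :: "'k::field free_complex"
  assumes S: "numerical_semigroup S" and F: "graded_free_resolution S F"
begin

abbreviation "G \<equiv> min_gens S"

abbreviation E :: "nat \<Rightarrow> nat \<Rightarrow> int \<Rightarrow> (nat set \<Rightarrow> 'k mvec) set" where
  "E p \<equiv> koszul_piece G (basis F p) (bdeg F p)"

abbreviation row :: "nat \<Rightarrow> (nat set \<Rightarrow> 'k mvec) \<Rightarrow> nat set \<Rightarrow> 'k mvec" where
  "row p c \<equiv> \<lambda>J. dmap (bdiff F p) (c J)"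

abbreviation free :: "nat \<Rightarrow> 'k mvec set" where
  "free p \<equiv> graded_piece G (basis F p) (bdeg F p) UNIV"

text \<open>Koszul chains with coefficients in the image of the differential from homological degree
  \<open>p + 1\<close> to \<open>p\<close>. By exactness this image is the kernel leaving degree
  \<open>p\<close>, the kernel of the augmentation if \<open>p = 0\<close>.\<close>

definition syzygies :: "nat \<Rightarrow> nat \<Rightarrow> int \<Rightarrow> (nat set \<Rightarrow> 'k mvec) set" where
  "syzygies p q s = row p ` E (Suc p) q s"

lemma finite_gens: "finite G" by (rule finite_min_gens[OF S])

lemma finite_basis: "finite {b \<in> basis F p. bdeg F p b = d}"
  using F[unfolded graded_free_resolution_def, THEN conjunct1] by blast

lemma bdiff_piece:
  assumes "b \<in> basis F (Suc p)"
  shows "bdiff F p b \<in> graded_piece G (basis F p) (bdeg F p) {bdeg F (Suc p) b}"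
  using F[unfolded graded_free_resolution_def, THEN conjunct2, THEN conjunct2, THEN conjunct1] assms
  unfolding homogeneous_free_mod_eq[symmetric] by blast

lemma kernel_dmap:
  "{v \<in> free (Suc p). dmap (bdiff F p) v = 0} = dmap (bdiff F (Suc p)) ` free (Suc (Suc p))"
  using F[unfolded graded_free_resolution_def, THEN conjunct2, THEN conjunct2, THEN conjunct2, THEN conjunct2, THEN conjunct2]
  unfolding free_mod_eq differential_eq_dmap by blast

lemma kernel_aug: "{v \<in> free 0. aug F v = 0} = dmap (bdiff F 0) ` free (Suc 0)"
  using F[unfolded graded_free_resolution_def, THEN conjunct2, THEN conjunct2, THEN conjunct2, THEN conjunct2, THEN conjunct1]
  unfolding free_mod_eq differential_eq_dmap One_nat_def .

lemma image_aug: "aug F ` free 0 = semigroup_ring S"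
  using F[unfolded graded_free_resolution_def, THEN conjunct2, THEN conjunct2, THEN conjunct2, THEN conjunct1]
  unfolding free_mod_eq .

lemma baug_degree: "b \<in> basis F 0 \<Longrightarrow> coeff (baug F b) m \<noteq> 0 \<Longrightarrow> m = bdeg F 0 b"
  using F[unfolded graded_free_resolution_def, THEN conjunct2, THEN conjunct1] by blast

lemma E_free: "c \<in> E p q s \<Longrightarrow> c J \<in> free p"
  using koszul_pieceD(2) graded_piece_mono[OF subset_UNIV] by blast

lemma row_E: "c \<in> E (Suc p) q s \<Longrightarrow> row p c \<in> E p q s"
  by (rule dmap_koszul_piece[OF bdiff_piece])

lemma kdiff_E: "c \<in> E p (Suc q) s \<Longrightarrow> kdiff G c \<in> E p q s"
  by (rule kdiff_koszul_piece[OF finite_gens])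

lemma row_kdiff: "row p (kdiff G c) = kdiff G (row p c)"
  by (rule ext) (rule dmap_kdiff)

lemma row_kernel: "{c \<in> E (Suc p) q s. row p c = 0} = syzygies (Suc p) q s"
proof (intro set_eqI iffI)
  fix c assume c: "c \<in> {c \<in> E (Suc p) q s. row p c = 0}"
  then have "dmap (bdiff F p) (c J) = 0" for J by (metis (mono_tags, lifting) mem_Collect_eq zero_fun_apply)
  then have *: "c J \<in> dmap (bdiff F (Suc p)) ` free (Suc (Suc p))" for J
    unfolding kernel_dmap[symmetric] using E_free c by blast
  from c have "c \<in> E (Suc p) q s" by blast
  from dmap_exact_koszul_piece[OF bdiff_piece this *] show "c \<in> syzygies (Suc p) q s"
    unfolding syzygies_def by blast
next
  fix c assume "c \<in> syzygies (Suc p) q s"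
  then obtain e where e: "e \<in> E (Suc (Suc p)) q s" "c = row (Suc p) e" unfolding syzygies_def by blast
  have "dmap (bdiff F p) (dmap (bdiff F (Suc p)) (e J)) = 0" for J
    using kernel_dmap[of p] E_free[OF e(1), of J] by blast
  then show "c \<in> {c \<in> E (Suc p) q s. row p c = 0}"
    using row_E e by (auto simp: zero_fun_def)
qed

text \<open>On chains of degree \<open>s\<close> the augmentation of \<open>c J\<close> is
  homogeneous of degree \<open>s - \<Sum>J\<close>, so one coefficient holds everything. If that
  degree is negative the augmentation vanishes, and the coefficient read at the truncated
  \<open>0\<close> is correctly zero.\<close>

definition eval_aug :: "int \<Rightarrow> (nat set \<Rightarrow> 'k mvec) \<Rightarrow> nat set \<Rightarrow> 'k" where
  "eval_aug s c J = coeff (aug F (c J)) (nat (s - int (\<Sum>J)))"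

lemma linear_eval_aug:
  "Vector_Spaces.linear (\<lambda>k c J. kscale k (c J)) (\<lambda>k c J. k * c J) (eval_aug s)"
proof -
  interpret s: vector_space "(*) :: 'k \<Rightarrow> 'k \<Rightarrow> 'k" by unfold_locales (auto simp: algebra_simps)
  have "vector_space (\<lambda>k (c :: nat set \<Rightarrow> 'k) J. k * c J)"
    by (rule vector_space_pointwise) unfold_locales
  then show ?thesis
    unfolding Vector_Spaces.linear_iff using kfun.vector_space_axioms
    by (auto simp: fun_eq_iff eval_aug_def aug_add aug_pscale monom_0)
qed

lemma aug_E:
  assumes "c \<in> E 0 q s" "coeff (aug F (c J)) n \<noteq> 0"
  shows "int n + int (\<Sum>J) = s"
  using aug_graded_piece[OF koszul_pieceD(2)[OF assms(1)] baug_degree assms(2)]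
  unfolding of_nat_add[symmetric] mem_Collect_eq .

lemma eval_aug_image: "eval_aug s ` E 0 q s = degree_chains S q s"
proof (intro set_eqI iffI)
  fix a assume "a \<in> eval_aug s ` E 0 q s"
  then obtain c where c: "c \<in> E 0 q s" "a = eval_aug s c" by blast
  show "a \<in> degree_chains S q s"
    unfolding degree_chains_def
  proof (intro CollectI allI impI)
    fix J assume nz: "a J \<noteq> 0"
    let ?u = "nat (s - int (\<Sum>J))"
    have nz: "coeff (aug F (c J)) ?u \<noteq> 0" using nz c(2) by (simp add: eval_aug_def)
    then have "c J \<noteq> 0" by auto
    then have "J \<subseteq> G \<and> card J = q" using koszul_pieceD(1)[OF c(1)] by blast
    moreover have "aug F (c J) \<in> semigroup_ring S" using image_aug E_free[OF c(1)] by blast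
    then have "?u \<in> S" using coeff_semigroup_ring[OF S] nz by blast
    moreover have "int (?u + \<Sum>J) = s" using aug_E[OF c(1) nz] by (simp only: of_nat_add)
    ultimately show "J \<subseteq> G \<and> card J = q \<and> (\<exists>u\<in>S. int (u + \<Sum>J) = s)" by blast
  qed
next
  fix a :: "nat set \<Rightarrow> 'k" assume a: "a \<in> degree_chains S q s"
  have "\<exists>w. w \<in> graded_piece G (basis F 0) (bdeg F 0) {n. int (n + \<Sum>J) = s} \<and>
      coeff (aug F w) (nat (s - int (\<Sum>J))) = a J \<and> (a J = 0 \<longrightarrow> w = 0)" for J
  proof (cases "a J = 0")
    case True
    then show ?thesis using kmod.subspace_0[OF subspace_graded_piece] by (intro exI[of _ 0]) simp
  next
    case False
    then obtain u where u: "u \<in> S" "int (u + \<Sum>J) = s" using a unfolding degree_chains_def by blast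
    then have nat: "nat (s - int (\<Sum>J)) = u" by linarith
    have "Polynomial.monom (a J) u \<in> aug F ` free 0"
      unfolding image_aug by (rule monom_in_semigroup_ring[OF S u(1)])
    then obtain v where v: "v \<in> free 0" "aug F v = Polynomial.monom (a J) u" by (metis imageE)
    \<comment> \<open>The preimage given by surjectivity need not be homogeneous; its part of degree
      \<open>u\<close> has the same coefficient there.\<close>
    obtain v1 v2 where s: "v1 \<in> graded_piece G (basis F 0) (bdeg F 0) (UNIV \<inter> {u})"
      "v2 \<in> graded_piece G (basis F 0) (bdeg F 0) (UNIV - {u})" "v = v1 + v2"
      using graded_piece_split[OF v(1)] .
    have "coeff (aug F v2) u = 0" using aug_graded_piece[OF s(2) baug_degree, of u] by blast
    then have "coeff (aug F v1) u = a J" using v(2) s(3) by (metis aug_add add.right_neutral coeff_add coeff_monom)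
    moreover have "v1 \<in> graded_piece G (basis F 0) (bdeg F 0) {n. int (n + \<Sum>J) = s}"
      using s(1) u(2) graded_piece_mono[of "UNIV \<inter> {u}" "{n. int (n + \<Sum>J) = s}"] by auto
    ultimately show ?thesis using False nat by blast
  qed
  then obtain c where c: "\<And>J. c J \<in> graded_piece G (basis F 0) (bdeg F 0) {n. int (n + \<Sum>J) = s}"
    "\<And>J. coeff (aug F (c J)) (nat (s - int (\<Sum>J))) = a J" "\<And>J. a J = 0 \<Longrightarrow> c J = 0" by metis
  have "c \<in> E 0 q s"
    unfolding koszul_piece_iff using c(1,3) a unfolding degree_chains_def by blast
  moreover have "eval_aug s c = a" using c(2) by (intro ext) (simp add: eval_aug_def)
  ultimately show "a \<in> eval_aug s ` E 0 q s" by blast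
qed

lemma eval_aug_kernel: "{c \<in> E 0 q s. eval_aug s c = 0} = syzygies 0 q s"
proof (intro set_eqI iffI)
  fix c assume c: "c \<in> {c \<in> E 0 q s. eval_aug s c = 0}"
  have "aug F (c J) = 0" for J
  proof (rule ccontr)
    assume "aug F (c J) \<noteq> 0"
    then obtain n where n: "coeff (aug F (c J)) n \<noteq> 0" by (metis poly_eqI coeff_0)
    then have "int n + int (\<Sum>J) = s" using aug_E c by blast
    then have "nat (s - int (\<Sum>J)) = n" by linarith
    moreover have "eval_aug s c J = 0" using c by simp
    ultimately show False using n by (simp add: eval_aug_def)
  qed
  then have *: "c J \<in> dmap (bdiff F 0) ` free (Suc 0)" for J
    unfolding kernel_aug[symmetric] using E_free c by blast
  from c have "c \<in> E 0 q s" by blast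
  from dmap_exact_koszul_piece[OF bdiff_piece this *] show "c \<in> syzygies 0 q s"
    unfolding syzygies_def by blast
next
  fix c assume "c \<in> syzygies 0 q s"
  then obtain e where e: "e \<in> E (Suc 0) q s" "c = row 0 e" unfolding syzygies_def by blast
  have "aug F (dmap (bdiff F 0) (e J)) = 0" for J
    using kernel_aug E_free[OF e(1), of J] by blast
  then show "c \<in> {c \<in> E 0 q s. eval_aug s c = 0}"
    using row_E e by (auto simp: zero_fun_def eval_aug_def)
qed

lemma eval_aug_kdiff:
  assumes c: "c \<in> E 0 q s"
  shows "eval_aug s (kdiff G c) = simplicial_koszul G (eval_aug s c)"
proof
  fix J
  let ?u = "nat (s - int (\<Sum>J))"
  have "coeff (ksign j J (Polynomial.monom 1 j * aug F (c (insert j J)))) ?u =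
      ksign j J (coeff (aug F (c (insert j J))) (nat (s - int (\<Sum>(insert j J)))))"
    if j: "j \<in> G - J" for j
  proof (cases "c (insert j J) = 0")
    case False
    then have "insert j J \<subseteq> G" using koszul_pieceD(1)[OF c] by blast
    then have "finite J" using finite_gens finite_subset by auto
    then have sum: "\<Sum>(insert j J) = j + \<Sum>J" using j by simp
    have "coeff (Polynomial.monom 1 j * aug F (c (insert j J))) ?u =
        coeff (aug F (c (insert j J))) (nat (s - int (\<Sum>(insert j J))))"
    proof (cases "j \<le> ?u")
      case True
      then have "nat (s - int (\<Sum>(insert j J))) = ?u - j" unfolding sum by linarith
      then show ?thesis using True by (simp add: coeff_monom_mult)
    next
      \<comment> \<open>Here the target degree of \<open>c (insert j J)\<close> is negative or
        \<open>?u\<close> is truncated; homogeneity makes the coefficient zero on this side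
        too.\<close>
      case F: False
      have "coeff (aug F (c (insert j J))) (nat (s - int (\<Sum>(insert j J)))) = 0"
      proof (rule ccontr)
        assume "\<not> ?thesis"
        from aug_E[OF c this] have "int (j + \<Sum>J) \<le> s" unfolding sum by linarith
        then show False using F by linarith
      qed
      then show ?thesis using F by (simp add: coeff_monom_mult)
    qed
    then show ?thesis by (simp add: ksign_def)
  qed simp
  then show "eval_aug s (kdiff G c) J = simplicial_koszul G (eval_aug s c) J"
    by (simp add: eval_aug_def koszul_def aug_sum aug_ksign aug_pscale coeff_sum)
qed

text \<open>This represents Tor in homological degree \<open>p + q + 1\<close>: Koszul homology of
  the syzygy module \<open>p\<close> in exterior degree \<open>q\<close>, restricted to boundaries
  of the free module. For \<open>q > 0\<close> the restriction is automatic; for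
  \<open>q = 0\<close> it gives the kernel after tensoring the inclusion into the free module with
  the residue field.\<close>

definition tor_dim :: "nat \<Rightarrow> nat \<Rightarrow> int \<Rightarrow> nat" where
  "tor_dim p q s = kfun.dim (syzygies p q s \<inter> kdiff G ` E p (Suc q) s) -
     kfun.dim (kdiff G ` syzygies p (Suc q) s)"

lemma linear_row:
  "Vector_Spaces.linear (\<lambda>k c J. kscale k (c J)) (\<lambda>k c J. kscale k (c J)) (row p)"
  by (rule linear_pointwise[OF linear_dmap])

lemma fin_dim_E: obtains A where "finite A" "E p q s \<subseteq> kfun.span A"
  using koszul_piece_finite_dim[OF finite_gens zero_notin_min_gens finite_basis] by metis

text \<open>The connecting isomorphism for the augmentation onto R, whose kernel is the first syzygy
  module. It lowers the exterior degree by one.\<close>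

lemma koszul_homology_eq_tor_dim:
  "vector_space.dim (\<lambda>k c x. k * c x)
      {a \<in> degree_chains S (Suc q) s. simplicial_koszul G a = (0 :: nat set \<Rightarrow> 'k)} -
    vector_space.dim (\<lambda>k c x. k * c x)
      (simplicial_koszul G ` (degree_chains S (Suc (Suc q)) s :: (nat set \<Rightarrow> 'k) set)) =
    tor_dim 0 q s"
proof -
  obtain A where A: "finite A" "E 0 (Suc q) s \<subseteq> kfun.span A" using fin_dim_E .
  show ?thesis
    unfolding tor_dim_def eval_aug_kernel[symmetric]
    by (rule dim_homology_shift[OF linear_kdiff linear_eval_aug linear_simplicial_koszul
          subspace_koszul_piece subspace_koszul_piece subspace_koszul_piece A _
          eval_aug_image eval_aug_image _ kdiff_exact[OF finite_gens]])
      (use kdiff_E eval_aug_kdiff in auto)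
qed

text \<open>The same step for the free module in degree \<open>p + 1\<close> mapping onto the syzygy
  module \<open>p\<close>, with the syzygy module \<open>p + 1\<close> as kernel.\<close>

lemma tor_dim_shift: "tor_dim p (Suc q) s = tor_dim (Suc p) q s"
proof -
  obtain A where A: "finite A" "E (Suc p) (Suc q) s \<subseteq> kfun.span A" using fin_dim_E .
  \<comment> \<open>In positive exterior degree every cycle of the free module is a boundary, so the
    restriction in \<open>tor_dim\<close> reduces to the cycle condition.\<close>
  have "syzygies p (Suc q) s \<inter> kdiff G ` E p (Suc (Suc q)) s = {z \<in> syzygies p (Suc q) s. kdiff G z = 0}"
    unfolding kdiff_exact[OF finite_gens, symmetric] syzygies_def using row_E by blast
  then have "tor_dim p (Suc q) s = kfun.dim {z \<in> syzygies p (Suc q) s. kdiff G z = 0} -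
      kfun.dim (kdiff G ` syzygies p (Suc (Suc q)) s)"
    unfolding tor_dim_def by simp
  also have "\<dots> = tor_dim (Suc p) q s"
    unfolding tor_dim_def row_kernel[symmetric]
    by (rule dim_homology_shift[OF linear_kdiff linear_row linear_kdiff
          subspace_koszul_piece subspace_koszul_piece subspace_koszul_piece A _
          syzygies_def[symmetric] syzygies_def[symmetric] _ kdiff_exact[OF finite_gens]])
      (use kdiff_E row_kdiff in auto)
  finally show ?thesis .
qed

lemma tor_dim_diagonal: "tor_dim 0 p s = tor_dim p 0 s"
proof -
  have "tor_dim r (p - r) s = tor_dim p 0 s" if "r \<le> p" for r
    using that
  proof (induction r rule: inc_induct)
    case (step n)
    then have "p - n = Suc (p - Suc n)" by simp
    then show ?case using step tor_dim_shift[of n "p - Suc n"] by simp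
  qed simp
  from this[of 0] show ?thesis by simp
qed

text \<open>At the edge \<open>q = 0\<close> the comparison runs through the chains of
  \<open>?V\<close>, whose image under \<open>row p\<close> has no constant coefficients.
  \<open>const_part\<close> maps them onto the cycles of the tensored complex, \<open>row p\<close>
  onto the numerator of \<open>tor_dim p 0 s\<close>.\<close>

lemma tor_eq_tor_dim:
  "kvec.dim (tor_cycles F (Suc p) s) - kvec.dim (tor_boundaries F (Suc p) s) = tor_dim p 0 s"
proof -
  obtain A where A: "finite A" "E (Suc p) 0 s \<subseteq> kfun.span A" using fin_dim_E .
  interpret row: Vector_Spaces.linear "\<lambda>k c J. kscale k (c J)" "\<lambda>k c J. kscale k (c J)" "row r" for r
    by (rule linear_row)
  interpret const: Vector_Spaces.linear "\<lambda>k c J. kscale k (c J)" "\<lambda>k. Poly_Mapping.map ((*) (k :: 'k))" const_part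
    by (rule linear_const_part)
  let ?V = "{c \<in> E (Suc p) 0 s. row p c \<in> kdiff G ` E p 1 s}"
  have V: "kfun.subspace ?V"
    using kfun.subspace_inter[OF subspace_koszul_piece
        row.subspace_linear_preimage[OF kdiff.subspace_image[OF subspace_koszul_piece]]]
    by (simp add: Int_def)
  have boundary_iff: "c \<in> kdiff G ` E p 1 s \<longleftrightarrow> const_part c = 0" if "c \<in> E p 0 s" for c p
    unfolding kdiff_image_0[OF finite_gens] poly_mapping_eq_iff using that
    by (auto simp: fun_eq_iff lookup_const_part)
  have Viff: "row p c \<in> kdiff G ` E p 1 s \<longleftrightarrow> tensor_diff F p (const_part c) = 0"
    if "c \<in> E (Suc p) 0 s" for c
    unfolding tensor_diff_const_part by (rule boundary_iff[OF row_E[OF that]])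
  have im1: "const_part ` ?V = tor_cycles F (Suc p) s"
    unfolding tor_cycles_def using Viff const_part_koszul_piece[of G F "Suc p" s] by force
  have im2: "row p ` ?V = syzygies p 0 s \<inter> kdiff G ` E p 1 s"
    unfolding syzygies_def by blast
  have W: "tor_boundaries F (Suc p) s = const_part ` row (Suc p) ` E (Suc (Suc p)) 0 s"
    unfolding tor_boundaries_def const_part_koszul_piece[of G, symmetric] image_image
      tensor_diff_const_part ..
  have W1: "kvec.subspace (tor_boundaries F (Suc p) s)"
    unfolding W by (intro const.subspace_image row.subspace_image subspace_koszul_piece)
  have 0: "(0 :: nat set \<Rightarrow> 'k mvec) \<in> kdiff G ` E p 1 s"
    by (rule kfun.subspace_0[OF kdiff.subspace_image[OF subspace_koszul_piece]])
  have W2: "tor_boundaries F (Suc p) s \<subseteq> const_part ` ?V"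
  proof -
    have "row (Suc p) ` E (Suc (Suc p)) 0 s \<subseteq> ?V"
      unfolding syzygies_def[symmetric] row_kernel[symmetric] using 0 by auto
    then show ?thesis unfolding W by (rule image_mono)
  qed
  have X1: "kfun.subspace (kdiff G ` syzygies p 1 s)"
    unfolding syzygies_def by (intro kdiff.subspace_image row.subspace_image subspace_koszul_piece)
  have X2: "kdiff G ` syzygies p 1 s \<subseteq> row p ` ?V"
  proof
    fix x assume "x \<in> kdiff G ` syzygies p 1 s"
    then obtain e where e: "e \<in> E (Suc p) 1 s" "x = kdiff G (row p e)" unfolding syzygies_def by blast
    then have "x = row p (kdiff G e)" by (simp only: row_kdiff)
    moreover have "kdiff G e \<in> ?V"
      using e kdiff_E[of e "Suc p" 0] row_E[OF e(1)] by (auto simp: row_kdiff)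
    ultimately show "x \<in> row p ` ?V" by blast
  qed
  \<comment> \<open>Both conditions say that \<open>c\<close> is the sum of a boundary of the
    resolution and a Koszul boundary: \<open>const_part\<close> kills the second summand,
    \<open>row p\<close> the first.\<close>
  have iff: "const_part c \<in> tor_boundaries F (Suc p) s \<longleftrightarrow> row p c \<in> kdiff G ` syzygies p 1 s"
    if c: "c \<in> ?V" for c
  proof
    assume "const_part c \<in> tor_boundaries F (Suc p) s"
    then obtain e where e: "e \<in> E (Suc (Suc p)) 0 s" "const_part c = const_part (row (Suc p) e)"
      unfolding W by blast
    let ?r = "row (Suc p) e"
    have "?r \<in> syzygies (Suc p) 0 s" using e(1) unfolding syzygies_def by blast
    then have r: "?r \<in> E (Suc p) 0 s" "row p ?r = 0"
      unfolding row_kernel[symmetric] mem_Collect_eq by blast+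
    have "c - ?r \<in> E (Suc p) 0 s" using c r(1) kfun.subspace_diff[OF subspace_koszul_piece] by blast
    moreover have "const_part (c - ?r) = 0" using e(2) by (simp only: const.diff diff_self)
    ultimately obtain y where y: "y \<in> E (Suc p) 1 s" "c - ?r = kdiff G y"
      using boundary_iff by blast
    have "row p c = row p (c - ?r)" unfolding row.diff r(2) by simp
    also have "\<dots> = kdiff G (row p y)" unfolding y(2) by (rule row_kdiff)
    finally show "row p c \<in> kdiff G ` syzygies p 1 s" using y(1) unfolding syzygies_def by blast
  next
    assume "row p c \<in> kdiff G ` syzygies p 1 s"
    then obtain y where y: "y \<in> E (Suc p) 1 s" "row p c = kdiff G (row p y)" unfolding syzygies_def by blast
    have ky: "kdiff G y \<in> E (Suc p) 0 s" using kdiff_E[of y "Suc p" 0] y(1) by simp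
    have "row p (c - kdiff G y) = 0" unfolding row.diff y(2) row_kdiff by simp
    moreover have "c - kdiff G y \<in> E (Suc p) 0 s"
      using c ky kfun.subspace_diff[OF subspace_koszul_piece] by blast
    ultimately have "c - kdiff G y \<in> syzygies (Suc p) 0 s"
      unfolding row_kernel[symmetric] mem_Collect_eq by blast
    then obtain e where e: "e \<in> E (Suc (Suc p)) 0 s" "c - kdiff G y = row (Suc p) e"
      unfolding syzygies_def by blast
    have "const_part (kdiff G y) = 0" using boundary_iff[OF ky] y(1) by blast
    then have "const_part c = const_part (c - kdiff G y)" by (simp add: const.diff)
    then show "const_part c \<in> tor_boundaries F (Suc p) s" unfolding W e(2) using e(1) by blast
  qed
  have "?V \<subseteq> kfun.span A" using A(2) by blast
  from dim_quotient_eqI[OF linear_const_part linear_row V A(1) this W1 W2 X1 X2 iff]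
  show ?thesis unfolding im1 im2 tor_dim_def by simp
qed

lemma tor_eq_koszul_homology:
  "kvec.dim (tor_cycles F (Suc p) s) - kvec.dim (tor_boundaries F (Suc p) s) =
    vector_space.dim (\<lambda>k c x. k * c x)
      {a \<in> degree_chains S (Suc p) s. simplicial_koszul G a = (0 :: nat set \<Rightarrow> 'k)} -
    vector_space.dim (\<lambda>k c x. k * c x)
      (simplicial_koszul G ` (degree_chains S (Suc (Suc p)) s :: (nat set \<Rightarrow> 'k) set))"
  by (simp add: tor_eq_tor_dim koszul_homology_eq_tor_dim tor_dim_diagonal)

end

section \<open>Existence of graded free resolutions\<close>

text \<open>The last clause is homogeneity: with a vector, its part in any set \<open>D\<close> of
  degrees also belongs to \<open>K\<close>. Splitting into \<open>D\<close> and \<open>- D\<close>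
  lets kernels be treated by disjointness of degrees.\<close>

definition graded_submodule ::
    "nat set \<Rightarrow> nat set \<Rightarrow> (nat \<Rightarrow> nat) \<Rightarrow> ('k::field) mvec set \<Rightarrow> bool" where
  "graded_submodule G B g K \<longleftrightarrow>
     K \<subseteq> graded_piece G B g UNIV \<and> 0 \<in> K \<and> (\<forall>v\<in>K. \<forall>w\<in>K. v + w \<in> K) \<and>
     (\<forall>p. \<forall>v\<in>K. (\<forall>\<alpha>\<in>Poly_Mapping.keys p. Poly_Mapping.keys \<alpha> \<subseteq> G) \<longrightarrow> pscale p v \<in> K) \<and>
     (\<forall>D. \<forall>v\<in>graded_piece G B g D. \<forall>w\<in>graded_piece G B g (- D). v + w \<in> K \<longrightarrow> v \<in> K)"

lemma pscale_graded_piece_UNIV: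
  assumes "v \<in> graded_piece G B g D" "\<forall>\<alpha>\<in>Poly_Mapping.keys p. Poly_Mapping.keys \<alpha> \<subseteq> G"
  shows "pscale p v \<in> graded_piece G B g UNIV"
  by (rule pscale_graded_piece[OF assms(1)]) (use assms(2) in \<open>auto simp: in_keys_iff\<close>)

lemma graded_submodule_kernel:
  assumes add: "\<And>v w. L (v + w) = L v + (L w :: 'b::ab_group_add)"
    and scale: "\<And>p v. L v = 0 \<Longrightarrow> L (pscale p v) = 0"
    and graded: "\<And>D v w. v \<in> graded_piece G B g D \<Longrightarrow> w \<in> graded_piece G B g (- D) \<Longrightarrow>
      L v + L w = 0 \<Longrightarrow> L v = 0"
  shows "graded_submodule G B g {v \<in> graded_piece G B g UNIV. L v = 0}"
proof -
  have "L 0 = 0" using add[of 0 0] by simp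
  moreover have "v \<in> graded_piece G B g D \<Longrightarrow> v \<in> graded_piece G B g UNIV" for v D
    using graded_piece_mono[of D UNIV] by blast
  ultimately show ?thesis
    unfolding graded_submodule_def
    using kmod.subspace_0[OF subspace_graded_piece] kmod.subspace_add[OF subspace_graded_piece]
      pscale_graded_piece_UNIV graded
    by (auto simp: add scale)
qed

lemma graded_submodule_kernel_dmap:
  assumes f: "\<And>b. b \<in> B' \<Longrightarrow> f b \<in> graded_piece G B g {g' b}"
  shows "graded_submodule G B' g' {v \<in> graded_piece G B' g' UNIV. dmap f v = 0}"
proof (rule graded_submodule_kernel)
  fix D and v w :: "'a mvec"
  assume v: "v \<in> graded_piece G B' g' D" and w: "w \<in> graded_piece G B' g' (- D)"
    and 0: "dmap f v + dmap f w = 0"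
  have "dmap f w \<in> graded_piece G B g (- D)" by (rule dmap_graded_piece[OF f w])
  then have "- dmap f w \<in> graded_piece G B g (- D)" by (rule kmod.subspace_neg[OF subspace_graded_piece])
  moreover have "dmap f v = - dmap f w" using 0 by (simp add: eq_neg_iff_add_eq_0)
  ultimately show "dmap f v = 0"
    using graded_piece_disjoint[OF dmap_graded_piece[OF f v], of "- D"] by simp
qed (simp_all add: dmap.add dmap.scale)

lemma graded_submodule_kernel_aug:
  assumes deg: "\<And>b m. b \<in> basis F 0 \<Longrightarrow> coeff (baug F b) m \<noteq> 0 \<Longrightarrow> m = bdeg F 0 b"
  shows "graded_submodule G (basis F 0) (bdeg F 0)
    {v \<in> graded_piece G (basis F 0) (bdeg F 0) UNIV. aug F v = 0}"
proof (rule graded_submodule_kernel)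
  fix D and v w :: "'a mvec"
  assume v: "v \<in> graded_piece G (basis F 0) (bdeg F 0) D"
    and w: "w \<in> graded_piece G (basis F 0) (bdeg F 0) (- D)" and 0: "aug F v + aug F w = 0"
  have "coeff (aug F v) n = 0" for n
  proof (cases "n \<in> D")
    case True
    then have "coeff (aug F w) n = 0" using aug_graded_piece[OF w deg, of n] by blast
    moreover have "coeff (aug F v + aug F w) n = 0" unfolding 0 by simp
    ultimately show ?thesis by simp
  next
    case False
    then show ?thesis using aug_graded_piece[OF v deg, of n] by blast
  qed
  then show "aug F v = 0" by (simp add: poly_eq_iff)
qed (simp_all add: aug_add aug_pscale)

lemma dmap_single: "dmap f (Poly_Mapping.single b p) = pscale p (f b)"
  by (simp add: dmap_def)

lemma finite_degrees:
  fixes v :: "('k::field) mvec"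
  assumes "v \<in> graded_piece G B g UNIV"
  obtains D where "finite D" "v \<in> graded_piece G B g D"
proof -
  let ?X = "SIGMA b:Poly_Mapping.keys v. Poly_Mapping.keys (Poly_Mapping.lookup v b)"
  let ?D = "(\<lambda>(b, \<alpha>). g b + mdeg \<alpha>) ` ?X"
  have "finite ?D" by (intro finite_imageI finite_SigmaI) auto
  moreover have "v \<in> graded_piece G B g ?D"
    unfolding graded_piece_def
  proof (intro CollectI allI impI)
    fix b \<alpha> assume nz: "coefficient v b \<alpha> \<noteq> 0"
    then have "(b, \<alpha>) \<in> ?X" by (auto simp: in_keys_iff)
    then have "g b + mdeg \<alpha> \<in> ?D" by (rule rev_image_eqI) simp
    then show "b \<in> B \<and> Poly_Mapping.keys \<alpha> \<subseteq> G \<and> g b + mdeg \<alpha> \<in> ?D"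
      using nz assms unfolding graded_piece_def by blast
  qed
  ultimately show thesis by (rule that)
qed

text \<open>One basis element per vector of a field basis of each graded piece of \<open>K\<close>.
  This is far from minimal, but finite in every degree, which is all a resolution has to
  satisfy.\<close>

lemma graded_submodule_free_cover:
  assumes G: "finite G" "0 \<notin> G" and B: "\<And>d. finite {b \<in> B. g b = d}"
    and K: "graded_submodule G B g (K :: ('k::field) mvec set)"
  obtains B' g' f where "\<And>d. finite {b \<in> B'. g' b = d}"
    "\<And>b. b \<in> B' \<Longrightarrow> f b \<in> graded_piece G B g {g' b}"
    "dmap f ` graded_piece G B' g' UNIV = K"
proof -
  have K1: "K \<subseteq> graded_piece G B g UNIV" and K0: "0 \<in> K"
    and Kadd: "\<And>v w. v \<in> K \<Longrightarrow> w \<in> K \<Longrightarrow> v + w \<in> K"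
    and Kscale: "\<And>p v. v \<in> K \<Longrightarrow> (\<And>\<alpha>. \<alpha> \<in> Poly_Mapping.keys p \<Longrightarrow> Poly_Mapping.keys \<alpha> \<subseteq> G) \<Longrightarrow> pscale p v \<in> K"
    and Kpart: "\<And>D v w. v \<in> graded_piece G B g D \<Longrightarrow> w \<in> graded_piece G B g (- D) \<Longrightarrow> v + w \<in> K \<Longrightarrow> v \<in> K"
    using K unfolding graded_submodule_def by blast+
  have "\<exists>l. set l \<subseteq> K \<inter> graded_piece G B g {d} \<and> K \<inter> graded_piece G B g {d} \<subseteq> kmod.span (set l)" for d
  proof -
    obtain A where A: "finite A" "(graded_piece G B g {d} :: 'k mvec set) \<subseteq> kmod.span A"
      using graded_piece_finite_dim[OF G B, of "{d}"] by auto
    have "K \<inter> graded_piece G B g {d} \<subseteq> kmod.span A" using A(2) by blast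
    then obtain C where C: "finite C" "C \<subseteq> K \<inter> graded_piece G B g {d}" "kmod.independent C"
      "K \<inter> graded_piece G B g {d} \<subseteq> kmod.span C"
      by (rule kmod.finite_basis_of_subset[OF A(1)])
    obtain l where "set l = C" using finite_list[OF C(1)] by blast
    then show ?thesis using C(2,4) by (intro exI[of _ l]) simp
  qed
  then obtain l where l: "\<And>d. set (l d) \<subseteq> K \<inter> graded_piece G B g {d}"
    "\<And>d. K \<inter> graded_piece G B g {d} \<subseteq> kmod.span (set (l d))" by metis
  \<comment> \<open>Basis indices must be natural numbers, so the pair of degree and position in the
    list \<open>l d\<close> is encoded as one.\<close>
  define B' where "B' = {prod_encode (d, j) |d j. j < length (l d)}"
  define g' where "g' b = fst (prod_decode b)" for b
  define f where "f b = l (fst (prod_decode b)) ! snd (prod_decode b)" for b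
  have fb: "f b \<in> K \<inter> graded_piece G B g {g' b}" if "b \<in> B'" for b
    using that l(1) nth_mem unfolding B'_def f_def g'_def by fastforce
  have "finite {b \<in> B'. g' b = d}" for d
    by (rule finite_subset[of _ "(\<lambda>j. prod_encode (d, j)) ` {..<length (l d)}"])
      (auto simp: B'_def g'_def)
  moreover have "f b \<in> graded_piece G B g {g' b}" if "b \<in> B'" for b using fb[OF that] by blast
  moreover have "dmap f ` graded_piece G B' g' UNIV = K"
  proof (intro set_eqI iffI)
    fix x assume "x \<in> dmap f ` graded_piece G B' g' UNIV"
    then obtain v where v: "v \<in> graded_piece G B' g' UNIV" "x = dmap f v" by blast
    have sum: "(\<And>a. a \<in> X \<Longrightarrow> h a \<in> K) \<Longrightarrow> sum h X \<in> K" if "finite X" for h and X :: "nat set"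
      using that by (induction X rule: finite_induct) (auto simp: K0 Kadd)
    show "x \<in> K"
      unfolding v(2) dmap_def
    proof (rule sum[OF finite_keys])
      fix b assume "b \<in> Poly_Mapping.keys v"
      then have "Poly_Mapping.lookup v b \<noteq> 0" by (simp add: in_keys_iff)
      then obtain \<beta> where "coefficient v b \<beta> \<noteq> 0" by (metis lookup_zero poly_mapping_eqI)
      then have b: "b \<in> B'" using v(1) unfolding graded_piece_def by blast
      show "pscale (Poly_Mapping.lookup v b) (f b) \<in> K"
        using fb[OF b] v(1) unfolding graded_piece_def by (intro Kscale) (auto simp: in_keys_iff)
    qed
  next
    let ?I = "dmap f ` graded_piece G B' g' UNIV"
    interpret f: Vector_Spaces.linear kscale kscale "dmap f" by (rule linear_dmap)
    have I: "kmod.subspace ?I" by (rule f.subspace_image[OF subspace_graded_piece])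
    have span: "kmod.span (set (l d)) \<subseteq> ?I" for d
    proof (rule kmod.span_minimal[OF _ I], rule subsetI)
      fix x assume "x \<in> set (l d)"
      then obtain j where j: "j < length (l d)" "x = l d ! j" by (metis in_set_conv_nth)
      let ?b = "prod_encode (d, j)"
      have "x = dmap f (Poly_Mapping.single ?b 1)" by (simp add: dmap_single f_def j(2))
      moreover have "Poly_Mapping.single ?b 1 \<in> graded_piece G B' g' UNIV"
        using j(1) by (auto simp: graded_piece_def lookup_single lookup_one when_def B'_def split: if_splits)
      ultimately show "x \<in> ?I" by blast
    qed
    \<comment> \<open>Homogeneous parts are split off one degree at a time; they remain in
      \<open>K\<close> by homogeneity, and each lies in the span of its list.\<close>
    have main: "v \<in> ?I" if "finite D" "v \<in> K" "v \<in> graded_piece G B g D" for D v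
      using that
    proof (induction D arbitrary: v rule: finite_induct)
      case empty
      then have "v = 0" using graded_piece_disjoint[of v G B g "{}" "{}"] by simp
      then show ?case using kmod.subspace_0[OF I] by simp
    next
      case (insert d D)
      obtain v1 v2 where v: "v1 \<in> graded_piece G B g (insert d D \<inter> {d})"
        "v2 \<in> graded_piece G B g (insert d D - {d})" "v = v1 + v2"
        using graded_piece_split[OF insert.prems(2)] .
      have v1: "v1 \<in> graded_piece G B g {d}" "v1 \<in> graded_piece G B g (- (- {d}))" using v(1) by auto
      have v2: "v2 \<in> graded_piece G B g D" "v2 \<in> graded_piece G B g (- {d})"
        using v(2) graded_piece_mono[of "insert d D - {d}"] by blast+
      have "v1 \<in> K" using Kpart[OF v1(1) v2(2)] insert.prems(1) v(3) by simp
      then have "v1 \<in> ?I" using l(2) span v1(1) by blast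
      moreover have "v2 \<in> K" using Kpart[OF v2(2) v1(2)] insert.prems(1) v(3) by (simp add: add.commute)
      then have "v2 \<in> ?I" using insert.IH v2(1) by blast
      ultimately show ?case unfolding v(3) by (rule kmod.subspace_add[OF I])
    qed
    fix x assume x: "x \<in> K"
    obtain D where "finite D" "x \<in> graded_piece G B g D"
      by (rule finite_degrees[OF subsetD[OF K1 x]])
    then show "x \<in> ?I" using main x by blast
  qed
  ultimately show thesis by (rule that)
qed

lemma aug_unit_image:
  assumes "basis F 0 = {0}" "bdeg F 0 = (\<lambda>_. 0)" "baug F = (\<lambda>_. 1)"
  shows "aug F ` free_mod S F 0 = semigroup_ring S"
proof -
  have aug: "aug F v = subst_t (Poly_Mapping.lookup v 0)" if "Poly_Mapping.keys v \<subseteq> {0}" for v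
  proof -
    have "aug F v = (\<Sum>b\<in>{0}. subst_t (Poly_Mapping.lookup v b) * baug F b)"
      unfolding aug_def
      by (rule sum_keys_superset[where g = "\<lambda>b p. subst_t p * baug F b"]) (use that in auto)
    then show ?thesis by (simp add: assms(3))
  qed
  show ?thesis
  proof (intro set_eqI iffI)
    fix x assume "x \<in> aug F ` free_mod S F 0"
    then show "x \<in> semigroup_ring S"
      using aug assms(1) by (auto simp: free_mod_def semigroup_ring_def)
  next
    fix x :: "'a poly" assume "x \<in> semigroup_ring S"
    then obtain p where p: "p \<in> poly_ring S" "x = subst_t p" unfolding semigroup_ring_def by blast
    have "0 \<in> poly_ring S" by (simp add: poly_ring_def)
    then have "Poly_Mapping.single 0 p \<in> free_mod S F 0"
      using p(1) by (auto simp: free_mod_def assms(1) lookup_single when_def)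
    moreover have "x = aug F (Poly_Mapping.single 0 p)" using p(2) aug[of "Poly_Mapping.single 0 p"] by simp
    ultimately show "x \<in> aug F ` free_mod S F 0" by blast
  qed
qed

text \<open>Start with the polynomial ring itself over R and cover each kernel by the preceding
  construction; dependent choice produces the whole sequence.\<close>

lemma graded_free_resolution_exists:
  assumes S: "numerical_semigroup S"
  shows "\<exists>F :: 'k::field free_complex. graded_free_resolution S F"
proof -
  let ?G = "min_gens S"
  define F0 :: "'k free_complex" where
    "F0 = \<lparr>basis = \<lambda>_. {0}, bdeg = \<lambda>_ _. 0, bdiff = \<lambda>_ _. 0, baug = \<lambda>_. 1\<rparr>"
  define K0 :: "'k mvec set" where "K0 = {v \<in> graded_piece ?G {0} (\<lambda>_. 0) UNIV. aug F0 v = 0}"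
  \<comment> \<open>A stage consists of a basis \<open>B\<close> with degrees \<open>g\<close>, the
    columns \<open>f\<close> of its map to the previous stage, and the kernel \<open>K\<close> that
    the next stage has to cover. The clause for \<open>n = 0\<close> pins down the kernel of the
    augmentation.\<close>
  define P where "P n x \<longleftrightarrow> (case x of (B, g, f :: nat \<Rightarrow> 'k mvec, K :: 'k mvec set) \<Rightarrow>
      (\<forall>d. finite {b \<in> B. g b = d}) \<and> graded_submodule ?G B g K \<and>
      (n = (0::nat) \<longrightarrow> B = {0} \<and> g = (\<lambda>_. 0) \<and> K = K0))" for n x
  define Q where "Q x y \<longleftrightarrow> (case x of (B, g, f :: nat \<Rightarrow> 'k mvec, K :: 'k mvec set) \<Rightarrow> case y of (B', g', f' :: nat \<Rightarrow> 'k mvec, K' :: 'k mvec set) \<Rightarrow>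
      (\<forall>b\<in>B'. f' b \<in> graded_piece ?G B g {g' b}) \<and> dmap f' ` graded_piece ?G B' g' UNIV = K \<and>
      K' = {v \<in> graded_piece ?G B' g' UNIV. dmap f' v = 0})" for x y
  have deg1: "coeff 1 m \<noteq> 0 \<Longrightarrow> m = 0" for m by (cases m) simp_all
  have "graded_submodule ?G (basis F0 0) (bdeg F0 0)
      {v \<in> graded_piece ?G (basis F0 0) (bdeg F0 0) UNIV. aug F0 v = 0}"
    by (rule graded_submodule_kernel_aug) (auto simp: F0_def intro: deg1)
  then have K0: "graded_submodule ?G {0} (\<lambda>_. 0) K0" unfolding K0_def by (simp add: F0_def)
  have start: "\<exists>x. P 0 x"
  proof -
    have "finite {b \<in> {0::nat}. (\<lambda>_. 0) b = (d::nat)}" for d by (rule finite_subset[of _ "{0}"]) auto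
    then show ?thesis
      using K0 by (intro exI[of _ "({0}, \<lambda>_. 0, \<lambda>_. 0, K0)"]) (auto simp: P_def)
  qed
  have step: "\<exists>y. P (Suc n) y \<and> Q x y" if "P n x" for n x
  proof -
    obtain B g f K where x: "x = (B, g, f, K)" by (cases x)
    have fin: "\<And>d. finite {b \<in> B. g b = d}" and K: "graded_submodule ?G B g K"
      using that unfolding P_def x by auto
    obtain B' g' f' where c: "\<And>d. finite {b \<in> B'. g' b = d}"
      "\<And>b. b \<in> B' \<Longrightarrow> f' b \<in> graded_piece ?G B g {g' b}"
      "dmap f' ` graded_piece ?G B' g' UNIV = K"
      by (rule graded_submodule_free_cover[OF finite_min_gens[OF S] zero_notin_min_gens fin K]) (rule that; blast)
    let ?y = "(B', g', f', {v \<in> graded_piece ?G B' g' UNIV. dmap f' v = 0})"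
    have "P (Suc n) ?y"
      using c(1) graded_submodule_kernel_dmap[of B' f' ?G B g g'] c(2) by (auto simp: P_def)
    moreover have "Q x ?y" using c(2,3) by (simp add: Q_def x)
    ultimately show ?thesis by blast
  qed
  obtain X where X: "\<And>n. P n (X n)" "\<And>n. Q (X n) (X (Suc n))"
    using dependent_nat_choice[of P "\<lambda>_. Q"] start step by metis
  define B where "B n = fst (X n)" for n
  define g where "g n = fst (snd (X n))" for n
  define f where "f n = fst (snd (snd (X n)))" for n
  define K where "K n = snd (snd (snd (X n)))" for n
  have Xn: "X n = (B n, g n, f n, K n)" for n by (simp add: B_def g_def f_def K_def)
  have fin: "finite {b \<in> B n. g n b = d}" for n d using X(1)[of n] by (simp add: P_def Xn)
  have zero: "B 0 = {0}" "g 0 = (\<lambda>_. 0)" "K 0 = K0" using X(1)[of 0] by (simp_all add: P_def Xn)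
  have f: "b \<in> B (Suc n) \<Longrightarrow> f (Suc n) b \<in> graded_piece ?G (B n) (g n) {g (Suc n) b}"
    and im: "dmap (f (Suc n)) ` graded_piece ?G (B (Suc n)) (g (Suc n)) UNIV = K n"
    and ker: "K (Suc n) = {v \<in> graded_piece ?G (B (Suc n)) (g (Suc n)) UNIV. dmap (f (Suc n)) v = 0}"
    for n b using X(2)[of n] by (simp_all add: Q_def Xn)
  define F :: "'k free_complex" where
    \<comment> \<open>The map out of stage \<open>n + 1\<close> is stored with that stage, while
      \<open>bdiff\<close> is indexed by its target; the \<open>f\<close> of stage 0 is a
      dummy.\<close>
    "F = \<lparr>basis = B, bdeg = g, bdiff = \<lambda>n. f (Suc n), baug = \<lambda>_. 1\<rparr>"
  have sel: "basis F = B" "bdeg F = g" "bdiff F n = f (Suc n)" "baug F = (\<lambda>_. 1)" for n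
    by (simp_all add: F_def)
  have aug: "aug F = aug F0" by (simp add: fun_eq_iff aug_def F_def F0_def)
  have "Polynomial.monom 1 0 \<in> semigroup_ring S"
    by (rule monom_in_semigroup_ring[OF S]) (use S in \<open>simp add: numerical_semigroup_def\<close>)
  then have one: "(1 :: 'k poly) \<in> semigroup_ring S" by (simp add: monom_0 one_pCons)
  have "graded_free_resolution S F"
    unfolding graded_free_resolution_def
  proof (intro conjI allI ballI impI)
    show "finite {b \<in> basis F i. bdeg F i b = d}" for i d by (simp add: sel fin)
    show "baug F b \<in> semigroup_ring S" for b by (simp add: sel one)
    show "m = bdeg F 0 b" if "coeff (baug F b) m \<noteq> 0" for b m
      using that deg1 by (simp add: sel zero)
    show "bdiff F i b \<in> free_mod S F i" "homogeneous F i (bdeg F (Suc i) b) (bdiff F i b)"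
      if "b \<in> basis F (Suc i)" for i b
      using f[of b i] that homogeneous_free_mod_eq[of "bdiff F i b" S F i "bdeg F (Suc i) b"]
      by (simp_all add: sel)
    show "aug F ` free_mod S F 0 = semigroup_ring S"
      by (rule aug_unit_image) (simp_all add: sel zero)
    show "{v \<in> free_mod S F 0. aug F v = 0} = differential F 0 ` free_mod S F 1"
      unfolding free_mod_eq differential_eq_dmap sel aug One_nat_def im zero K0_def ..
    show "{v \<in> free_mod S F (Suc i). differential F i v = 0} =
        differential F (Suc i) ` free_mod S F (Suc (Suc i))" for i
      unfolding free_mod_eq differential_eq_dmap sel im ker ..
  qed
  then show ?thesis by blast
qed

section \<open>Arf semigroups\<close>

lemma numerical_semigroupD:
  assumes "numerical_semigroup S"
  shows "0 \<in> S" "\<And>a b. a \<in> S \<Longrightarrow> b \<in> S \<Longrightarrow> a + b \<in> S"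
  using assms unfolding numerical_semigroup_def by blast+

text \<open>The least nonzero element exists as the complement of \<open>S\<close> is finite, and it
  cannot be a sum of two nonzero elements. So the least generator bounds all nonzero elements, not
  only generators.\<close>

lemma semigroup_multiplicity:
  assumes S: "numerical_semigroup S"
  shows "semigroup_multiplicity S \<in> min_gens S" "0 < semigroup_multiplicity S"
    and "u \<in> S \<Longrightarrow> u \<noteq> 0 \<Longrightarrow> semigroup_multiplicity S \<le> u"
proof -
  have "\<exists>u. u \<in> S \<and> u \<noteq> 0"
  proof (rule ccontr)
    assume "\<not> ?thesis"
    then have "UNIV - {0} \<subseteq> UNIV - S" by auto
    then have "finite (UNIV - {0 :: nat})"
      using S finite_subset unfolding numerical_semigroup_def by blast
    then show False by simp
  qed
  then obtain x where x: "x \<in> S \<and> x \<noteq> 0" "\<And>u. u < x \<Longrightarrow> \<not> (u \<in> S \<and> u \<noteq> 0)"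
    using exists_least_iff[of "\<lambda>u. u \<in> S \<and> u \<noteq> 0"] by blast
  have "x \<in> min_gens S"
  proof -
    have "x \<noteq> a + b" if "a \<in> S" "b \<in> S" "a \<noteq> 0" "b \<noteq> 0" for a b
      using x(2)[of a] that by auto
    then show ?thesis using x(1) unfolding min_gens_def by blast
  qed
  moreover have "x \<le> k" if "k \<in> min_gens S" for k
    using x(2)[of k] that unfolding min_gens_def by (metis (mono_tags, lifting) mem_Collect_eq not_less)
  ultimately have "semigroup_multiplicity S = x"
    unfolding semigroup_multiplicity_def using finite_min_gens[OF S] by (intro Min_eqI) auto
  then show "semigroup_multiplicity S \<in> min_gens S" "0 < semigroup_multiplicity S"
    and "u \<in> S \<Longrightarrow> u \<noteq> 0 \<Longrightarrow> semigroup_multiplicity S \<le> u"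
    using x \<open>x \<in> min_gens S\<close> by (auto simp: not_less[symmetric])
qed

lemma arf_semigroup_diff:
  assumes "arf_semigroup S" "n \<in> S" "a \<in> S" "b \<in> S" "n \<le> a" "n \<le> b"
  obtains v where "v \<in> S" "a + b = n + v"
proof -
  let ?S = "{s - n |s. s \<in> S \<and> s \<ge> n}"
  have "numerical_semigroup ?S" using assms(1,2) unfolding arf_semigroup_def by blast
  then have "(a - n) + (b - n) \<in> ?S" using assms by (intro numerical_semigroupD(2)) auto
  then obtain s where "s \<in> S" "s \<ge> n" "(a - n) + (b - n) = s - n" by blast
  then show thesis using assms by (intro that[of s]) auto
qed

text \<open>A sum of two nonzero elements, both at least m, stays in \<open>S\<close> after
  subtracting m by the Arf property. So the Apery set of m consists of 0 and the generators other
  than m: maximal embedding dimension.\<close>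

lemma arf_apery:
  assumes S: "arf_semigroup S"
  shows "u \<in> S \<Longrightarrow> u = 0 \<or> u \<in> min_gens S - {semigroup_multiplicity S} \<or>
      (\<exists>v\<in>S. u = semigroup_multiplicity S + v)"
    and "n \<in> min_gens S - {semigroup_multiplicity S} \<Longrightarrow> v \<in> S \<Longrightarrow> n \<noteq> semigroup_multiplicity S + v"
proof -
  have ns: "numerical_semigroup S" using S unfolding arf_semigroup_def by blast
  note m = semigroup_multiplicity[OF ns]
  have mS: "semigroup_multiplicity S \<in> S" using m(1) unfolding min_gens_def by blast
  show "u = 0 \<or> u \<in> min_gens S - {semigroup_multiplicity S} \<or>
      (\<exists>v\<in>S. u = semigroup_multiplicity S + v)" if u: "u \<in> S"
  proof (cases "u = 0 \<or> u \<in> min_gens S")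
    case True
    then show ?thesis using numerical_semigroupD(1)[OF ns] by auto
  next
    case False
    then obtain a b where "a \<in> S" "b \<in> S" "a \<noteq> 0" "b \<noteq> 0" "u = a + b"
      using u unfolding min_gens_def by blast
    then obtain v where "v \<in> S" "u = semigroup_multiplicity S + v"
      using arf_semigroup_diff[OF S mS, of a b] m(3) by metis
    then show ?thesis by blast
  qed
  show "n \<noteq> semigroup_multiplicity S + v"
    if n: "n \<in> min_gens S - {semigroup_multiplicity S}" and v: "v \<in> S"
  proof
    assume eq: "n = semigroup_multiplicity S + v"
    then have "v \<noteq> 0" using n by auto
    then show False using n v eq mS m(2) unfolding min_gens_def by blast
  qed
qed

text \<open>The right side depends on \<open>S\<close> only through the generators other than the
  multiplicity, and not on the field.\<close>

lemma betti_arf: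
  assumes S: "arf_semigroup S" and i: "i \<ge> 1"
  shows "betti TYPE('k::field) S i s =
    card {J. J \<subseteq> min_gens S - {semigroup_multiplicity S} \<and> card J = i \<and>
      (\<exists>n\<in>min_gens S - {semigroup_multiplicity S}. int (n + \<Sum>J) = s)} -
    card {J. J \<subseteq> min_gens S - {semigroup_multiplicity S} \<and> card J = Suc i \<and> int (\<Sum>J) = s}"
    (is "_ = ?rhs")
proof -
  have ns: "numerical_semigroup S" using S unfolding arf_semigroup_def by blast
  note m = semigroup_multiplicity[OF ns]
  have GS: "j \<in> S" "j \<noteq> 0" if "j \<in> min_gens S" for j using that unfolding min_gens_def by auto
  define F :: "'k free_complex" where "F = (SOME F. graded_free_resolution S F)"
  have "graded_free_resolution S F"
    unfolding F_def by (rule someI_ex[OF graded_free_resolution_exists[OF ns]])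
  then interpret res: semigroup_resolution S F by unfold_locales (rule ns)
  obtain p where p: "i = Suc p" using i by (cases i) auto
  have "\<exists>v\<in>S. j + u = semigroup_multiplicity S + v" if "j \<in> min_gens S" "u \<in> S" "u \<noteq> 0" for j u
    using arf_semigroup_diff[OF S GS(1)[OF m(1)] GS(1)[OF that(1)] that(2)] m(3) that GS by metis
  moreover have "semigroup_multiplicity S \<le> k" if "k \<in> min_gens S" for k
    using m(3) GS[OF that] by blast
  ultimately have homology: "vector_space.dim (\<lambda>k c x. k * c x)
      {a \<in> degree_chains S i s. simplicial_koszul (min_gens S) a = (0 :: nat set \<Rightarrow> 'k)} -
    vector_space.dim (\<lambda>k c x. k * c x)
      (simplicial_koszul (min_gens S) ` (degree_chains S (Suc i) s :: (nat set \<Rightarrow> 'k) set)) = ?rhs"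
    by (intro koszul_homology_max_embedding_dim[OF res.finite_gens numerical_semigroupD(2)[OF ns]
      numerical_semigroupD(1)[OF ns] m(1) _ refl _ arf_apery(1)[OF S] i])
  have "betti TYPE('k) S i s = kvec.dim (tor_cycles F i s) - kvec.dim (tor_boundaries F i s)"
    unfolding betti_def F_def Let_def ..
  also have "\<dots> = vector_space.dim (\<lambda>k c x. k * c x)
      {a \<in> degree_chains S i s. simplicial_koszul (min_gens S) a = (0 :: nat set \<Rightarrow> 'k)} -
    vector_space.dim (\<lambda>k c x. k * c x)
      (simplicial_koszul (min_gens S) ` (degree_chains S (Suc i) s :: (nat set \<Rightarrow> 'k) set))"
    unfolding p by (rule res.tor_eq_koszul_homology)
  finally show ?thesis unfolding homology .
qed

text \<open>The right side is a semigroup by the Arf property and contains the generators of the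
  blowup. Conversely a sum is lowered by m in one summand only: \<open>a + b - m\<close> is
  \<open>(a - m) + b\<close>.\<close>

lemma blowup_eq_diff:
  assumes S: "arf_semigroup S"
  defines "m \<equiv> semigroup_multiplicity S"
  shows "blowup S = {s - m |s. s \<in> S \<and> s \<ge> m}"
proof -
  let ?S = "{s - m |s. s \<in> S \<and> s \<ge> m}"
  have ns: "numerical_semigroup S" using S unfolding arf_semigroup_def by blast
  note m = semigroup_multiplicity[OF ns, folded m_def]
  have GS: "j \<in> S" "j \<noteq> 0" if "j \<in> min_gens S" for j using that unfolding min_gens_def by auto
  have S': "numerical_semigroup ?S" using S GS(1)[OF m(1)] unfolding arf_semigroup_def by blast
  let ?A = "insert m ((\<lambda>n. n - m) ` (min_gens S - {m}))"
  have A: "blowup S = nat_span ?A" unfolding blowup_def m_def ..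
  have AS: "?A \<subseteq> ?S"
  proof -
    have "m + m \<in> S" using numerical_semigroupD(2)[OF ns] GS(1)[OF m(1)] by blast
    then have "m \<in> ?S" by (intro CollectI exI[of _ "m + m"]) auto
    moreover have "n - m \<in> ?S" if "n \<in> min_gens S" for n using GS[OF that] m(3) by blast
    ultimately show ?thesis by auto
  qed
  have "nat_span ?A \<subseteq> ?S"
  proof
    fix x assume "x \<in> nat_span ?A"
    then obtain X c where X: "finite X" "X \<subseteq> ?A" "x = (\<Sum>a\<in>X. c a * a)" unfolding nat_span_def by blast
    have scale: "k * a \<in> ?S" if "a \<in> ?S" for k a
    proof (induction k)
      case 0
      then show ?case using numerical_semigroupD(1)[OF S'] by (simp only: mult_0)
    next
      case (Suc k)
      then show ?case using numerical_semigroupD(2)[OF S' that Suc] by (simp only: mult_Suc)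
    qed
    have mult: "c a * a \<in> ?S" if "a \<in> X" for a
      by (rule scale[OF subsetD[OF AS subsetD[OF X(2) that]]])
    have "(\<Sum>a\<in>Y. c a * a) \<in> ?S" if "finite Y" "Y \<subseteq> X" for Y
      using that
    proof (induction Y rule: finite_induct)
      case empty
      then show ?case using numerical_semigroupD(1)[OF S'] by (simp only: sum.empty)
    next
      case (insert a Y)
      have "c a * a + (\<Sum>a\<in>Y. c a * a) \<in> ?S"
        by (rule numerical_semigroupD(2)[OF S' mult insert.IH]) (use insert.prems in auto)
      then show ?case by (simp only: sum.insert[OF insert(1,2)])
    qed
    then show "x \<in> ?S" unfolding X(3) using X(1) by blast
  qed
  moreover have "?S \<subseteq> nat_span ?A"
  proof -
    have gen: "n \<in> nat_span ?A \<and> n - m \<in> nat_span ?A" if n: "n \<in> min_gens S" for n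
    proof (cases "n = m")
      case True
      then show ?thesis using nat_span_base[of m ?A] nat_span_0 by simp
    next
      case False
      then have "n - m \<in> nat_span ?A" "m \<in> nat_span ?A" using n by (auto intro: nat_span_base)
      then have "n - m + m \<in> nat_span ?A" by (rule nat_span_add)
      moreover have "n - m + m = n" using m(3)[OF GS[OF n]] by simp
      ultimately show ?thesis using \<open>n - m \<in> nat_span ?A\<close> by simp
    qed
    \<comment> \<open>The induction carries both claims, since the unlowered summand
      \<open>b\<close> must itself be in the span.\<close>
    have "x \<in> nat_span ?A \<and> (x \<noteq> 0 \<longrightarrow> x - m \<in> nat_span ?A)" if "x \<in> S" for x
      using that
    proof (induction x rule: less_induct)
      case (less x)
      show ?case
      proof (cases "x = 0 \<or> x \<in> min_gens S")
        case True
        then show ?thesis using gen nat_span_0 by auto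
      next
        case False
        then obtain a b where ab: "a \<in> S" "b \<in> S" "a \<noteq> 0" "b \<noteq> 0" "x = a + b"
          using less.prems unfolding min_gens_def by blast
        then have *: "a \<in> nat_span ?A" "a - m \<in> nat_span ?A" "b \<in> nat_span ?A"
          using less.IH[of a] less.IH[of b] by auto
        have "x - m = a - m + b" using m(3)[OF ab(1,3)] ab(5) by simp
        then show ?thesis using nat_span_add[OF *(1,3)] nat_span_add[OF *(2,3)] ab(5) by simp
      qed
    qed
    then show ?thesis using m(2) by force
  qed
  ultimately show ?thesis unfolding A by blast
qed

text \<open>The condition for the blowup at \<open>s - m\<close> is the condition for
  \<open>S\<close> at \<open>s\<close>, since subtracting \<open>m\<close> and then
  \<open>s - m\<close> amounts to subtracting \<open>s\<close>.\<close>

lemma arf_blowup: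
  assumes S: "arf_semigroup S"
  shows "arf_semigroup (blowup S)"
proof -
  define m where "m = semigroup_multiplicity S"
  have ns: "numerical_semigroup S" using S unfolding arf_semigroup_def by blast
  have mS: "m \<in> S" using semigroup_multiplicity(1)[OF ns] unfolding m_def min_gens_def by blast
  have blowup: "blowup S = {s - m |s. s \<in> S \<and> s \<ge> m}"
    using blowup_eq_diff[OF S] unfolding m_def .
  have arf: "n \<in> S \<Longrightarrow> numerical_semigroup {s - n |s. s \<in> S \<and> s \<ge> n}" for n
    using S unfolding arf_semigroup_def by blast
  have "numerical_semigroup {x - n |x. x \<in> blowup S \<and> x \<ge> n}" if n: "n \<in> blowup S" for n
  proof -
    obtain s where s: "s \<in> S" "s \<ge> m" "n = s - m" using n unfolding blowup by blast
    have "{x - n |x. x \<in> blowup S \<and> x \<ge> n} = {t - s |t. t \<in> S \<and> t \<ge> s}"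
    proof (intro set_eqI iffI)
      fix y assume "y \<in> {x - n |x. x \<in> blowup S \<and> x \<ge> n}"
      then obtain t where t: "t \<in> S" "t \<ge> m" "t - m \<ge> n" "y = t - m - n" unfolding blowup by blast
      then show "y \<in> {t - s |t. t \<in> S \<and> t \<ge> s}"
        using s by (intro CollectI exI[of _ t]) auto
    next
      fix y assume "y \<in> {t - s |t. t \<in> S \<and> t \<ge> s}"
      then obtain t where t: "t \<in> S" "t \<ge> s" "y = t - s" by blast
      then have "t - m \<in> blowup S" unfolding blowup using s(2) by (intro CollectI exI[of _ t]) auto
      then show "y \<in> {x - n |x. x \<in> blowup S \<and> x \<ge> n}"
        using t s by (intro CollectI exI[of _ "t - m"]) auto
    qed
    then show ?thesis using arf[OF s(1)] by simp
  qed
  moreover have "numerical_semigroup (blowup S)" unfolding blowup by (rule arf[OF mS])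
  ultimately show ?thesis unfolding arf_semigroup_def by blast
qed

text \<open>With equal multiplicities both sides are nonzero Apery elements of the same m, so it
  suffices that \<open>s - m\<close> is divisible by m in the blowup exactly when \<open>s\<close>
  exceeds an element of \<open>S\<close> by m. The case \<open>s = m\<close> corresponds to 0 and is
  excluded on both sides.\<close>

lemma min_gens_blowup:
  assumes S: "arf_semigroup S" and mult: "semigroup_multiplicity (blowup S) = m"
    and m: "m = semigroup_multiplicity S"
  shows "min_gens (blowup S) - {m} = (\<lambda>n. n - m) ` (min_gens S - {m})"
proof -
  have ns: "numerical_semigroup S" using S unfolding arf_semigroup_def by blast
  note least = semigroup_multiplicity(3)[OF ns, folded m]
  have blowup: "blowup S = {s - m |s. s \<in> S \<and> s \<ge> m}" using blowup_eq_diff[OF S] unfolding m .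
  have mS: "m \<in> S" "m > 0" using semigroup_multiplicity(1,2)[OF ns] unfolding m min_gens_def by auto
  note apery = arf_apery[OF S, folded m]
  note apery' = arf_apery[OF arf_blowup[OF S], unfolded mult]
  have S0: "0 \<in> S" by (rule numerical_semigroupD(1)[OF ns])
  show ?thesis
  proof (intro set_eqI iffI)
    fix x assume x: "x \<in> min_gens (blowup S) - {m}"
    then have x': "x \<in> blowup S" "x \<noteq> 0" unfolding min_gens_def by auto
    then obtain s where s: "s \<in> S" "s \<ge> m" "x = s - m" unfolding blowup by blast
    have "s \<noteq> m + v" if v: "v \<in> S" for v
    proof
      assume eq: "s = m + v"
      then have "v \<noteq> 0" using s(3) x'(2) by auto
      then have "v \<ge> m" using least v by blast
      then have "v - m \<in> blowup S" "x = m + (v - m)" using v eq s(3) unfolding blowup by auto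
      then show False using apery'(2)[OF x] by blast
    qed
    then have "s \<in> min_gens S - {m}" using apery(1)[OF s(1)] s(2) mS(2) by auto
    then show "x \<in> (\<lambda>n. n - m) ` (min_gens S - {m})" using s(3) by blast
  next
    fix x assume "x \<in> (\<lambda>n. n - m) ` (min_gens S - {m})"
    then obtain n where n: "n \<in> min_gens S - {m}" "x = n - m" by blast
    then have nS: "n \<in> S" "n \<noteq> 0" unfolding min_gens_def by auto
    then have nm: "n \<ge> m" using least by blast
    have "x \<in> blowup S" using nS(1) nm n(2) unfolding blowup by blast
    moreover have "x \<noteq> 0" using n nm by auto
    moreover have "x \<noteq> m + v" if v: "v \<in> blowup S" for v
    proof
      assume eq: "x = m + v"
      obtain s where s: "s \<in> S" "s \<ge> m" "v = s - m" using v unfolding blowup by blast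
      then have "n = m + s" using eq n(2) nm mS(2) by auto
      then show False using apery(2)[OF n(1) s(1)] by blast
    qed
    ultimately show "x \<in> min_gens (blowup S) - {m}" using apery'(1) by blast
  qed
qed

text \<open>The shift is injective on \<open>N\<close> because the subtraction is never truncated
  there, so taking images is a bijection on subsets preserving cardinality.\<close>

lemma card_subsets_shift:
  fixes N :: "nat set"
  assumes m: "\<And>n. n \<in> N \<Longrightarrow> m \<le> n" and R: "\<And>J. J \<subseteq> N \<Longrightarrow> finite J \<Longrightarrow> card J = k \<Longrightarrow> R ((\<lambda>n. n - m) ` J) \<longleftrightarrow> R' J"
    and fin: "finite N"
  shows "card {J. J \<subseteq> (\<lambda>n. n - m) ` N \<and> card J = k \<and> R J} = card {J. J \<subseteq> N \<and> card J = k \<and> R' J}"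
proof -
  let ?f = "\<lambda>n. n - m"
  have inj: "inj_on ?f N" using m by (intro inj_onI) (metis le_add_diff_inverse)
  have cardf: "card (?f ` J) = card J" if "J \<subseteq> N" for J
    using card_image inj_on_subset[OF inj that] by blast
  have "{J. J \<subseteq> ?f ` N \<and> card J = k \<and> R J} = (`) ?f ` {J. J \<subseteq> N \<and> card J = k \<and> R' J}"
  proof (intro set_eqI iffI)
    fix L assume L: "L \<in> {J. J \<subseteq> ?f ` N \<and> card J = k \<and> R J}"
    then obtain J where J: "J \<subseteq> N" "L = ?f ` J" using subset_image_iff[of L ?f N] by auto
    then show "L \<in> (`) ?f ` {J. J \<subseteq> N \<and> card J = k \<and> R' J}"
      using L R[OF J(1) finite_subset[OF J(1) fin]] cardf[OF J(1)] by auto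
  next
    fix L assume "L \<in> (`) ?f ` {J. J \<subseteq> N \<and> card J = k \<and> R' J}"
    then obtain J where J: "J \<subseteq> N" "card J = k" "R' J" "L = ?f ` J" by blast
    then show "L \<in> {J. J \<subseteq> ?f ` N \<and> card J = k \<and> R J}"
      using R[OF J(1) finite_subset[OF J(1) fin]] cardf[OF J(1)] by auto
  qed
  moreover have "inj_on ((`) ?f) {J. J \<subseteq> N \<and> card J = k \<and> R' J}"
    by (rule inj_on_subset[OF inj_on_image_Pow[OF inj]]) auto
  ultimately show ?thesis by (simp add: card_image)
qed

text \<open>The range \<open>i \<ge> 1\<close> is the right one: in homological degree 0 each
  semigroup ring has a single Betti number 1, in degree 0 for both, so no shift by the multiplicity
  can occur.\<close>

theorem theorem2p1:
  fixes S :: "nat set" and i :: nat and s :: int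
  assumes "arf_semigroup S"
    and "semigroup_multiplicity (blowup S) = semigroup_multiplicity S"
    and "i \<ge> 1"
  shows "betti TYPE('k::field) (blowup S) i s =
         betti TYPE('k) S i (s + (int i + 1) * int (semigroup_multiplicity S))"
proof -
  define m where "m = semigroup_multiplicity S"
  define N where "N = min_gens S - {m}"
  have ns: "numerical_semigroup S" using assms(1) unfolding arf_semigroup_def by blast
  have fin: "finite N" unfolding N_def using finite_min_gens[OF ns] by blast
  have le: "m \<le> n" if "n \<in> N" for n
    using that semigroup_multiplicity(3)[OF ns] unfolding N_def m_def min_gens_def by blast
  have N': "min_gens (blowup S) - {m} = (\<lambda>n. n - m) ` N"
    unfolding N_def by (rule min_gens_blowup[OF assms(1)]) (simp_all add: assms(2) m_def)
  have sum: "int (\<Sum>((\<lambda>n. n - m) ` J)) = int (\<Sum>J) - int (card J) * int m" if J: "J \<subseteq> N" for J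
  proof -
    have "inj_on (\<lambda>n. n - m) J" using le J by (intro inj_onI) (metis le_add_diff_inverse subsetD)
    then have "int (\<Sum>((\<lambda>n. n - m) ` J)) = (\<Sum>n\<in>J. int (n - m))" by (simp add: sum.reindex)
    also have "\<dots> = (\<Sum>n\<in>J. int n - int m)" by (rule sum.cong) (use le J in \<open>auto simp: of_nat_diff\<close>)
    finally show ?thesis by (simp add: sum_subtractf)
  qed
  \<comment> \<open>Both cardinalities involve \<open>i + 1\<close> shifted generators:
    \<open>i\<close> in \<open>J\<close> and one more as \<open>n\<close>, or all of them in
    \<open>J\<close>. This is the origin of the factor \<open>i + 1\<close>.\<close>
  let ?t = "s + (int i + 1) * int m"
  have "card {J. J \<subseteq> (\<lambda>n. n - m) ` N \<and> card J = i \<and> (\<exists>n\<in>(\<lambda>n. n - m) ` N. int (n + \<Sum>J) = s)} =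
      card {J. J \<subseteq> N \<and> card J = i \<and> (\<exists>n\<in>N. int (n + \<Sum>J) = ?t)}"
  proof (rule card_subsets_shift[OF le _ fin])
    fix J assume J: "J \<subseteq> N" "card J = i"
    have "int (n - m + \<Sum>((\<lambda>n. n - m) ` J)) = s \<longleftrightarrow> int (n + \<Sum>J) = ?t" if "n \<in> N" for n
      unfolding of_nat_add sum[OF J(1)] J(2) using le[OF that] by (simp add: of_nat_diff algebra_simps)
    then show "(\<exists>n\<in>(\<lambda>n. n - m) ` N. int (n + \<Sum>((\<lambda>n. n - m) ` J)) = s) \<longleftrightarrow>
        (\<exists>n\<in>N. int (n + \<Sum>J) = ?t)" by blast
  qed
  moreover have "card {J. J \<subseteq> (\<lambda>n. n - m) ` N \<and> card J = Suc i \<and> int (\<Sum>J) = s} =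
      card {J. J \<subseteq> N \<and> card J = Suc i \<and> int (\<Sum>J) = ?t}"
  proof (rule card_subsets_shift[OF le _ fin])
    fix J assume J: "J \<subseteq> N" "card J = Suc i"
    show "int (\<Sum>((\<lambda>n. n - m) ` J)) = s \<longleftrightarrow> int (\<Sum>J) = ?t"
      unfolding sum[OF J(1)] J(2) by (simp add: algebra_simps)
  qed
  ultimately show ?thesis
    unfolding betti_arf[OF arf_blowup[OF assms(1)] assms(3)] betti_arf[OF assms(1,3)] assms(2)
      m_def[symmetric] N_def[symmetric] N' by simp
qed

end
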